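(* Let $d,c\ge1$ be integers and let $L_{d,c}=\frac1{\mu_S(S)}\int_S\rho\,d\mu_S$, which is also the $\mu$-almost sure value of $\lim_{n\to\infty}\frac1n\ln q_n(\Lambda)$, $\Lambda\in\mathcal{L}_{d+c}$. Then $$L_{d,c}=\frac{d}{\mu_S(S)}\int_S\tau\,d\mu_S=\frac{d\times\mu(\mathcal{L}_{d+c})}{\mu_S(S)}.$$
   Context: $\mathbb{R}^d,\mathbb{R}^c$ carry the standard Euclidean norms. For $X=(u,h)\in\mathbb{R}^d\times\mathbb{R}^c$ put $|X|_+=\|u\|_{\mathbb{R}^d}$, $|X|_-=\|h\|_{\mathbb{R}^c}$, $\|X\|_{d,c}=\max(|X|_+,|X|_-)$; $B_{d,c}(0,r)$ is the closed $r$-ball of $\|\cdot\|_{d,c}$. $\mathcal{L}_{d+c}=\mathrm{SL}(d+c,\mathbb{R})/\mathrm{SL}(d+c,\mathbb{Z})$ is the space of unimodular lattices of $\mathbb{R}^{d+c}$, $\mu$ a fixed nonzero (finite) $\mathrm{SL}(d+c,\mathbb{R})$-invariant measure on it, $\lambda_1(\Lambda)$ the length of a shortest nonzero vector of $\Lambda$ for $\|\cdot\|_{d,c}$, and $g_t=\mathrm{diag}(e^{ct}I_d,e^{-dt}I_c)$, $t\in\mathbb{R}$. Minimal vectors: with $C(X)=\{Y:|Y|_+\le|X|_+,|Y|_-\le|X|_-\}$, a nonzero $X\in\Lambda$ is minimal if every nonzero $Y\in\Lambda\cap C(X)$ satisfies $|Y|_\pm=|X|_\pm$; minimal vectors with $C(X)=C(Y)$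 are equivalent. One minimal vector per class, numbered by increasing $|\cdot|_-$, gives $(X_n(\Lambda))_n$ (bi-infinite for almost every $\Lambda$; $n=0$ is the smallest $n$ with $|X_{n+1}(\Lambda)|_-\ge|X_n(\Lambda)|_+$), and $q_n(\Lambda)=|X_n(\Lambda)|_-$. $S$ is the set of $\Lambda\in\mathcal{L}_{d+c}$ for which there are two independent vectors $v_0^S(\Lambda),v_1^S(\Lambda)\in\Lambda$ (unique up to sign) such that $|v_1^S(\Lambda)|_+$ and $|v_0^S(\Lambda)|_-$ are both $<|v_1^S(\Lambda)|_-=|v_0^S(\Lambda)|_+$ and the only nonzero points of $\Lambda$ in $B_{d,c}(0,\lambda_1(\Lambda))$ are $\pm v_0^S(\Lambda),\pm v_1^S(\Lambda)$. On $S$, $\rho(\Lambda)=\ln\frac{|v_1^S(\Lambda)|_-}{|v_0^S(\Lambda)|_-}$. The first return time is $\tau(\Lambda)=\inf\{t>0:g_t\Lambda\in S\}$. Let $\mathcal{N}$ be the set of $\Lambda\in\mathcal{L}_{d+c}$ such that there are $v_1\ne\pm v_2$ in $\Lambda$ with $|v_1|_+=|v_2|_+>0$ or $|v_1|_-=|v_2|_->0$, or such that $\Lambda$ has a nonzero vector in $\mathbb{R}^d\times\{0\}$ or $\{0\}\times\mathbb{R}^c$ (it is $\mu$-negligible and $g_t$-invariant, and $0<\tau<\infty$ off $\mathcal{N}$). $\mu_S$ is the measure on $S$ with $\mu_S(S\cap\mathcal{N})=0$ and $\delta\,\mu_S(B)=\mu\bigl(\bigcup_{t\in[0,\delta]}g_tB\bigr)$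 for all Borel $B\subset S\setminus\mathcal{N}$ and $\delta>0$ with $\tau>\delta$ on $B$. *)

theory Defs
  imports "HOL-Analysis.Analysis"
begin

text \<open>
  Throughout, \<open>d = CARD('d)\<close>, \<open>c = CARD('c)\<close>, and \<open>\<real>\<^sup>d \<times> \<real>\<^sup>c\<close> is the type
  \<^typ>\<open>real^('d::finite + 'c::finite)\<close>, so that matrices and determinants of size
  \<open>d + c\<close> are those of the library.
\<close>

section \<open>The two seminorms on \<open>\<real>\<^sup>d \<times> \<real>\<^sup>c\<close>\<close>

definition u_part :: "real^('d::finite + 'c::finite) \<Rightarrow> real^'d" where
  "u_part X = (\<chi> i. X $ Inl i)"

definition h_part :: "real^('d::finite + 'c::finite) \<Rightarrow> real^'c" where
  "h_part X = (\<chi> j. X $ Inr j)"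

definition norm_plus :: "real^('d::finite + 'c::finite) \<Rightarrow> real" where
  "norm_plus X = norm (u_part X)"

definition norm_minus :: "real^('d::finite + 'c::finite) \<Rightarrow> real" where
  "norm_minus X = norm (h_part X)"

definition norm_dc :: "real^('d::finite + 'c::finite) \<Rightarrow> real" where
  "norm_dc X = max (norm_plus X) (norm_minus X)"

definition ball_dc :: "real \<Rightarrow> (real^('d::finite + 'c::finite)) set" where
  "ball_dc r = {X. norm_dc X \<le> r}"


section \<open>The space of unimodular lattices\<close>

definition SL_real :: "(real^'n::finite^'n) set" where
  "SL_real = {A. det A = 1}"

definition lattice_of :: "real^'n::finite^'n \<Rightarrow> (real^'n) set" where
  "lattice_of A = {A *v z | z. \<forall>i. z $ i \<in> \<int>}"

text \<open>
  The coset \<open>A SL(n,\<int>)\<close> is represented by the lattice \<open>A \<int>\<^sup>n\<close>: two matrices of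
  determinant \<open>1\<close> lie in the same coset iff they generate the same lattice.
\<close>

definition lattice_space :: "(real^'n::finite) set set" where
  "lattice_space = lattice_of ` SL_real"

text \<open>
  Borel \<open>\<sigma>\<close>-algebra of the quotient topology: a set of lattices is open iff its
  preimage under \<open>A \<mapsto> A \<int>\<^sup>n\<close> is open in \<open>SL(n,\<real>)\<close>.
\<close>

definition open_lattice_sets :: "(real^'n::finite) set set set" where
  "open_lattice_sets = {U. U \<subseteq> lattice_space \<and>
     openin (top_of_set SL_real) {A \<in> SL_real. lattice_of A \<in> U}}"

definition lattice_borel :: "(real^'n::finite) set measure" where
  "lattice_borel = sigma lattice_space open_lattice_sets"

definition act :: "real^'n::finite^'n \<Rightarrow> (real^'n) set \<Rightarrow> (real^'n) set" where
  "act A \<Lambda> = (\<lambda>X. A *v X) ` \<Lambda>"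

definition invariant_lattice_measure :: "(real^'n::finite) set measure \<Rightarrow> bool" where
  "invariant_lattice_measure \<mu> \<longleftrightarrow>
     sets \<mu> = sets lattice_borel \<and>
     finite_measure \<mu> \<and>
     emeasure \<mu> lattice_space \<noteq> 0 \<and>
     (\<forall>A\<in>SL_real. \<forall>B\<in>sets \<mu>. emeasure \<mu> (act A ` B) = emeasure \<mu> B)"

definition flow_matrix :: "real \<Rightarrow> real^('d::finite + 'c::finite)^('d + 'c)" where
  "flow_matrix t = (\<chi> i j. if i = j
     then (case i of Inl _ \<Rightarrow> exp (real CARD('c) * t) | Inr _ \<Rightarrow> exp (- real CARD('d) * t))
     else 0)"

definition flow :: "real \<Rightarrow> (real^('d::finite + 'c::finite)) set \<Rightarrow> (real^('d + 'c)) set" where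
  "flow t \<Lambda> = act (flow_matrix t) \<Lambda>"

definition lambda1 :: "(real^('d::finite + 'c::finite)) set \<Rightarrow> real" where
  "lambda1 \<Lambda> = (INF X \<in> \<Lambda> - {0}. norm_dc X)"


section \<open>Minimal vectors\<close>

definition cylinder :: "real^('d::finite + 'c::finite) \<Rightarrow> (real^('d + 'c)) set" where
  "cylinder X = {Y. norm_plus Y \<le> norm_plus X \<and> norm_minus Y \<le> norm_minus X}"

definition minimal_vector ::
    "(real^('d::finite + 'c::finite)) set \<Rightarrow> real^('d + 'c) \<Rightarrow> bool" where
  "minimal_vector \<Lambda> X \<longleftrightarrow> X \<in> \<Lambda> \<and> X \<noteq> 0 \<and>
     (\<forall>Y \<in> \<Lambda> \<inter> cylinder X. Y \<noteq> 0 \<longrightarrow> norm_plus Y = norm_plus X \<and> norm_minus Y = norm_minus X)"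

text \<open>
  Bi-infinite enumerations of the classes of minimal vectors by increasing \<open>norm_minus\<close>;
  strict monotonicity allows at most one representative per class. The last two
  conditions say that \<open>0\<close> is the smallest \<open>n\<close> with
  \<open>norm_minus (X (n + 1)) \<ge> norm_plus (X n)\<close>.
\<close>

definition minimal_sequence ::
    "(real^('d::finite + 'c::finite)) set \<Rightarrow> (int \<Rightarrow> real^('d + 'c)) \<Rightarrow> bool" where
  "minimal_sequence \<Lambda> X \<longleftrightarrow>
     (\<forall>n. minimal_vector \<Lambda> (X n)) \<and>
     (\<forall>Y. minimal_vector \<Lambda> Y \<longrightarrow> (\<exists>n. cylinder Y = cylinder (X n))) \<and>
     strict_mono (\<lambda>n. norm_minus (X n)) \<and>
     norm_minus (X 1) \<ge> norm_plus (X 0) \<and>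
     (\<forall>n<0. \<not> norm_minus (X (n + 1)) \<ge> norm_plus (X n))"

text \<open>
  An arbitrary choice of representatives; meaningful only if \<open>\<Lambda>\<close> has such an enumeration,
  in which case \<open>q \<Lambda>\<close> does not depend on the choice.
\<close>

definition min_vec :: "(real^('d::finite + 'c::finite)) set \<Rightarrow> int \<Rightarrow> real^('d + 'c)" where
  "min_vec \<Lambda> = (SOME X. minimal_sequence \<Lambda> X)"

definition q :: "(real^('d::finite + 'c::finite)) set \<Rightarrow> int \<Rightarrow> real" where
  "q \<Lambda> n = norm_minus (min_vec \<Lambda> n)"


section \<open>The transversal \<open>S\<close>\<close>

definition S_pair ::
    "(real^('d::finite + 'c::finite)) set \<Rightarrow> real^('d + 'c) \<Rightarrow> real^('d + 'c) \<Rightarrow> bool" where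
  "S_pair \<Lambda> v0 v1 \<longleftrightarrow>
     v0 \<in> \<Lambda> \<and> v1 \<in> \<Lambda> \<and> v0 \<noteq> v1 \<and> independent {v0, v1} \<and>
     norm_plus v1 < norm_minus v1 \<and> norm_minus v0 < norm_minus v1 \<and>
     norm_minus v1 = norm_plus v0 \<and>
     (\<Lambda> - {0}) \<inter> ball_dc (lambda1 \<Lambda>) = {v0, - v0, v1, - v1}"

definition S :: "(real^('d::finite + 'c::finite)) set set" where
  "S = {\<Lambda> \<in> lattice_space. \<exists>v0 v1. S_pair \<Lambda> v0 v1}"

text \<open>\<open>v0\<close> and \<open>v1\<close> are unique up to sign, so \<open>\<rho>\<close> does not depend on the choice.\<close>

definition rho :: "(real^('d::finite + 'c::finite)) set \<Rightarrow> real" where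
  "rho \<Lambda> = (let (v0, v1) = (SOME (v0, v1). S_pair \<Lambda> v0 v1)
             in ln (norm_minus v1 / norm_minus v0))"

text \<open>
  The set of return times is nonempty for every lattice outside the negligible set
  \<open>exceptional\<close>; on the latter, the value of the infimum of the empty set is irrelevant.
\<close>

definition tau :: "(real^('d::finite + 'c::finite)) set \<Rightarrow> real" where
  "tau \<Lambda> = Inf {t. t > 0 \<and> flow t \<Lambda> \<in> S}"

definition exceptional :: "(real^('d::finite + 'c::finite)) set set" where
  "exceptional = {\<Lambda> \<in> lattice_space.
     (\<exists>v1\<in>\<Lambda>. \<exists>v2\<in>\<Lambda>. v1 \<noteq> v2 \<and> v1 \<noteq> - v2 \<and>
        (norm_plus v1 = norm_plus v2 \<and> norm_plus v2 > 0 \<or>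
         norm_minus v1 = norm_minus v2 \<and> norm_minus v2 > 0)) \<or>
     (\<exists>v\<in>\<Lambda>. v \<noteq> 0 \<and> (h_part v = 0 \<or> u_part v = 0))}"

definition transversal_measure ::
    "(real^('d::finite + 'c::finite)) set measure \<Rightarrow> (real^('d + 'c)) set measure \<Rightarrow> bool" where
  "transversal_measure \<mu> \<mu>S \<longleftrightarrow>
     sets \<mu>S = sets (restrict_space lattice_borel S) \<and>
     emeasure \<mu>S (S \<inter> exceptional) = 0 \<and>
     (\<forall>B \<delta>. B \<in> sets lattice_borel \<and> B \<subseteq> S - exceptional \<and> \<delta> > 0 \<and> (\<forall>\<Lambda>\<in>B. tau \<Lambda> > \<delta>) \<longrightarrow>
        ennreal \<delta> * emeasure \<mu>S B = emeasure \<mu> (\<Union>t\<in>{0..\<delta>}. flow t ` B))"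

definition levy_const :: "(real^('d::finite + 'c::finite)) set measure \<Rightarrow> real" where
  "levy_const \<mu>S = 1 / measure \<mu>S S * (\<integral>\<Lambda>. rho \<Lambda> \<partial>\<mu>S)"

end

theory Submission
  imports Defs
begin

text \<open>
  Off the exceptional set the orbit of a lattice meets \<open>S\<close> exactly at the times \<open>t\<^sub>n\<close> with
  \<open>(d + c) t\<^sub>n = ln q\<^sub>n\<^sub>+\<^sub>1 - ln r\<^sub>n\<close>, where \<open>r\<^sub>n\<close>, \<open>q\<^sub>n\<close> are the two seminorms of the \<open>n\<close>-th minimal
  vector, and there \<open>\<rho>\<close> equals \<open>ln q\<^sub>n\<^sub>+\<^sub>1 - ln q\<^sub>n\<close>. The defining property of \<open>\<mu>\<^sub>S\<close> upgrades to
  \<open>\<integral>\<^sub>S F d\<mu>\<^sub>S = \<integral> (\<Sum> F(g\<^sub>t \<Lambda>)) d\<mu>\<close>, the sum being over the \<open>t \<in> [0,1)\<close> with \<open>g\<^sub>t \<Lambda> \<in> S\<close>.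
  For \<open>F = \<rho>\<close> the sum telescopes to \<open>d\<close> plus the coboundary of \<open>ln q\<^sub>0\<close>, for \<open>F = \<tau>\<close> to \<open>1\<close> plus a
  coboundary, and for \<open>F = 1\<close> it is bounded by a packing argument. A coboundary bounded below has
  integral zero, which gives all three integrals without the first return map.

  The almost sure limit follows from Birkhoff's theorem for the time-one map, applied to the number of
  returns and to \<open>d\<close> plus the coboundary of \<open>ln q\<^sub>0\<close>. Ergodicity is Mautner's argument: an invariant set
  is almost invariant under both horospherical subgroups, hence under \<open>SL(d+c,\<real>)\<close>, which acts
  transitively.
\<close>

section \<open>Ergodic theory and measurability\<close>

text \<open>Integrability shapes the argument. Nothing is known about the integrability of
  \<open>log_q0\<close> or \<open>first_hit\<close>, so the integral of a coboundary cannot be split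
  into two equal terms. What is known is a sign: \<open>rho\<close> and \<open>tau\<close> are
  nonnegative at generic points of \<open>S\<close>, so the sums over one unit of time are
  nonnegative and the coboundaries are at least \<open>- d\<close> and \<open>- 1\<close>. On a
  finite measure space this one-sided bound is enough, by truncation and Fatou's lemma. The size of
  \<open>\<mu>S\<close> is derived too: the bound on the number of hits per unit of time gives
  \<open>\<mu>S S < \<infinity>\<close>, and the integral of \<open>rho\<close>, being
  \<open>d\<close> times the mass of \<open>\<mu>\<close>, gives \<open>\<mu>S S > 0\<close>. The
  group \<open>SL_real\<close> never receives a Haar measure. Lebesgue measure on all square
  matrices takes its place: matrices of positive determinant are rescaled to determinant one, and
  Fubini exchanges almost every matrix with almost every lattice. This serves both for ergodicity
  and for the nullity of \<open>exceptional\<close>. Measurability rests on a Borel choice of a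
  basis, which turns quantifiers over lattice vectors into countable ones.\<close>

lemma (in finite_measure) coboundary_integral:
  fixes f :: "'a \<Rightarrow> real"
  assumes T [measurable]: "T \<in> measurable M M" and dT: "distr M M T = M"
    and f [measurable]: "f \<in> borel_measurable M"
    and C: "C \<ge> 0" and lb: "AE x in M. f (T x) - f x \<ge> - C"
  shows "integrable M (\<lambda>x. f (T x) - f x)" "(\<integral>x. f (T x) - f x \<partial>M) = 0"
proof -
  \<comment> \<open>Clamping to \<open>[-k, k]\<close> makes both terms integrable, so that
    invariance gives mean zero. As \<open>cl k\<close> is monotone and 1-Lipschitz, a clamped
    increment keeps its sign, does not grow in absolute value and is still at least
    \<open>- C\<close>.\<close>
  define cl where "cl k y = max (- real k) (min (real k) y)" for k and y :: real
  define D where "D k x = cl k (f (T x)) - cl k (f x)" for k x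
  have [measurable]: "cl k \<in> borel_measurable borel" for k
    unfolding cl_def by measurable
  have intcl: "integrable M (\<lambda>x. cl k (f x))" for k
    by (rule integrable_const_bound[of _ "real k"]) (auto simp: cl_def)
  have intclT: "integrable M (\<lambda>x. cl k (f (T x)))" for k
    by (rule integrable_const_bound[of _ "real k"]) (auto simp: cl_def)
  have eq: "(\<integral>x. cl k (f (T x)) \<partial>M) = (\<integral>x. cl k (f x) \<partial>M)" for k
    using integral_distr[of T M M "\<lambda>x. cl k (f x)"] dT by simp
  have intD: "integrable M (D k)" and D0: "(\<integral>x. D k x \<partial>M) = 0" for k
    unfolding D_def using intcl intclT eq by auto
  have lim: "(\<lambda>k. D k x) \<longlonglongrightarrow> f (T x) - f x" for x
  proof -
    obtain k0 where k0: "real k0 \<ge> \<bar>f (T x)\<bar> + \<bar>f x\<bar>" using real_arch_simple by blast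
    have "eventually (\<lambda>k. D k x = f (T x) - f x) sequentially"
      using eventually_ge_at_top[of k0]
    proof eventually_elim
      case (elim k)
      then have "real k \<ge> \<bar>f (T x)\<bar> + \<bar>f x\<bar>" using k0 by linarith
      then show ?case unfolding D_def cl_def by (auto simp: max_def min_def)
    qed
    then show ?thesis by (simp add: tendsto_eventually)
  qed
  have bnd: "\<bar>D k x\<bar> \<le> \<bar>f (T x) - f x\<bar>" for k x
    unfolding D_def cl_def by (auto simp: max_def min_def abs_real_def)
  have lbD: "AE x in M. C + D k x \<ge> 0" for k
    using lb
  proof eventually_elim
    case (elim x)
    show ?case using elim C unfolding D_def cl_def by (auto simp: max_def min_def)
  qed
  \<comment> \<open>As \<open>D k\<close> has mean zero, these integrals do not depend on
    \<open>k\<close>. Fatou's lemma then bounds the integral of the limit, and only after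
    integrability is known can the limit itself serve as the majorant for dominated
    convergence.\<close>
  have nnD: "(\<integral>\<^sup>+x. ennreal (C + D k x) \<partial>M) = ennreal (C * measure M (space M))" for k
  proof -
    have "(\<integral>\<^sup>+x. ennreal (C + D k x) \<partial>M) = ennreal (\<integral>x. C + D k x \<partial>M)"
      by (rule nn_integral_eq_integral) (use intD lbD in auto)
    then show ?thesis using D0 intD by (simp add: mult.commute)
  qed
  have "(\<integral>\<^sup>+x. liminf (\<lambda>k. ennreal (C + D k x)) \<partial>M)
      \<le> liminf (\<lambda>k. \<integral>\<^sup>+x. ennreal (C + D k x) \<partial>M)"
    by (rule nn_integral_liminf) (simp add: D_def)
  moreover have "liminf (\<lambda>k. ennreal (C + D k x)) = ennreal (C + (f (T x) - f x))" for x
    by (rule lim_imp_Liminf) (auto intro!: tendsto_intros lim)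
  ultimately have fin: "(\<integral>\<^sup>+x. ennreal (C + (f (T x) - f x)) \<partial>M) < \<infinity>"
    by (simp add: nnD Liminf_const le_less_trans)
  have "integrable M (\<lambda>x. C + (f (T x) - f x))"
    by (rule integrableI_nonneg) (use lb fin in auto)
  from Bochner_Integration.integrable_diff[OF this integrable_const[of C]]
  show int: "integrable M (\<lambda>x. f (T x) - f x)" by simp
  have "(\<lambda>k. \<integral>x. D k x \<partial>M) \<longlonglongrightarrow> (\<integral>x. f (T x) - f x \<partial>M)"
    by (rule integral_dominated_convergence[where w = "\<lambda>x. \<bar>f (T x) - f x\<bar>"])
       (use int lim bnd in \<open>auto simp: D_def\<close>)
  then show "(\<integral>x. f (T x) - f x \<partial>M) = 0"
    using D0 by (simp add: LIMSEQ_const_iff)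
qed

text \<open>\<open>F n\<close> is the largest of the ergodic sums of lengths \<open>1\<close> to
  \<open>n + 1\<close>, and the set \<open>A\<close> where it is unbounded is invariant. If
  \<open>A\<close> were conull, \<open>F (Suc n) - F n \<circ> T\<close> would converge to
  \<open>f\<close>; its mean is nonnegative because \<open>F\<close> increases with
  \<open>n\<close>, and this contradicts \<open>neg\<close>.\<close>

lemma (in finite_measure) birkhoff_bounded_sums:
  fixes f :: "'a \<Rightarrow> real"
  assumes T [measurable]: "T \<in> measurable M M" and dT: "distr M M T = M"
    and erg: "\<And>B. B \<in> sets M \<Longrightarrow> T -` B \<inter> space M = B \<Longrightarrow>
      emeasure M B = 0 \<or> emeasure M (space M - B) = 0"
    and f: "integrable M f" and neg: "(\<integral>x. f x \<partial>M) < 0"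
  shows "AE x in M. \<exists>K. \<forall>n. (\<Sum>k<n. f ((T ^^ k) x)) \<le> K"
proof -
  have fm [measurable]: "f \<in> borel_measurable M" using f by auto
  define F where "F n = rec_nat f (\<lambda>_ g x. f x + max 0 (g (T x))) n" for n
  have F0: "F 0 = f" and FS: "F (Suc n) = (\<lambda>x. f x + max 0 (F n (T x)))" for n
    by (simp_all add: F_def)
  have intT: "integrable M (\<lambda>x. g (T x))" "(\<integral>x. g (T x) \<partial>M) = (\<integral>x. g x \<partial>M)"
    if "integrable M g" for g :: "'a \<Rightarrow> real"
  proof -
    have [measurable]: "g \<in> borel_measurable M" using that by auto
    show "integrable M (\<lambda>x. g (T x))"
      using integrable_distr_eq[of T M M g] that by (simp add: dT)
    show "(\<integral>x. g (T x) \<partial>M) = (\<integral>x. g x \<partial>M)"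
      using integral_distr[of T M M g] dT by simp
  qed
  have intF: "integrable M (F n)" for n
    by (induction n) (auto simp: F0 FS f intro!: intT(1))
  then have Fm [measurable]: "F n \<in> borel_measurable M" for n by auto
  have mono: "F n x \<le> F (Suc n) x" for n x
  proof (induction n arbitrary: x)
    case 0 then show ?case by (simp add: F0 FS)
  next
    case (Suc n)
    have "F (Suc n) x = f x + max 0 (F n (T x))" "F (Suc (Suc n)) x = f x + max 0 (F (Suc n) (T x))"
      by (simp_all only: FS)
    then show ?case using Suc.IH[of "T x"] by linarith
  qed
  then have mono': "m \<le> n \<Longrightarrow> F m x \<le> F n x" for m n x
    by (rule lift_Suc_mono_le)
  have Sle: "(\<Sum>k<Suc n. f ((T ^^ k) x)) \<le> F n x" for n x
  proof (induction n arbitrary: x)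
    case 0 then show ?case by (simp add: F0)
  next
    case (Suc n)
    have "(\<Sum>k<Suc (Suc n). f ((T ^^ k) x)) = f x + (\<Sum>k<Suc n. f ((T ^^ k) (T x)))"
      by (subst sum.lessThan_Suc_shift) (simp add: funpow_swap1)
    also have "\<dots> \<le> F (Suc n) x" using Suc.IH[of "T x"] by (simp add: FS)
    finally show ?case .
  qed
  define A where "A = {x \<in> space M. \<forall>K::nat. \<exists>n. F n x > real K}"
  have Am [measurable]: "A \<in> sets M" unfolding A_def by measurable
  have inv: "(\<forall>K::nat. \<exists>n. F n (T x) > real K) \<longleftrightarrow> (\<forall>K::nat. \<exists>n. F n x > real K)" for x
  proof
    assume h: "\<forall>K::nat. \<exists>n. F n (T x) > real K"
    show "\<forall>K::nat. \<exists>n. F n x > real K"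
    proof
      fix K :: nat
      obtain K' :: nat where "real K' \<ge> real K - f x" using real_arch_simple by blast
      moreover obtain n where "F n (T x) > real K'" using h by blast
      ultimately have "F (Suc n) x > real K" by (auto simp: FS max_def)
      then show "\<exists>n. F n x > real K" by blast
    qed
  next
    assume h: "\<forall>K::nat. \<exists>n. F n x > real K"
    show "\<forall>K::nat. \<exists>n. F n (T x) > real K"
    proof
      fix K :: nat
      obtain K' :: nat where K': "real K' \<ge> real K + \<bar>f x\<bar>" using real_arch_simple by blast
      moreover obtain n where n: "F n x > real K'" using h by blast
      ultimately have "F (Suc n) x > real K'" using mono[of n x] by linarith
      then have "F n (T x) > real K" using K' by (auto simp: FS max_def split: if_splits)
      then show "\<exists>n. F n (T x) > real K" by blast
    qed
  qed
  have "T -` A \<inter> space M = A"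
    using measurable_space[OF T] inv unfolding A_def by auto
  from erg[OF Am this] have "emeasure M A = 0"
  proof
    assume co: "emeasure M (space M - A) = 0"
    have AEA: "AE x in M. x \<in> A"
      by (rule AE_I[where N = "space M - A"]) (use co in auto)
    \<comment> \<open>Once \<open>F n (T x)\<close> is positive, the maximum with \<open>0\<close>
      in the recursion is \<open>F n (T x)\<close> and \<open>D n x\<close> equals
      \<open>f x\<close>. The majorant used below comes from \<open>F n \<ge> f\<close>.\<close>
    define D where "D n x = F (Suc n) x - F n (T x)" for n x
    have lim: "AE x in M. (\<lambda>n. D n x) \<longlonglongrightarrow> f x"
      using AEA
    proof eventually_elim
      case (elim x)
      then have "\<forall>K::nat. \<exists>n. F n (T x) > real K" unfolding A_def using inv by auto
      from spec[OF this, of 0] obtain n0 where n0: "F n0 (T x) > 0" by auto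
      have "eventually (\<lambda>n. D n x = f x) sequentially"
        using eventually_ge_at_top[of n0]
      proof eventually_elim
        case (elim n)
        have "F n (T x) > 0" using n0 mono'[OF elim, of "T x"] by linarith
        then show ?case by (simp add: D_def FS)
      qed
      then show ?case by (simp add: tendsto_eventually)
    qed
    have "(\<lambda>n. \<integral>x. D n x \<partial>M) \<longlonglongrightarrow> (\<integral>x. f x \<partial>M)"
    proof (rule integral_dominated_convergence[where w = "\<lambda>x. \<bar>f x\<bar> + \<bar>f (T x)\<bar>"])
      show "integrable M (\<lambda>x. \<bar>f x\<bar> + \<bar>f (T x)\<bar>)" using f intT(1)[OF f] by auto
      show "AE x in M. norm (D n x) \<le> \<bar>f x\<bar> + \<bar>f (T x)\<bar>" for n
      proof (rule AE_I2)
        fix x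
        have "f (T x) \<le> F n (T x)" using mono'[of 0 n "T x"] by (simp add: F0)
        then show "norm (D n x) \<le> \<bar>f x\<bar> + \<bar>f (T x)\<bar>"
          unfolding D_def FS real_norm_def by linarith
      qed
    qed (use lim in \<open>auto simp: D_def\<close>)
    moreover have "(\<integral>x. D n x \<partial>M) \<ge> 0" for n
    proof -
      have "(\<integral>x. D n x \<partial>M) = (\<integral>x. F (Suc n) x \<partial>M) - (\<integral>x. F n x \<partial>M)"
        unfolding D_def using intF intT by auto
      also have "\<dots> \<ge> 0" using integral_mono[OF intF[of n] intF[of "Suc n"]] mono by auto
      finally show ?thesis .
    qed
    ultimately have "(\<integral>x. f x \<partial>M) \<ge> 0" by (intro LIMSEQ_le_const) auto
    then show ?thesis using neg by simp
  qed
  then have "AE x in M. x \<notin> A" using Am by (intro AE_not_in) (auto simp: null_sets_def)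
  then show ?thesis using AE_space
  proof eventually_elim
    case (elim x)
    then obtain K :: nat where K: "\<And>n. F n x \<le> real K" unfolding A_def by (auto simp: not_less)
    have "(\<Sum>k<n. f ((T ^^ k) x)) \<le> max 0 (real K)" for n
      by (cases n) (use Sle K order_trans in \<open>fastforce\<close>)+
    then show ?case by blast
  qed
qed

text \<open>Subtracting slightly more than the mean leaves a function of negative integral, whose
  ergodic sums are bounded above; division by \<open>n\<close> then bounds the averages
  asymptotically. The same applies to \<open>- f\<close>. The slack runs through
  \<open>1 / Suc j\<close>, so only countably many null sets are discarded.\<close>

lemma (in finite_measure) birkhoff_ergodic:
  fixes f :: "'a \<Rightarrow> real"
  assumes T [measurable]: "T \<in> measurable M M" and dT: "distr M M T = M"
    and erg: "\<And>B. B \<in> sets M \<Longrightarrow> T -` B \<inter> space M = B \<Longrightarrow>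
      emeasure M B = 0 \<or> emeasure M (space M - B) = 0"
    and f: "integrable M f" and pos: "measure M (space M) > 0"
  shows "AE x in M. (\<lambda>n. (\<Sum>k<n. f ((T ^^ k) x)) / real n)
           \<longlonglongrightarrow> (\<integral>x. f x \<partial>M) / measure M (space M)"
proof -
  define L where "L = (\<integral>x. f x \<partial>M) / measure M (space M)"
  have up: "AE x in M. \<exists>K. \<forall>n. (\<Sum>k<n. g ((T ^^ k) x)) - real n * (c + 1 / real (Suc j)) \<le> K"
    if g: "integrable M g" and c: "c = (\<integral>x. g x \<partial>M) / measure M (space M)" for g c j
  proof -
    have "AE x in M. \<exists>K. \<forall>n. (\<Sum>k<n. g ((T ^^ k) x) - (c + 1 / real (Suc j))) \<le> K"
    proof (rule birkhoff_bounded_sums[OF T dT erg])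
      show "integrable M (\<lambda>x. g x - (c + 1 / real (Suc j)))" using g by auto
      have "(\<integral>x. g x - (c + 1 / real (Suc j)) \<partial>M)
          = (\<integral>x. g x \<partial>M) - measure M (space M) * (c + 1 / real (Suc j))"
        using g by simp
      also have "\<dots> = - measure M (space M) / real (Suc j)"
        unfolding c using pos by (simp add: distrib_left)
      also have "\<dots> < 0" using pos by simp
      finally show "(\<integral>x. g x - (c + 1 / real (Suc j)) \<partial>M) < 0" .
    qed
    then show ?thesis by (simp add: sum_subtractf)
  qed
  have a1: "AE x in M. \<forall>j. \<exists>K. \<forall>n. (\<Sum>k<n. f ((T ^^ k) x)) - real n * (L + 1 / real (Suc j)) \<le> K"
    unfolding AE_all_countable using up[OF f L_def] by blast
  have a2: "AE x in M. \<forall>j. \<exists>K. \<forall>n. (\<Sum>k<n. - f ((T ^^ k) x)) - real n * (- L + 1 / real (Suc j)) \<le> K"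
    unfolding AE_all_countable using up[of "\<lambda>x. - f x" "- L"] f by (auto simp: L_def)
  from a1 a2 show ?thesis unfolding L_def[symmetric]
  proof eventually_elim
    case (elim x)
    show ?case
    proof (rule LIMSEQ_I)
      fix r :: real assume r: "r > 0"
      obtain j where j: "1 / real (Suc j) < r / 2"
        using reals_Archimedean[of "r / 2"] r by (auto simp: inverse_eq_divide)
      obtain K1 where K1: "\<And>n. (\<Sum>k<n. f ((T ^^ k) x)) - real n * (L + 1 / real (Suc j)) \<le> K1"
        using elim(1) by blast
      obtain K2 where K2: "\<And>n. - (\<Sum>k<n. f ((T ^^ k) x)) - real n * (- L + 1 / real (Suc j)) \<le> K2"
        using elim(2) by (auto simp: sum_negf)
      obtain n0 :: nat where n0: "real n0 > 2 * (\<bar>K1\<bar> + \<bar>K2\<bar>) / r" using reals_Archimedean2 by blast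
      have "norm ((\<Sum>k<n. f ((T ^^ k) x)) / real n - L) < r" if n: "n \<ge> max 1 n0" for n
      proof -
        let ?s = "\<Sum>k<n. f ((T ^^ k) x)"
        have n1: "real n > 0" using n by auto
        have "real n > 2 * (\<bar>K1\<bar> + \<bar>K2\<bar>) / r" using n0 n by (auto simp: max_def split: if_splits)
        then have nK: "\<bar>K1\<bar> + \<bar>K2\<bar> < real n * (r/2)" using r by (simp add: field_simps)
        have m: "real n * (1 / real (Suc j)) \<le> real n * (r / 2)"
          using j n1 by (intro mult_left_mono) auto
        have "?s - real n * L < real n * r" "?s - real n * L > - (real n * r)"
          using K1[of n] K2[of n] nK m by (simp_all only: distrib_left)
        then have "\<bar>?s - real n * L\<bar> < real n * r" by linarith
        moreover have "?s / real n - L = (?s - real n * L) / real n" using n1 by (simp add: field_simps)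
        ultimately show ?thesis using n1 by (simp add: abs_divide pos_divide_less_eq mult.commute)
      qed
      then show "\<exists>n0. \<forall>n\<ge>n0. norm ((\<Sum>k<n. f ((T ^^ k) x)) / real n - L) < r" by blast
    qed
  qed
qed

text \<open>Different indices may yield the same point, so each point is counted at its least valid
  index, the members of \<open>I x\<close>; the integral becomes a series of measurable functions.
  The times at which an orbit meets \<open>S\<close> will be listed in this redundant way.\<close>

lemma measurable_nn_integral_countable_graph:
  fixes t :: "nat \<Rightarrow> 'a \<Rightarrow> 'b" and F :: "'a \<Rightarrow> 'b \<Rightarrow> ennreal"
  assumes P [measurable]: "\<And>i. Measurable.pred M (P i)"
    and E [measurable]: "\<And>i j. Measurable.pred M (\<lambda>x. t i x = t j x)"
    and F [measurable]: "\<And>i. (\<lambda>x. F x (t i x)) \<in> borel_measurable M"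
  shows "(\<lambda>x. \<integral>\<^sup>+s. F x s \<partial>count_space {t i x | i. P i x}) \<in> borel_measurable M"
proof -
  define I where "I x = {i. P i x \<and> (\<forall>j<i. P j x \<longrightarrow> t j x \<noteq> t i x)}" for x
  have bij: "bij_betw (\<lambda>i. t i x) (I x) {t i x | i. P i x}" for x
  proof (rule bij_betwI')
    fix i j assume "i \<in> I x" "j \<in> I x"
    then show "(t i x = t j x) = (i = j)" unfolding I_def
      by (cases i j rule: linorder_cases) auto
  next
    fix i assume "i \<in> I x" then show "t i x \<in> {t i x | i. P i x}" by (auto simp: I_def)
  next
    fix y assume "y \<in> {t i x | i. P i x}"
    then have ex: "\<exists>i. P i x \<and> t i x = y" by auto
    define i where "i = (LEAST i. P i x \<and> t i x = y)"
    have "P i x \<and> t i x = y" unfolding i_def by (rule LeastI_ex[OF ex])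
    moreover have "\<not> (P j x \<and> t j x = y)" if "j < i" for j
      using not_less_Least that unfolding i_def by blast
    ultimately show "\<exists>i\<in>I x. y = t i x" by (auto simp: I_def intro!: exI[of _ i])
  qed
  have "(\<integral>\<^sup>+s. F x s \<partial>count_space {t i x | i. P i x}) = (\<Sum>i. F x (t i x) * indicator (I x) i)" for x
  proof -
    have "(\<integral>\<^sup>+s. F x s \<partial>count_space {t i x | i. P i x}) = (\<integral>\<^sup>+i. F x (t i x) \<partial>count_space (I x))"
      using nn_integral_bij_count_space[OF bij[of x], of "F x"] by simp
    also have "\<dots> = (\<integral>\<^sup>+i. F x (t i x) * indicator (I x) i \<partial>count_space UNIV)"
      by (simp add: nn_integral_count_space_indicator)
    finally show ?thesis by (simp add: nn_integral_count_space_nat)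
  qed
  moreover have "(\<lambda>x. \<Sum>i. F x (t i x) * indicator (I x) i) \<in> borel_measurable M"
  proof -
    have [measurable]: "Measurable.pred M (\<lambda>x. i \<in> I x)" for i unfolding I_def by simp
    have "(\<lambda>x. indicator (I x) i :: ennreal) = (\<lambda>x. if i \<in> I x then 1 else 0)" for i
      by (auto simp: indicator_def)
    then show ?thesis by simp
  qed
  ultimately show ?thesis by simp
qed

text \<open>Fubini in the direction \<open>e\<close>: averaging the translates of \<open>Z\<close>
  over \<open>s\<close> in \<open>[0,1]\<close> preserves the measure of \<open>Z\<close> by
  translation invariance, while the inner integral over \<open>s\<close> runs over a countable set
  and vanishes.\<close>

lemma null_set_lborel_if_lines_countable:
  fixes e :: "'a::euclidean_space"
  assumes Z [measurable]: "Z \<in> sets borel" and e: "\<And>x. countable {s::real. x + s *\<^sub>R e \<in> Z}"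
  shows "emeasure lborel Z = 0"
proof -
  have "(\<integral>\<^sup>+s. \<integral>\<^sup>+x. indicator Z (x + s *\<^sub>R e) * indicator {0..1} s \<partial>lborel \<partial>(lborel::real measure))
      = (\<integral>\<^sup>+x. \<integral>\<^sup>+s. indicator Z (x + s *\<^sub>R e) * indicator {0..1} s \<partial>lborel \<partial>lborel)"
    by (rule lborel_pair.Fubini') measurable
  moreover have "(\<integral>\<^sup>+s. indicator Z (x + s *\<^sub>R e) * indicator {0..1} s \<partial>lborel) = (0::ennreal)" for x
  proof -
    have "AE s in lborel. s \<notin> {s::real. x + s *\<^sub>R e \<in> Z}"
      using countable_imp_null_set_lborel[OF e[of x]] by (rule AE_not_in)
    then have "AE s in lborel. indicator Z (x + s *\<^sub>R e) * indicator {0..1} s = (0::ennreal)"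
      by eventually_elim auto
    then show ?thesis by (subst nn_integral_0_iff_AE) auto
  qed
  moreover have "(\<integral>\<^sup>+x. indicator Z (x + s *\<^sub>R e) * indicator {0..1} s \<partial>lborel)
      = emeasure lborel Z * indicator {0..1} s" for s :: real
  proof -
    have "(\<integral>\<^sup>+x. indicator Z (x + s *\<^sub>R e) \<partial>lborel)
        = (\<integral>\<^sup>+x. indicator Z x \<partial>distr lborel borel (\<lambda>x. x + s *\<^sub>R e))"
      by (subst nn_integral_distr) auto
    also have "distr lborel borel (\<lambda>x. x + s *\<^sub>R e) = lborel"
    proof -
      have "(\<lambda>x. x + s *\<^sub>R e) = (+) (s *\<^sub>R e)" by (auto simp: add.commute)
      then show ?thesis using lborel_distr_plus[of "s *\<^sub>R e"] by simp
    qed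
    finally show ?thesis by (subst nn_integral_multc) auto
  qed
  ultimately show ?thesis by (simp add: nn_integral_cmult)
qed

text \<open>Change of clock: \<open>N m\<close> will be the number of hits before time
  \<open>m\<close> and \<open>a n\<close> the logarithm of the \<open>n\<close>-th \<open>q\<close>.
  An index \<open>n\<close> lies between \<open>N (M n)\<close> and \<open>N (Suc (M n))\<close>,
  monotonicity sandwiches the ratio, and both bounds have the same limit since \<open>N m\<close>
  grows like \<open>\<kappa> m\<close>.\<close>

lemma tendsto_along_subsequence_mono:
  fixes a :: "nat \<Rightarrow> real" and N :: "nat \<Rightarrow> nat"
  assumes a: "mono a" and N: "mono N" "N 0 = 0"
    and kap: "(\<lambda>m. real (N m) / real m) \<longlonglongrightarrow> \<kappa>" "\<kappa> > 0"
    and lim: "(\<lambda>m. a (N m) / real m) \<longlonglongrightarrow> d" "d > 0"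
  shows "(\<lambda>n. a n / real n) \<longlonglongrightarrow> d / \<kappa>"
proof -
  have evN: "eventually (\<lambda>m. real (N m) / real m > \<kappa> / 2) sequentially"
    using order_tendstoD(1)[OF kap(1), of "\<kappa> / 2"] kap(2) by simp
  have Ninf: "filterlim N at_top sequentially"
  proof -
    have "filterlim (\<lambda>m. \<kappa> / 2 * real m) at_top sequentially"
      using kap(2) by (intro filterlim_tendsto_pos_mult_at_top[OF tendsto_const] filterlim_real_sequentially) auto
    moreover have "eventually (\<lambda>m. \<kappa> / 2 * real m \<le> real (N m)) sequentially"
      using evN eventually_gt_at_top[of 0] by eventually_elim (simp add: field_simps)
    ultimately have "filterlim (\<lambda>m. real (N m)) at_top sequentially"
      by (rule filterlim_at_top_mono)
    then show ?thesis by (simp add: filterlim_sequentially_iff_filterlim_real)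
  qed
  have fin: "finite {m. N m \<le> n}" for n
  proof -
    obtain m0 where m0: "\<And>m. m \<ge> m0 \<Longrightarrow> N m \<ge> Suc n"
      using Ninf unfolding filterlim_at_top eventually_sequentially by blast
    have "{m. N m \<le> n} \<subseteq> {..<m0}" using m0 by (force simp: not_le[symmetric])
    then show ?thesis using finite_subset by blast
  qed
  define M where "M n = Max {m. N m \<le> n}" for n
  have M1: "N (M n) \<le> n" for n
  proof -
    have "M n \<in> {m. N m \<le> n}" unfolding M_def
      by (rule Max_in[OF fin]) (use N(2) in \<open>auto intro!: exI[of _ 0]\<close>)
    then show ?thesis by simp
  qed
  have M2: "n < N (Suc (M n))" for n
  proof (rule ccontr)
    assume "\<not> n < N (Suc (M n))"
    then have "Suc (M n) \<in> {m. N m \<le> n}" by simp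
    from Max_ge[OF fin this] show False by (simp add: M_def)
  qed
  have Minf: "filterlim M at_top sequentially"
    unfolding filterlim_at_top
  proof
    fix k
    show "eventually (\<lambda>n. k \<le> M n) sequentially"
      using eventually_ge_at_top[of "N k"]
      by eventually_elim (auto simp: M_def intro!: Max_ge fin)
  qed
  have l1: "(\<lambda>m. a (N m) / real (N (Suc m))) \<longlonglongrightarrow> d / \<kappa>"
    and l2: "(\<lambda>m. a (N (Suc m)) / real (N m)) \<longlonglongrightarrow> d / \<kappa>"
  proof -
    have s: "(\<lambda>m. real (Suc m) / real m) \<longlonglongrightarrow> 1"
      using LIMSEQ_Suc_n_over_n by simp
    have s': "(\<lambda>m. real m / real (Suc m)) \<longlonglongrightarrow> 1"
      using LIMSEQ_n_over_Suc_n by simp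
    have "(\<lambda>m. a (N m) / real m * (real m / real (Suc m)) / (real (N (Suc m)) / real (Suc m))) \<longlonglongrightarrow> d * 1 / \<kappa>"
      by (intro tendsto_intros lim(1) s' LIMSEQ_Suc[OF kap(1)]) (use kap(2) in auto)
    moreover have "eventually (\<lambda>m. a (N m) / real m * (real m / real (Suc m)) / (real (N (Suc m)) / real (Suc m))
       = a (N m) / real (N (Suc m))) sequentially"
      using eventually_gt_at_top[of 0] by eventually_elim simp
    ultimately show "(\<lambda>m. a (N m) / real (N (Suc m))) \<longlonglongrightarrow> d / \<kappa>"
      unfolding mult_1_right by (rule Lim_transform_eventually)
    have "(\<lambda>m. a (N (Suc m)) / real (Suc m) * (real (Suc m) / real m) / (real (N m) / real m)) \<longlonglongrightarrow> d * 1 / \<kappa>"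
      by (intro tendsto_intros LIMSEQ_Suc[OF lim(1)] s kap(1)) (use kap(2) in auto)
    moreover have "eventually (\<lambda>m. a (N (Suc m)) / real (Suc m) * (real (Suc m) / real m) / (real (N m) / real m)
       = a (N (Suc m)) / real (N m)) sequentially"
      using eventually_gt_at_top[of 0] by eventually_elim simp
    ultimately show "(\<lambda>m. a (N (Suc m)) / real (N m)) \<longlonglongrightarrow> d / \<kappa>"
      unfolding mult_1_right by (rule Lim_transform_eventually)
  qed
  have "eventually (\<lambda>m. a (N m) / real m > 0) sequentially"
    using order_tendstoD(1)[OF lim(1), of 0] lim(2) by simp
  then have apos: "eventually (\<lambda>m. a (N m) > 0 \<and> N m > 0) sequentially"
    using evN eventually_gt_at_top[of 0]
  proof eventually_elim
    case (elim m)
    then have "real (N m) / real m > 0" using kap(2) by linarith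
    then show ?case using elim by (auto simp: zero_less_divide_iff)
  qed
  have ev: "eventually (\<lambda>n. a (N (M n)) > 0 \<and> N (M n) > 0) sequentially"
    using eventually_compose_filterlim[OF apos Minf] .
  show ?thesis
  proof (rule tendsto_sandwich)
    show "(\<lambda>n. a (N (M n)) / real (N (Suc (M n)))) \<longlonglongrightarrow> d / \<kappa>"
      by (rule filterlim_compose[OF l1 Minf])
    show "(\<lambda>n. a (N (Suc (M n))) / real (N (M n))) \<longlonglongrightarrow> d / \<kappa>"
      by (rule filterlim_compose[OF l2 Minf])
    show "eventually (\<lambda>n. a (N (M n)) / real (N (Suc (M n))) \<le> a n / real n) sequentially"
      using ev
    proof eventually_elim
      case (elim n)
      then show ?case using M1[of n] M2[of n] monoD[OF a M1[of n]] by (intro frac_le) auto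
    qed
    show "eventually (\<lambda>n. a n / real n \<le> a (N (Suc (M n))) / real (N (M n))) sequentially"
      using ev
    proof eventually_elim
      case (elim n)
      have "a n \<le> a (N (Suc (M n)))" using M2[of n] by (intro monoD[OF a]) auto
      moreover have "a (N (M n)) \<le> a n" using M1 by (intro monoD[OF a]) auto
      ultimately show ?case using elim M1[of n] by (intro frac_le) auto
    qed
  qed
qed

section \<open>Increasing families indexed by the integers\<close>

lemma strict_mono_int_Suc:
  fixes f :: "int \<Rightarrow> 'a::order"
  assumes "\<And>n. f n < f (n + 1)"
  shows "strict_mono f"
proof (rule strict_monoI)
  fix m n :: int assume "m < n"
  then show "f m < f n"
  proof (induction n rule: int_gr_induct)
    case base then show ?case using assms by simp
  next
    case (step i) then show ?case using assms[of i] by (meson less_trans)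
  qed
qed

lemma strict_mono_int_unbounded:
  fixes f :: "int \<Rightarrow> real"
  assumes f: "strict_mono f" and fin: "\<And>a b. finite (range f \<inter> {a..b})"
  shows "\<exists>n. f n > b" "\<exists>n. f n < b"
proof -
  show "\<exists>n. f n > b"
  proof (rule ccontr)
    assume "\<not> (\<exists>n. f n > b)"
    then have "f ` {0..} \<subseteq> range f \<inter> {f 0..b}"
      using strict_mono_leD[OF f] by (auto simp: not_less)
    then have "finite (f ` {0..})" using fin finite_subset by blast
    then have "finite {0::int..}"
      by (rule finite_imageD) (use f in \<open>auto simp: strict_mono_imp_inj_on inj_on_subset\<close>)
    then show False by (simp add: infinite_Ici)
  qed
  show "\<exists>n. f n < b"
  proof (rule ccontr)
    assume "\<not> (\<exists>n. f n < b)"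
    then have "f ` {..0} \<subseteq> range f \<inter> {b..f 0}"
      using strict_mono_leD[OF f] by (auto simp: not_less)
    then have "finite (f ` {..0})" using fin finite_subset by blast
    then have "finite {..0::int}"
      by (rule finite_imageD) (use f in \<open>auto simp: strict_mono_imp_inj_on inj_on_subset\<close>)
    then show False by (simp add: infinite_Iic)
  qed
qed

lemma strict_mono_int_switch:
  fixes f :: "int \<Rightarrow> real"
  assumes f: "strict_mono f" and "\<exists>n. f n \<ge> y" and "\<exists>n. f n < y"
  obtains n where "f (n - 1) < y" "y \<le> f n"
proof -
  obtain a b where a: "f a < y" and b: "f b \<ge> y" using assms by blast
  have ab: "a < b"
  proof (rule ccontr)
    assume "\<not> a < b"
    then have "f b \<le> f a" using strict_mono_leD[OF f, of b a] by simp
    then show False using a b by simp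
  qed
  define k where "k = (LEAST k::nat. y \<le> f (a + int k))"
  have ex: "y \<le> f (a + int (nat (b - a)))" using b ab by simp
  have k1: "y \<le> f (a + int k)" unfolding k_def
    using LeastI[of "\<lambda>k. y \<le> f (a + int k)", OF ex] .
  have "k > 0" using k1 a by (cases k) auto
  then have "\<not> y \<le> f (a + int (k - 1))" unfolding k_def by (intro not_less_Least) auto
  then show thesis using that[of "a + int k"] k1 \<open>k > 0\<close> by (simp add: of_nat_diff algebra_simps)
qed

text \<open>Local finiteness gives every real number, in \<open>Q\<close> or not, a next and a
  previous element of \<open>Q\<close>; both are iterated from \<open>x0\<close>. Nothing is
  skipped, because the resulting \<open>f\<close> is unbounded in both directions and no element of
  \<open>Q\<close> lies strictly between consecutive values.\<close>

lemma enumerate_int: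
  fixes Q :: "real set"
  assumes fin: "\<And>a b. finite (Q \<inter> {a..b})"
    and up: "\<And>b. \<exists>x\<in>Q. x > b" and dn: "\<And>b. \<exists>x\<in>Q. x < b"
  obtains f :: "int \<Rightarrow> real" where "strict_mono f" "range f = Q"
proof -
  have "\<exists>y. x < y \<and> y \<in> Q \<and> Q \<inter> {x<..<y} = {}" for x
  proof -
    obtain z where z: "z \<in> Q" "z > x" using up by blast
    have fn: "finite (Q \<inter> {x<..z})" by (rule finite_subset[OF _ fin[of x z]]) auto
    have "Min (Q \<inter> {x<..z}) \<in> Q \<inter> {x<..z}" by (rule Min_in[OF fn]) (use z in auto)
    moreover have "w \<notin> Q \<inter> {x<..<Min (Q \<inter> {x<..z})}" for w
    proof
      assume w: "w \<in> Q \<inter> {x<..<Min (Q \<inter> {x<..z})}"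
      then have "w \<in> Q \<inter> {x<..z}" using calculation by auto
      from Min_le[OF fn this] w show False by auto
    qed
    ultimately show ?thesis by (intro exI[of _ "Min (Q \<inter> {x<..z})"]) auto
  qed
  then obtain s where s: "\<And>x. x < s x" "\<And>x. s x \<in> Q" "\<And>x. Q \<inter> {x<..<s x} = {}" by metis
  have "\<exists>y. y < x \<and> y \<in> Q \<and> Q \<inter> {y<..<x} = {}" for x
  proof -
    obtain z where z: "z \<in> Q" "z < x" using dn by blast
    have fn: "finite (Q \<inter> {z..<x})" by (rule finite_subset[OF _ fin[of z x]]) auto
    have "Max (Q \<inter> {z..<x}) \<in> Q \<inter> {z..<x}" by (rule Max_in[OF fn]) (use z in auto)
    moreover have "w \<notin> Q \<inter> {Max (Q \<inter> {z..<x})<..<x}" for w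
    proof
      assume w: "w \<in> Q \<inter> {Max (Q \<inter> {z..<x})<..<x}"
      then have "w \<in> Q \<inter> {z..<x}" using calculation by auto
      from Max_ge[OF fn this] w show False by auto
    qed
    ultimately show ?thesis by (intro exI[of _ "Max (Q \<inter> {z..<x})"]) auto
  qed
  then obtain p where p: "\<And>x. p x < x" "\<And>x. p x \<in> Q" "\<And>x. Q \<inter> {p x<..<x} = {}" by metis
  obtain x0 where x0: "x0 \<in> Q" using up by blast
  define f where "f n = (if n \<ge> 0 then (s ^^ nat n) x0 else (p ^^ nat (- n)) x0)" for n :: int
  have fs: "f (n + 1) = s (f n)" if "n \<ge> 0" for n
    using that by (simp add: f_def nat_add_distrib)
  have fp: "f n = p (f (n + 1))" if "n < 0" for n
  proof -
    have "nat (- n) = Suc (nat (- (n + 1)))" using that by simp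
    then show ?thesis using that by (auto simp: f_def)
  qed
  have fQ: "f n \<in> Q" for n
  proof (cases "n > 0")
    case True then show ?thesis using fs[of "n - 1"] s(2) by simp
  next
    case False
    then show ?thesis using fp[of n] p(2) x0 by (cases "n = 0") (auto simp: f_def)
  qed
  have step: "f n < f (n + 1) \<and> Q \<inter> {f n<..<f (n + 1)} = {}" for n
  proof (cases "n \<ge> 0")
    case True then show ?thesis using fs[of n] s by simp
  next
    case False then show ?thesis using fp[of n] p(1,3)[of "f (n + 1)"] by simp
  qed
  then have mono: "strict_mono f" by (intro strict_mono_int_Suc) auto
  have finr: "finite (range f \<inter> {a..b})" for a b
    by (rule finite_subset[OF _ fin[of a b]]) (use fQ in auto)
  have "y \<in> range f" if y: "y \<in> Q" for y
  proof -
    obtain n where n: "f (n - 1) < y" "y \<le> f n"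
    proof (rule strict_mono_int_switch[OF mono, of y])
      show "\<exists>n. f n \<ge> y"
        using strict_mono_int_unbounded(1)[OF mono finr, of y] by (auto intro: less_imp_le)
      show "\<exists>n. f n < y"
        using strict_mono_int_unbounded(2)[OF mono finr, of y] by simp
    qed
    have "y \<notin> {f (n - 1)<..<f (n - 1 + 1)}" using step[of "n - 1"] y by blast
    then show ?thesis using n by auto
  qed
  then show thesis using that[OF mono] fQ by blast
qed

text \<open>An order automorphism of the integers is a translation. Hence the numbering of the
  minimal vectors is unique up to a shift.\<close>

lemma strict_mono_int_same_range:
  fixes f g :: "int \<Rightarrow> 'a::linorder"
  assumes f: "strict_mono f" and g: "strict_mono g" and r: "range f = range g"
  obtains k where "\<And>n. g n = f (n + k)"
proof -
  have "\<exists>m. g n = f m" for n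
  proof -
    have "g n \<in> range f" unfolding r by simp
    then show ?thesis by blast
  qed
  then obtain h where h: "\<And>n. g n = f (h n)" by metis
  have hm: "h m < h n \<longleftrightarrow> m < n" for m n
    using strict_mono_less[OF f, of "h m" "h n"] strict_mono_less[OF g, of m n] h by simp
  have surj: "\<exists>n. h n = m" for m
  proof -
    have "f m \<in> range g" unfolding r[symmetric] by simp
    then obtain n where "f m = g n" by blast
    then show ?thesis using strict_mono_eq[OF f] h by auto
  qed
  have hs: "h (n + 1) = h n + 1" for n
  proof -
    obtain m where m: "h m = h n + 1" using surj by blast
    have "n < m" using hm[of n m] m by simp
    moreover have "\<not> n + 1 < m" using hm[of "n + 1" m] hm[of n "n + 1"] m by simp
    ultimately have "m = n + 1" by simp
    then show ?thesis using m by simp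
  qed
  have hn: "h n = n + h 0" for n
  proof (induction n rule: int_induct[where k = 0])
    case (step2 i) then show ?case using hs[of "i - 1"] by simp
  qed (use hs in auto)
  have "g n = f (n + h 0)" for n
    unfolding h[of n] by (rule arg_cong[OF hn])
  then show thesis by (rule that)
qed

section \<open>The space of lattices\<close>

lemma SL_real_mult: "A \<in> SL_real \<Longrightarrow> B \<in> SL_real \<Longrightarrow> A ** B \<in> SL_real"
  by (simp add: SL_real_def det_mul)

lemma SL_real_one: "mat 1 \<in> SL_real"
  by (simp add: SL_real_def)

lemma SL_real_inverse:
  assumes "A \<in> SL_real"
  obtains B where "B \<in> SL_real" "A ** B = mat 1" "B ** A = mat 1"
proof -
  have "invertible A" using assms by (simp add: SL_real_def invertible_det_nz)
  then obtain B where B: "A ** B = mat 1" "B ** A = mat 1" unfolding invertible_def by blast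
  have "det A * det B = 1" using arg_cong[OF B(1), of det] by (simp add: det_mul)
  then have "B \<in> SL_real" using assms by (simp add: SL_real_def)
  then show thesis using that B by blast
qed

lemma act_lattice_of: "act A (lattice_of B) = lattice_of (A ** B)"
proof -
  have "lattice_of M = (\<lambda>z. M *v z) ` {z. \<forall>i. z $ i \<in> \<int>}" for M :: "real^'a^'a"
    unfolding lattice_of_def by (rule image_Collect[symmetric])
  then show ?thesis unfolding act_def by (simp add: image_image matrix_vector_mul_assoc)
qed

lemma act_mult: "act A (act B L) = act (A ** B) L"
  unfolding act_def by (simp add: image_image matrix_vector_mul_assoc)

lemma act_one: "act (mat 1) L = L"
  unfolding act_def by simp

lemma lattice_space_iff: "L \<in> lattice_space \<longleftrightarrow> (\<exists>A\<in>SL_real. L = lattice_of A)"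
  unfolding lattice_space_def by auto

lemma act_lattice_space: "A \<in> SL_real \<Longrightarrow> L \<in> lattice_space \<Longrightarrow> act A L \<in> lattice_space"
  by (auto simp: lattice_space_iff act_lattice_of intro: SL_real_mult)

lemma continuous_on_matrix_mult [continuous_intros]:
  fixes f :: "'a::topological_space \<Rightarrow> real^'m::finite^'k::finite" and g :: "'a \<Rightarrow> real^'n::finite^'m"
  assumes "continuous_on T f" "continuous_on T g"
  shows "continuous_on T (\<lambda>x. f x ** g x)"
  unfolding matrix_matrix_mult_def
  by (intro continuous_on_vec_lambda continuous_intros assms)

lemma continuous_on_det [continuous_intros]:
  fixes f :: "'a::topological_space \<Rightarrow> real^'n::finite^'n"
  assumes "continuous_on T f"
  shows "continuous_on T (\<lambda>x. det (f x))"
  unfolding det_def by (intro continuous_intros assms)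

lemma borel_measurable_matrix_mult [measurable (raw)]:
  fixes f :: "'a \<Rightarrow> real^'m::finite^'k::finite" and g :: "'a \<Rightarrow> real^'n::finite^'m"
  assumes "f \<in> borel_measurable M" "g \<in> borel_measurable M"
  shows "(\<lambda>x. f x ** g x) \<in> borel_measurable M"
  by (rule borel_measurable_continuous_Pair[OF assms]) (intro continuous_intros)

lemma borel_measurable_matrix_vector_mult [measurable (raw)]:
  fixes f :: "'a \<Rightarrow> real^'m::finite^'k::finite"
  assumes "f \<in> borel_measurable M" "g \<in> borel_measurable M"
  shows "(\<lambda>x. f x *v g x) \<in> borel_measurable M"
  by (rule borel_measurable_continuous_Pair[OF assms])
     (auto simp: matrix_vector_mult_def intro!: continuous_intros)

lemma open_lattice_sets_subset: "open_lattice_sets \<subseteq> Pow lattice_space"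
  unfolding open_lattice_sets_def by auto

lemma space_lattice_borel [simp]: "space lattice_borel = lattice_space"
  unfolding lattice_borel_def by (rule space_measure_of[OF open_lattice_sets_subset])

lemma sets_lattice_borel: "sets lattice_borel = sigma_sets lattice_space open_lattice_sets"
  unfolding lattice_borel_def by (rule sets_measure_of[OF open_lattice_sets_subset])

text \<open>The quotient map is open: the saturation of \<open>W\<close> is a union of translates of
  \<open>W\<close> by elements of \<open>\<Gamma>\<close>. Here \<open>\<Gamma>\<close> is
  \<open>SL(n,\<int>)\<close>, described as the stabiliser of the standard lattice so that matrix
  entries do not enter.\<close>

lemma lattice_of_image_open:
  fixes W :: "(real^'n::finite^'n) set"
  assumes W: "open W"
  shows "lattice_of ` (W \<inter> SL_real) \<in> open_lattice_sets"
proof -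
  define \<Gamma> where "\<Gamma> = {\<gamma> \<in> SL_real. lattice_of \<gamma> = lattice_of (mat 1 :: real^'n^'n)}"
  have eq: "{A \<in> SL_real. lattice_of A \<in> lattice_of ` (W \<inter> SL_real)}
      = (\<Union>\<gamma>\<in>\<Gamma>. SL_real \<inter> (\<lambda>A. A ** \<gamma>) -` W)"
  proof (intro set_eqI iffI)
    fix A assume "A \<in> {A \<in> SL_real. lattice_of A \<in> lattice_of ` (W \<inter> SL_real)}"
    then obtain B where A: "A \<in> SL_real" and B: "B \<in> W" "B \<in> SL_real" "lattice_of A = lattice_of B"
      by auto
    obtain A' where A': "A' \<in> SL_real" "A ** A' = mat 1" "A' ** A = mat 1"
      using SL_real_inverse[OF A] .
    have "lattice_of (A' ** B) = lattice_of (mat 1 :: real^'n^'n)"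
    proof -
      have "lattice_of (A' ** B) = act A' (lattice_of A)" by (simp only: B(3) act_lattice_of)
      then show ?thesis by (simp only: act_lattice_of A'(3))
    qed
    moreover have "A ** (A' ** B) = B" using A'(2) by (simp add: matrix_mul_assoc)
    ultimately show "A \<in> (\<Union>\<gamma>\<in>\<Gamma>. SL_real \<inter> (\<lambda>A. A ** \<gamma>) -` W)"
      using A B(1,2) A'(1) by (intro UN_I[of "A' ** B"]) (simp_all add: \<Gamma>_def SL_real_mult)
  next
    fix A assume "A \<in> (\<Union>\<gamma>\<in>\<Gamma>. SL_real \<inter> (\<lambda>A. A ** \<gamma>) -` W)"
    then obtain \<gamma> where g: "\<gamma> \<in> \<Gamma>" "A \<in> SL_real" "A ** \<gamma> \<in> W" by auto
    have "lattice_of A = lattice_of (A ** \<gamma>)"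
      using g(1) act_lattice_of[of A \<gamma>] act_lattice_of[of A "mat 1"] by (simp add: \<Gamma>_def)
    then show "A \<in> {A \<in> SL_real. lattice_of A \<in> lattice_of ` (W \<inter> SL_real)}"
      using g by (simp add: \<Gamma>_def SL_real_mult)
  qed
  have "openin (top_of_set SL_real) (\<Union>\<gamma>\<in>\<Gamma>. SL_real \<inter> (\<lambda>A. A ** \<gamma>) -` W)"
  proof (rule openin_Union, clarify)
    fix \<gamma>
    show "openin (top_of_set SL_real) (SL_real \<inter> (\<lambda>A. A ** \<gamma>) -` W)"
      by (rule continuous_openin_preimage_gen[OF _ W]) (intro continuous_intros)
  qed
  then have "openin (top_of_set SL_real) {A \<in> SL_real. lattice_of A \<in> lattice_of ` (W \<inter> SL_real)}"
    by (simp only: eq)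
  moreover have "lattice_of ` (W \<inter> SL_real) \<subseteq> lattice_space"
    unfolding lattice_space_def by blast
  ultimately show ?thesis unfolding open_lattice_sets_def by blast
qed

lemma lattice_of_image_open_measurable [measurable]:
  "open W \<Longrightarrow> lattice_of ` (W \<inter> SL_real) \<in> sets lattice_borel"
  unfolding sets_lattice_borel by (intro sigma_sets.Basic lattice_of_image_open)

lemma integer_vector_norm_ge_1:
  fixes w :: "real^'n::finite"
  assumes "\<forall>i. w $ i \<in> \<int>" "w \<noteq> 0"
  shows "norm w \<ge> 1"
proof -
  obtain i where "w $ i \<noteq> 0" using assms(2) by (auto simp: vec_eq_iff)
  then have "\<bar>w $ i\<bar> \<ge> 1" using assms(1) Ints_nonzero_abs_ge1 by blast
  then show ?thesis using component_le_norm_cart[of w i] by linarith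
qed

text \<open>Discreteness of the integral matrices. If \<open>A\<close> and \<open>B\<close> near
  \<open>A0\<close> generate the same lattice, the \<open>k\<close>-th column of \<open>A\<close> is
  \<open>B *v z\<close> with \<open>z\<close> integral, and \<open>B\<close> maps
  \<open>w = z - axis k 1\<close> to a difference of two nearby columns. Since \<open>B\<close> does
  not contract much, \<open>w\<close> is an integral vector of norm below \<open>1\<close>, hence
  zero.\<close>

lemma lattice_of_locally_injective:
  fixes A0 :: "real^'n::finite^'n"
  assumes A0: "A0 \<in> SL_real"
  shows "\<exists>W. open W \<and> A0 \<in> W \<and> inj_on lattice_of (W \<inter> SL_real)"
proof -
  have inj: "inj ((*v) A0)"
    using A0 by (intro inj_matrix_vector_mult) (simp add: SL_real_def invertible_det_nz)
  obtain c where c: "c > 0" "\<And>v. norm (A0 *v v) \<ge> c * norm v"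
    by (rule linear_inj_bounded_below_pos[OF matrix_vector_mul_linear inj]) blast
  \<comment> \<open>The entrywise sum dominates the operator norm. The margin \<open>c / 4\<close>
    leaves \<open>B\<close> expanding by at least \<open>3 c / 4\<close>, while the two columns
    differ by at most \<open>c / 2\<close>; this forces \<open>norm w \<le> 2 / 3\<close>.\<close>
  define W where "W = {A :: real^'n^'n. (\<Sum>i\<in>UNIV. \<Sum>j\<in>UNIV. \<bar>(A - A0) $ i $ j\<bar>) < c / 4}"
  have opn: "open W" unfolding W_def by (intro open_Collect_less continuous_intros)
  have near: "norm ((A - A0) *v v) \<le> c / 4 * norm v" if "A \<in> W" for A and v :: "real^'n"
  proof -
    have "norm ((A - A0) *v v) \<le> onorm ((*v) (A - A0)) * norm v"
      by (rule onorm) simp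
    also have "\<dots> \<le> c / 4 * norm v"
      using onorm_le_matrix_component_sum[of "A - A0"] that unfolding W_def
      by (intro mult_right_mono) auto
    finally show ?thesis .
  qed
  have "inj_on lattice_of (W \<inter> SL_real)"
  proof (rule inj_onI)
    fix A B assume A: "A \<in> W \<inter> SL_real" and B: "B \<in> W \<inter> SL_real" and eq: "lattice_of A = lattice_of B"
    have "column k A = column k B" for k
    proof -
      have "A *v axis k 1 \<in> lattice_of A" unfolding lattice_of_def by (force simp: axis_def)
      then obtain z where z: "A *v axis k 1 = B *v z" "\<forall>i. z $ i \<in> \<int>"
        unfolding eq by (auto simp: lattice_of_def)
      define w where "w = z - axis k 1"
      have wint: "\<forall>i. w $ i \<in> \<int>" using z(2) by (auto simp: w_def axis_def)
      have nax: "norm (axis k (1::real)) = 1" by (simp add: norm_axis_1)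
      have "B *v w = (A - A0) *v axis k 1 - (B - A0) *v axis k 1"
        using z(1) by (simp add: w_def matrix_vector_mult_diff_distrib matrix_vector_mult_diff_rdistrib)
      then have "norm (B *v w) \<le> c / 4 + c / 4"
        using near[of A "axis k 1"] near[of B "axis k 1"] A B
          norm_triangle_ineq4[of "(A - A0) *v axis k 1" "(B - A0) *v axis k 1"] by (simp add: nax)
      moreover have "norm (B *v w) \<ge> c * norm w - c / 4 * norm w"
      proof -
        have "A0 *v w = B *v w - (B - A0) *v w"
          unfolding matrix_vector_mult_diff_rdistrib by simp
        then have "norm (A0 *v w) \<le> norm (B *v w) + norm ((B - A0) *v w)"
          by (simp only: norm_triangle_ineq4)
        moreover have "norm ((B - A0) *v w) \<le> c / 4 * norm w" using near[of B w] B by blast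
        ultimately show ?thesis using c(2)[of w] by linarith
      qed
      ultimately have "c * (3 / 4 * norm w) \<le> c * (1 / 2)" by (simp add: field_simps)
      then have "norm w < 1" using c(1) by simp
      then have "w = 0" using integer_vector_norm_ge_1[OF wint] by linarith
      then have "A *v axis k 1 = B *v axis k 1" using z(1) by (simp add: w_def)
      then show ?thesis by (simp add: matrix_vector_mul_component matrix_vector_mult_basis)
    qed
    then show "A = B" by (simp add: vec_eq_iff column_def)
  qed
  moreover have "A0 \<in> W" using c(1) by (simp add: W_def)
  ultimately show ?thesis using opn by blast
qed

text \<open>A Borel section of the quotient map. Countably many open sets on which the map is
  injective cover \<open>SL_real\<close>, by Lindelof; \<open>s\<close> inverts the map on the first
  of them whose image contains the lattice. Preimages of open sets are then unions of differences of
  open sets of lattices.\<close>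

lemma lattice_basis_selection:
  obtains s :: "(real^'n::finite) set \<Rightarrow> real^'n^'n"
  where "s \<in> borel_measurable lattice_borel"
    "\<And>L. L \<in> lattice_space \<Longrightarrow> s L \<in> SL_real" "\<And>L. L \<in> lattice_space \<Longrightarrow> lattice_of (s L) = L"
proof -
  define \<F> where "\<F> = {W :: (real^'n^'n) set. open W \<and> inj_on lattice_of (W \<inter> SL_real)}"
  obtain \<F>' where F': "\<F>' \<subseteq> \<F>" "countable \<F>'" "\<Union>\<F>' = \<Union>\<F>"
    by (rule Lindelof[of \<F>]) (auto simp: \<F>_def)
  have cov: "SL_real \<subseteq> \<Union>\<F>'"
  proof
    fix A :: "real^'n^'n" assume "A \<in> SL_real"
    from lattice_of_locally_injective[OF this] show "A \<in> \<Union>\<F>'" unfolding F'(3) \<F>_def by blast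
  qed
  then have "\<F>' \<noteq> {}" using SL_real_one by auto
  define W where "W = from_nat_into \<F>'"
  have W: "range W = \<F>'" unfolding W_def using \<open>\<F>' \<noteq> {}\<close> F'(2) by (rule range_from_nat_into)
  have opn: "open (W k)" and inj: "inj_on lattice_of (W k \<inter> SL_real)" for k
  proof -
    have "W k \<in> \<F>" using W F'(1) by blast
    then show "open (W k)" "inj_on lattice_of (W k \<inter> SL_real)" by (simp_all add: \<F>_def)
  qed
  define U where "U k = lattice_of ` (W k \<inter> SL_real)" for k
  have U [measurable]: "U k \<in> sets lattice_borel" for k unfolding U_def using opn by measurable
  have Ucov: "\<exists>k. L \<in> U k" if L: "L \<in> lattice_space" for L
  proof -
    obtain A where A: "A \<in> SL_real" "L = lattice_of A" using L by (auto simp: lattice_space_def)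
    then obtain k where "A \<in> W k" using cov W by blast
    then show ?thesis using A unfolding U_def by blast
  qed
  define \<kappa> where "\<kappa> L = (LEAST k. L \<in> U k)" for L
  define s where "s L = inv_into (W (\<kappa> L) \<inter> SL_real) lattice_of L" for L
  have kap: "L \<in> U (\<kappa> L)" if "L \<in> lattice_space" for L
    unfolding \<kappa>_def using Ucov[OF that] by (rule LeastI_ex)
  have sW: "s L \<in> W (\<kappa> L) \<inter> SL_real" and ls: "lattice_of (s L) = L" if "L \<in> lattice_space" for L
    using inv_into_into[OF kap[OF that, unfolded U_def]] f_inv_into_f[OF kap[OF that, unfolded U_def]]
    unfolding s_def by simp_all
  have "s \<in> borel_measurable lattice_borel"
  proof (rule borel_measurableI)
    fix O' :: "(real^'n^'n) set" assume O': "open O'"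
    have "s -` O' \<inter> space lattice_borel
        = (\<Union>k. lattice_of ` ((W k \<inter> O') \<inter> SL_real) - (\<Union>j<k. U j))"
    proof (intro set_eqI iffI)
      fix L assume "L \<in> s -` O' \<inter> space lattice_borel"
      then have L: "L \<in> lattice_space" "s L \<in> O'" by auto
      have "L \<in> lattice_of ` ((W (\<kappa> L) \<inter> O') \<inter> SL_real)"
        using sW[OF L(1)] ls[OF L(1)] L(2) by (intro image_eqI[of _ _ "s L"]) auto
      moreover have "L \<notin> U j" if "j < \<kappa> L" for j
        using that not_less_Least unfolding \<kappa>_def by blast
      ultimately show "L \<in> (\<Union>k. lattice_of ` ((W k \<inter> O') \<inter> SL_real) - (\<Union>j<k. U j))" by blast
    next
      fix L assume "L \<in> (\<Union>k. lattice_of ` ((W k \<inter> O') \<inter> SL_real) - (\<Union>j<k. U j))"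
      then obtain k A where k: "A \<in> W k" "A \<in> O'" "A \<in> SL_real" "L = lattice_of A" "\<And>j. j < k \<Longrightarrow> L \<notin> U j"
        by blast
      then have L: "L \<in> lattice_space" by (auto simp: lattice_space_def)
      have "L \<in> U k" using k by (auto simp: U_def)
      then have "\<kappa> L = k" unfolding \<kappa>_def
      proof (rule Least_equality)
        fix j assume "L \<in> U j" then show "k \<le> j" using k(5)[of j] by (cases "j < k") auto
      qed
      then have "s L = A" using inj[of k] sW[OF L] ls[OF L] k by (auto dest: inj_onD)
      then show "L \<in> s -` O' \<inter> space lattice_borel" using k L by auto
    qed
    also have "\<dots> \<in> sets lattice_borel"
    proof -
      have "lattice_of ` ((W k \<inter> O') \<inter> SL_real) \<in> sets lattice_borel" for k
        by (intro lattice_of_image_open_measurable open_Int opn O')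
      then show ?thesis by measurable
    qed
    finally show "s -` O' \<inter> space lattice_borel \<in> sets lattice_borel" .
  qed
  then show thesis using that sW ls by blast
qed

definition basis_selection :: "((real^'n::finite) set \<Rightarrow> real^'n^'n) \<Rightarrow> bool" where
  "basis_selection s \<longleftrightarrow> s \<in> borel_measurable lattice_borel \<and>
     (\<forall>L\<in>lattice_space. s L \<in> SL_real \<and> lattice_of (s L) = L)"

text \<open>One global Borel choice of basis reduces measurability on the space of lattices to
  measurability of matrix-valued functions.\<close>

definition basis_of :: "(real^'n::finite) set \<Rightarrow> real^'n^'n" where
  "basis_of = (SOME s. basis_selection s)"

lemma basis_selection_basis_of: "basis_selection basis_of"
proof -
  have "\<exists>s :: (real^'n::finite) set \<Rightarrow> real^'n^'n. basis_selection s"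
    by (rule lattice_basis_selection) (auto simp: basis_selection_def)
  then show ?thesis unfolding basis_of_def by (rule someI_ex[of basis_selection])
qed

lemmas basis_of_spec = basis_selection_basis_of[unfolded basis_selection_def]

lemma measurable_basis_of [measurable]: "basis_of \<in> borel_measurable lattice_borel"
  by (rule basis_of_spec[THEN conjunct1])

lemma basis_of_SL: "L \<in> lattice_space \<Longrightarrow> basis_of L \<in> SL_real"
  using basis_of_spec[THEN conjunct2] by blast

lemma lattice_of_basis_of: "L \<in> lattice_space \<Longrightarrow> lattice_of (basis_of L) = L"
  using basis_of_spec[THEN conjunct2] by blast

lemma measurable_lattice_of:
  fixes f :: "'a \<Rightarrow> real^'n::finite^'n"
  assumes f [measurable]: "f \<in> borel_measurable M" and SL: "\<And>x. x \<in> space M \<Longrightarrow> f x \<in> SL_real"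
  shows "(\<lambda>x. lattice_of (f x)) \<in> measurable M lattice_borel"
  unfolding lattice_borel_def
proof (rule measurable_measure_of[OF open_lattice_sets_subset])
  show "(\<lambda>x. lattice_of (f x)) \<in> space M \<rightarrow> lattice_space"
    using SL by (auto simp: lattice_space_def)
  fix U :: "(real^'n) set set" assume "U \<in> open_lattice_sets"
  then obtain T where T: "open T" "{A \<in> SL_real. lattice_of A \<in> U} = SL_real \<inter> T"
    unfolding open_lattice_sets_def openin_open by auto
  have "(\<lambda>x. lattice_of (f x)) -` U \<inter> space M = f -` T \<inter> space M"
  proof -
    have "lattice_of A \<in> U \<longleftrightarrow> A \<in> T" if "A \<in> SL_real" for A
      using T(2) that by (auto simp: set_eq_iff)
    then show ?thesis using SL by auto
  qed
  then show "(\<lambda>x. lattice_of (f x)) -` U \<inter> space M \<in> sets M"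
    using measurable_sets[OF f, of T] T(1) by simp
qed

text \<open>Joint measurability in the matrix and the lattice: replacing the lattice by its chosen
  basis turns the action into a matrix product followed by the quotient map.\<close>

lemma measurable_act:
  assumes f [measurable]: "f \<in> borel_measurable M" and g [measurable]: "g \<in> measurable M lattice_borel"
    and SL: "\<And>x. x \<in> space M \<Longrightarrow> f x \<in> SL_real"
  shows "(\<lambda>x. act (f x) (g x)) \<in> measurable M lattice_borel"
proof -
  have gs: "g x \<in> lattice_space" if "x \<in> space M" for x
    using measurable_space[OF g that] by simp
  have "(\<lambda>x. lattice_of (f x ** basis_of (g x))) \<in> measurable M lattice_borel"
    using SL basis_of_SL[OF gs] by (intro measurable_lattice_of SL_real_mult) auto
  moreover have "lattice_of (f x ** basis_of (g x)) = act (f x) (g x)" if "x \<in> space M" for x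
    by (simp add: act_lattice_of[symmetric] lattice_of_basis_of[OF gs[OF that]])
  ultimately show ?thesis by (simp cong: measurable_cong)
qed

lemma measurable_act_const [measurable]: "A \<in> SL_real \<Longrightarrow> act A \<in> measurable lattice_borel lattice_borel"
  using measurable_act[of "\<lambda>_. A" lattice_borel "\<lambda>x. x"] by simp

section \<open>Generation of the special linear group by transvections\<close>

text \<open>For \<open>m \<noteq> n\<close> this is the elementary matrix with off-diagonal entry
  \<open>c\<close>. The body has the shape used by the induction rule
  \<open>induct_matrix_elementary\<close>, so that rule applies without conversion.\<close>

definition transv :: "'n \<Rightarrow> 'n \<Rightarrow> real \<Rightarrow> real^'n::finite^'n" where
  "transv m n c = (\<chi> i j. if i = m \<and> j = n then c else of_bool (i = j))"

lemma transv_nth: "transv m n c $ i $ j = (if i = m \<and> j = n then c else of_bool (i = j))"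
  by (simp add: transv_def)

lemma transv_mult:
  assumes "m \<noteq> n"
  shows "(transv m n c ** A) $ i $ j = A $ i $ j + (if i = m then c * A $ n $ j else 0)"
proof -
  have "(transv m n c ** A) $ i $ j
      = (\<Sum>k\<in>UNIV. (if k = i then A $ k $ j else 0) + (if k = n then (if i = m then c * A $ n $ j else 0) else 0))"
  proof -
    have "(transv m n c ** A) $ i $ j = (\<Sum>k\<in>UNIV. transv m n c $ i $ k * A $ k $ j)"
      by (simp add: matrix_matrix_mult_def)
    also have "\<dots> = (\<Sum>k\<in>UNIV. (if k = i then A $ k $ j else 0) + (if k = n then (if i = m then c * A $ n $ j else 0) else 0))"
      by (rule sum.cong) (use assms in \<open>auto simp: transv_def\<close>)
    finally show ?thesis .
  qed
  then show ?thesis by (simp add: sum.distrib)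
qed

lemma mat_1_nth: "mat 1 $ i $ j = of_bool (i = j)"
  by (simp add: mat_def)

lemma det_transv:
  fixes m n :: "'n::finite"
  assumes "m \<noteq> n"
  shows "det (transv m n c) = 1"
proof -
  have "transv m n c = (\<chi> k. if k = m then row m (mat 1) + c *s row n (mat 1) else row k (mat 1 :: real^'n^'n))"
    using assms by (auto simp: vec_eq_iff transv_def row_def mat_def)
  then show ?thesis using det_row_operation[OF assms, of "mat 1 :: real^'n^'n" c] by simp
qed

inductive_set transv_group :: "(real^'n::finite^'n) set" where
  one: "mat 1 \<in> transv_group"
| step: "m \<noteq> n \<Longrightarrow> g \<in> transv_group \<Longrightarrow> transv m n c ** g \<in> transv_group"

lemma transv_in_group: "m \<noteq> n \<Longrightarrow> transv m n c \<in> transv_group"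
  using transv_group.step[OF _ transv_group.one, of m n c] by simp

lemma transv_group_mult: "g \<in> transv_group \<Longrightarrow> h \<in> transv_group \<Longrightarrow> g ** h \<in> transv_group"
  by (induction rule: transv_group.induct)
     (auto simp: matrix_mul_assoc[symmetric] intro: transv_group.step)

lemma det_transv_group: "g \<in> transv_group \<Longrightarrow> det g = 1"
  by (induction rule: transv_group.induct) (auto simp: det_mul det_transv)

definition diag :: "('n \<Rightarrow> real) \<Rightarrow> real^'n::finite^'n" where
  "diag a = (\<chi> i j. if i = j then a i else 0)"

lemma diag_mult_nth: "(diag a ** A) $ i $ j = a i * A $ i $ j"
proof -
  have "(diag a ** A) $ i $ j = (\<Sum>k\<in>UNIV. if k = i then a i * A $ k $ j else 0)"
  proof -
    have "(diag a ** A) $ i $ j = (\<Sum>k\<in>UNIV. diag a $ i $ k * A $ k $ j)"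
      by (simp add: matrix_matrix_mult_def)
    also have "\<dots> = (\<Sum>k\<in>UNIV. if k = i then a i * A $ k $ j else 0)"
      by (rule sum.cong) (auto simp: diag_def)
    finally show ?thesis .
  qed
  then show ?thesis by simp
qed

lemma mult_diag_nth: "(A ** diag a) $ i $ j = A $ i $ j * a j"
proof -
  have "(A ** diag a) $ i $ j = (\<Sum>k\<in>UNIV. if k = j then A $ i $ k * a j else 0)"
  proof -
    have "(A ** diag a) $ i $ j = (\<Sum>k\<in>UNIV. A $ i $ k * diag a $ k $ j)"
      by (simp add: matrix_matrix_mult_def)
    also have "\<dots> = (\<Sum>k\<in>UNIV. if k = j then A $ i $ k * a j else 0)"
      by (rule sum.cong) (auto simp: diag_def)
    finally show ?thesis .
  qed
  then show ?thesis by simp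
qed

lemma diag_mult: "diag a ** diag b = diag (\<lambda>i. a i * b i)"
  by (simp add: vec_eq_iff diag_mult_nth) (simp add: diag_def)

lemma diag_1: "diag (\<lambda>_. 1) = mat 1"
  by (simp add: vec_eq_iff diag_def mat_def)

lemma det_diag: "det (diag a) = prod a UNIV"
proof -
  have "det (diag a) = prod (\<lambda>i. diag a $ i $ i) UNIV" by (rule det_diagonal) (simp add: diag_def)
  then show ?thesis by (simp add: diag_def)
qed

text \<open>Invertible diagonal matrices normalise the group generated by the transvections, since
  conjugation only rescales the off-diagonal entry. This allows determinant factors to be collected
  on the right of a product.\<close>

lemma transv_group_conj_diag:
  assumes "g \<in> transv_group" "\<And>i. a i \<noteq> 0"
  shows "diag a ** g ** diag (\<lambda>i. 1 / a i) \<in> transv_group"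
  using assms(1)
proof induction
  case one
  have "diag a ** diag (\<lambda>i. 1 / a i) = mat 1" using assms(2) by (simp add: diag_mult diag_1)
  then show ?case by (simp add: transv_group.one)
next
  case (step m n g c)
  have "diag a ** transv m n c = transv m n (a m * c / a n) ** diag a"
    using assms(2) step.hyps(1)
    by (auto simp: vec_eq_iff diag_mult_nth mult_diag_nth transv_def)
  then have "diag a ** (transv m n c ** g) ** diag (\<lambda>i. 1 / a i)
      = transv m n (a m * c / a n) ** (diag a ** g ** diag (\<lambda>i. 1 / a i))"
    by (simp add: matrix_mul_assoc)
  then show ?case using step by (simp add: transv_group.step)
qed

text \<open>Steinberg's relation \<open>w(b) = x(b) y(-1/b) x(b)\<close>, where \<open>x\<close> and
  \<open>y\<close> are the two opposite transvections in the coordinates \<open>m\<close>,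
  \<open>n\<close>.\<close>

lemma rotation_in_transv_group:
  fixes m n :: "'n::finite" and b :: real
  assumes "m \<noteq> n" "b \<noteq> 0"
  shows "(\<chi> i j. if i = m then (if j = n then b else 0)
      else if i = n then (if j = m then - 1 / b else 0) else of_bool (i = j)) \<in> transv_group"
    (is "?w \<in> _")
proof -
  have "?w = transv m n b ** (transv n m (- 1 / b) ** (transv m n b ** mat 1))"
    using assms by (auto simp: vec_eq_iff transv_mult mat_1_nth simp del: matrix_mul_rid)
  also have "\<dots> \<in> transv_group"
    by (intro transv_group.intros) (use assms in auto)
  finally show ?thesis .
qed

text \<open>Steinberg's relation \<open>h(b) = w(b) w(-1)\<close> for the diagonal torus element,
  with both factors written out as three transvections.\<close>

lemma transv_group_diag2:
  fixes m n :: "'n::finite"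
  assumes "m \<noteq> n" "b \<noteq> 0"
  shows "diag (\<lambda>i. if i = m then b else if i = n then 1 / b else 1) \<in> transv_group"
proof -
  have "diag (\<lambda>i. if i = m then b else if i = n then 1 / b else 1)
     = transv m n b ** (transv n m (- 1 / b) ** (transv m n b **
       (transv m n (-1) ** (transv n m 1 ** (transv m n (-1) ** mat 1)))))"
    using assms by (auto simp: vec_eq_iff transv_mult mat_1_nth diag_def simp del: matrix_mul_rid)
  also have "\<dots> \<in> transv_group"
    by (intro transv_group.intros) (use assms in auto)
  finally show ?thesis .
qed

text \<open>The elementary induction runs over all square matrices, so the claim is widened to them:
  an invertible \<open>A\<close> is an element of the group times \<open>D (det A)\<close>, which
  carries the whole determinant in one fixed coordinate \<open>k\<close>. For singular matrices the
  claim is void, and it passes to products by the normalisation property.\<close>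

lemma SL_real_subset_transv_group:
  fixes A :: "real^'n::finite^'n"
  assumes "A \<in> SL_real"
  shows "A \<in> transv_group"
proof -
  fix k :: 'n
  define D where "D b = diag (\<lambda>i. if i = k then b else 1)" for b
  have D_mult: "D a ** D b = D (a * b)" for a b
    unfolding D_def diag_mult by (rule arg_cong[of _ _ diag]) auto
  have detD: "det (D b) = b" for b
    by (simp add: D_def det_diag)
  have D1: "D 1 = mat 1" by (simp add: D_def diag_1 cong: if_cong)
  define P where "P A \<longleftrightarrow> (det A \<noteq> 0 \<longrightarrow> (\<exists>g\<in>transv_group. A = g ** D (det A)))" for A
  have mult: "P (A ** B)" if PA: "P A" and PB: "P B" for A B
  proof (cases "det (A ** B) = 0")
    case False
    then have nz: "det A \<noteq> 0" "det B \<noteq> 0" by (auto simp: det_mul)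
    obtain g where g: "g \<in> transv_group" "A = g ** D (det A)" using PA nz unfolding P_def by blast
    obtain h where h: "h \<in> transv_group" "B = h ** D (det B)" using PB nz unfolding P_def by blast
    define h' where "h' = D (det A) ** h ** D (1 / det A)"
    have "h' = diag (\<lambda>i. if i = k then det A else 1) ** h ** diag (\<lambda>i. 1 / (if i = k then det A else 1))"
      unfolding h'_def D_def by (rule arg_cong[where f = "\<lambda>a. _ ** _ ** diag a"]) auto
    then have h': "h' \<in> transv_group"
      using transv_group_conj_diag[OF h(1), of "\<lambda>i. if i = k then det A else 1"] nz by simp
    have "A ** B = g ** D (det A) ** (h ** D (det B))" using g(2) h(2) by metis
    also have "\<dots> = g ** (h' ** D (det A)) ** D (det B)"
    proof -
      have "h' ** D (det A) = D (det A) ** h ** (D (1 / det A) ** D (det A))"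
        unfolding h'_def by (simp only: matrix_mul_assoc)
      also have "D (1 / det A) ** D (det A) = mat 1" using nz by (simp add: D_mult D1)
      finally have "h' ** D (det A) = D (det A) ** h" by simp
      then show ?thesis by (simp add: matrix_mul_assoc)
    qed
    also have "\<dots> = g ** h' ** (D (det A) ** D (det B))" by (simp only: matrix_mul_assoc)
    also have "\<dots> = g ** h' ** D (det (A ** B))" by (simp add: D_mult det_mul)
    finally show ?thesis unfolding P_def using transv_group_mult[OF g(1) h'] by blast
  qed (simp add: P_def)
  have ptrans: "P g" if "g \<in> transv_group" for g
    using that D1 det_transv_group[OF that] unfolding P_def by auto
  have pdiag1: "P (diag (\<lambda>i. if i = p then b else 1))" for p b
  proof (cases "b = 0 \<or> p = k")
    case True
    then show ?thesis
    proof
      assume "b = 0" then show ?thesis by (simp add: P_def det_diag)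
    next
      assume "p = k"
      then have "diag (\<lambda>i. if i = p then b else 1) = mat 1 ** D b" by (simp add: D_def)
      then show ?thesis unfolding P_def using transv_group.one detD by (metis matrix_mul_lid)
    qed
  next
    case False
    \<comment> \<open>A factor \<open>b\<close> in coordinate \<open>p\<close> is moved to
      coordinate \<open>k\<close> at the cost of an element of the group.\<close>
    let ?h = "diag (\<lambda>i. if i = p then b else if i = k then 1 / b else 1)"
    have "P ?h" by (rule ptrans[OF transv_group_diag2]) (use False in auto)
    moreover have "P (D b)"
      unfolding P_def detD using transv_group.one by (metis matrix_mul_lid)
    ultimately have "P (?h ** D b)" by (rule mult)
    also have "?h ** D b = diag (\<lambda>i. if i = p then b else 1)"
      unfolding D_def diag_mult using False by (intro arg_cong[of _ _ diag]) auto
    finally show ?thesis .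
  qed
  have pdiag: "P (diag a)" for a
  proof -
    have "P (diag (\<lambda>i. if i \<in> F then a i else 1))" for F
    proof (induction F rule: finite_induct[OF finite])
      case 1
      show ?case using ptrans[OF transv_group.one] by (simp add: diag_1)
    next
      case (2 p F)
      have "diag (\<lambda>i. if i \<in> insert p F then a i else 1)
          = diag (\<lambda>i. if i = p then a p else 1) ** diag (\<lambda>i. if i \<in> F then a i else 1)"
        unfolding diag_mult using 2 by (intro arg_cong[of _ _ diag]) auto
      then show ?case using mult[OF pdiag1 2(3)] by simp
    qed
    from this[of UNIV] show ?thesis by simp
  qed
  have "P A"
  proof (rule induct_matrix_elementary)
    show "P A" if "\<And>i j. i \<noteq> j \<Longrightarrow> A $ i $ j = 0" for A :: "real^'n^'n"
    proof -
      have "A = diag (\<lambda>i. A $ i $ i)" using that by (auto simp: vec_eq_iff diag_def)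
      then show ?thesis using pdiag by metis
    qed
    show "P A" if "row i A = 0" for A :: "real^'n^'n" and i
      using det_zero_row(2)[OF that] by (simp add: P_def)
    show "P (\<chi> i j. mat 1 $ i $ Transposition.transpose m n j)" if "m \<noteq> n" for m n :: 'n
    proof -
      \<comment> \<open>A transposition has determinant \<open>-1\<close>; it is the rotation for
        \<open>b = 1\<close> followed on the right by a sign change in coordinate
        \<open>m\<close>.\<close>
      let ?w = "\<chi> i j. if i = m then (if j = n then 1 else 0)
        else if i = n then (if j = m then - 1 / 1 else 0) else of_bool (i = j)"
      have "P (?w ** diag (\<lambda>i. if i = m then -1 else 1))"
        by (intro mult ptrans rotation_in_transv_group that pdiag1) auto
      also have "?w ** diag (\<lambda>i. if i = m then -1 else 1)
          = (\<chi> i j. mat 1 $ i $ Transposition.transpose m n j)"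
        using that by (auto simp: vec_eq_iff mult_diag_nth mat_1_nth Transposition.transpose_def)
      finally show ?thesis .
    qed
    show "P (\<chi> i j. if i = m \<and> j = n then c else of_bool (i = j))" if "m \<noteq> n" for m n :: 'n and c
      using ptrans[OF transv_in_group[OF that]] by (simp only: transv_def)
  qed (rule mult)
  then obtain g where g: "g \<in> transv_group" "A = g ** D 1"
    using assms unfolding P_def SL_real_def by auto
  then show ?thesis by (simp add: D1)
qed

text \<open>A transvection inside a diagonal block is a commutator of two off-block ones passing
  through an index of the other block, which exists because both index types are nonempty. Only the
  off-block transvections are contracted by the flow in one time direction, so this is the form in
  which generation is used.\<close>

lemma SL_real_induct_blocks:
  fixes A :: "real^('d::finite + 'c::finite)^('d + 'c)"
  assumes "A \<in> SL_real"
    and one: "P (mat 1)"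
    and mult: "\<And>A B. A \<in> SL_real \<Longrightarrow> B \<in> SL_real \<Longrightarrow> P A \<Longrightarrow> P B \<Longrightarrow> P (A ** B)"
    and up: "\<And>i j c. P (transv (Inl i) (Inr j) c)" and dn: "\<And>i j c. P (transv (Inr j) (Inl i) c)"
  shows "P A"
proof -
  have SLt: "transv m n c \<in> SL_real" if "m \<noteq> n" for m n :: "'d + 'c" and c
    using det_transv[OF that] by (simp add: SL_real_def)
  have comm: "P (transv m n c)" if mn: "m \<noteq> n" and k: "k \<noteq> m" "k \<noteq> n"
    and P: "\<And>c. P (transv m k c)" "\<And>c. P (transv k n c)" for m n k :: "'d + 'c" and c
  proof -
    have "P (transv m k c ** (transv k n 1 ** (transv m k (- c) ** (transv k n (-1) ** mat 1))))"
      using mn k by (intro mult P one SL_real_mult SLt SL_real_one) auto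
    also have "transv m k c ** (transv k n 1 ** (transv m k (- c) ** (transv k n (-1) ** mat 1))) = transv m n c"
      using mn k by (auto simp: vec_eq_iff transv_mult mat_1_nth transv_nth simp del: matrix_mul_rid)
    finally show ?thesis .
  qed
  have tr: "P (transv m n c)" if "m \<noteq> n" for m n :: "'d + 'c" and c
  proof (cases m)
    case m: (Inl i)
    show ?thesis
    proof (cases n)
      case n: (Inl j)
      show ?thesis unfolding m n
        by (rule comm[of _ _ "Inr undefined"]) (use that m n in \<open>simp_all add: up dn\<close>)
    qed (simp add: m up)
  next
    case m: (Inr i)
    show ?thesis
    proof (cases n)
      case n: (Inr j)
      show ?thesis unfolding m n
        by (rule comm[of _ _ "Inl undefined"]) (use that m n in \<open>simp_all add: up dn\<close>)
    qed (simp add: m dn)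
  qed
  have "g \<in> transv_group \<Longrightarrow> P g \<and> g \<in> SL_real" for g :: "real^('d + 'c)^('d + 'c)"
  proof (induction rule: transv_group.induct)
    case one
    show ?case using assms(2) SL_real_one by blast
  next
    case (step m n g c)
    then show ?case using mult[OF SLt _ tr] SL_real_mult[OF SLt] by blast
  qed
  then show ?thesis using SL_real_subset_transv_group[OF assms(1)] by blast
qed

section \<open>Ergodicity\<close>

lemma det_scaleR: "det (c *\<^sub>R A) = c ^ CARD('n) * det (A :: real^'n::finite^'n)"
proof -
  have "c *\<^sub>R A = diag (\<lambda>_. c) ** A"
    by (simp add: vec_eq_iff diag_mult_nth)
  then show ?thesis by (simp add: det_mul det_diag)
qed

lemma scaleR_matrix_mult: "(c *\<^sub>R A) ** B = c *\<^sub>R (A ** B :: real^'n::finite^'n)"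
  by (simp add: scalar_matrix_assoc)

text \<open>Radial projection of the matrices of positive determinant onto \<open>SL_real\<close>.
  Seen through it, Lebesgue measure serves as a substitute for Haar measure; the default
  \<open>mat 1\<close> makes the map total with values in \<open>SL_real\<close>.\<close>

definition unimodular :: "real^'n::finite^'n \<Rightarrow> real^'n^'n" where
  "unimodular h = (if det h > 0 then (det h powr (- 1 / real CARD('n))) *\<^sub>R h else mat 1)"

lemma unimodular_SL: "unimodular h \<in> SL_real"
proof (cases "det h > 0")
  case True
  have "(det h powr (- 1 / real CARD('a))) ^ CARD('a) = det h powr (- 1)"
    using True by (simp add: powr_realpow[symmetric] powr_powr)
  then show ?thesis using True
    by (simp add: unimodular_def SL_real_def det_scaleR powr_minus)
qed (simp add: unimodular_def SL_real_one)

lemma borel_measurable_det [measurable (raw)]: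
  fixes f :: "'a \<Rightarrow> real^'n::finite^'n"
  assumes "f \<in> borel_measurable M"
  shows "(\<lambda>x. det (f x)) \<in> borel_measurable M"
  by (rule borel_measurable_continuous_on[OF _ assms]) (intro continuous_intros)

lemma measurable_unimodular [measurable]: "unimodular \<in> borel_measurable borel"
  unfolding unimodular_def by measurable

lemma unimodular_mult_SL:
  assumes "A \<in> SL_real"
  shows "unimodular (h ** A) = unimodular h ** A \<or> \<not> det h > 0"
  using assms by (auto simp: unimodular_def SL_real_def det_mul scaleR_matrix_mult)

lemma not_AE_det_nonpos: "\<not> (AE h in lborel. \<not> det (h :: real^'n::finite^'n) > 0)"
proof
  assume "AE h in lborel. \<not> det (h :: real^'n^'n) > 0"
  then have "emeasure lborel {h :: real^'n^'n. det h > 0} = 0"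
    by (subst (asm) AE_iff_measurable[OF _ refl]) auto
  moreover have op: "open {h :: real^'n^'n. det h > 0}" by (intro open_Collect_less continuous_intros)
  ultimately have "negligible {h :: real^'n^'n. det h > 0}"
    by (simp add: negligible_iff_emeasure0 borel_open)
  moreover have "{h :: real^'n^'n. det h > 0} \<noteq> {}" using det_I[where 'n = 'n] by (auto intro!: exI[of _ "mat 1"])
  ultimately show False using open_not_negligible[OF op] by blast
qed

text \<open>Right multiplication by \<open>A\<close> is linear, so it maps null sets to null sets.
  This quasi-invariance is the part of Haar invariance that the transitivity argument uses.\<close>

lemma AE_lborel_mult_right:
  fixes A :: "real^'n::finite^'n"
  assumes A: "A \<in> SL_real" and ae: "AE h in lborel. P (h ** A)"
  shows "AE h in lborel. P h"
proof -
  obtain B where B: "A ** B = mat 1" "B ** A = mat 1" using SL_real_inverse[OF A] by blast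
  obtain N where N: "N \<in> null_sets lborel" "{h. \<not> P (h ** A)} \<subseteq> N"
    using ae unfolding eventually_ae_filter by auto
  have "negligible N"
    using N(1) by (simp add: negligible_iff_null_sets null_sets_completionI)
  moreover have "linear (\<lambda>h. h ** A)"
    by (rule linearI) (simp_all add: vec_eq_iff matrix_matrix_mult_def distrib_right sum.distrib sum_distrib_left mult.assoc)
  ultimately have "negligible ((\<lambda>h. h ** A) ` N)"
    by (intro negligible_differentiable_image_negligible linear_imp_differentiable_on) auto
  moreover have "{h. \<not> P h} \<subseteq> (\<lambda>h. h ** A) ` N"
  proof
    fix h assume "h \<in> {h. \<not> P h}"
    moreover have "h ** B ** A = h" using B(2) by (simp add: matrix_mul_assoc[symmetric])
    ultimately have "h ** B \<in> N" "h = h ** B ** A" using N(2) by auto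
    then show "h \<in> (\<lambda>h. h ** A) ` N" by blast
  qed
  ultimately have "negligible {h. \<not> P h}" using negligible_subset by blast
  then have "AE h in lebesgue. P h"
    by (auto simp: negligible_iff_null_sets intro: AE_I')
  then show ?thesis by (simp add: AE_completion_iff)
qed

section \<open>Invariant measures on the space of lattices\<close>

locale lattice_measure =
  fixes \<mu> :: "(real^'n::finite) set measure"
  assumes invariant_mu: "invariant_lattice_measure \<mu>"
begin

lemma sets_mu [measurable_cong, simp]: "sets \<mu> = sets lattice_borel"
  using invariant_mu by (simp add: invariant_lattice_measure_def)

lemma space_mu [simp]: "space \<mu> = lattice_space"
  using sets_eq_imp_space_eq[OF sets_mu] by simp

sublocale finite_measure \<mu>
  using invariant_mu by (simp add: invariant_lattice_measure_def)

lemma measurable_act_mu [measurable]: "A \<in> SL_real \<Longrightarrow> act A \<in> measurable \<mu> \<mu>"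
  using measurable_act_const[of A] by (simp cong: measurable_cong_sets)

lemma distr_act:
  assumes A: "A \<in> SL_real"
  shows "distr \<mu> \<mu> (act A) = \<mu>"
proof (rule measure_eqI)
  fix B assume "B \<in> sets (distr \<mu> \<mu> (act A))"
  then have B: "B \<in> sets \<mu>" by simp
  then have BX: "B \<subseteq> lattice_space" using sets.sets_into_space[OF B] by simp
  obtain A' where A': "A' \<in> SL_real" "A ** A' = mat 1" "A' ** A = mat 1" using SL_real_inverse[OF A] .
  have "act A -` B \<inter> space \<mu> = act A' ` B"
  proof (intro set_eqI iffI)
    fix x assume "x \<in> act A -` B \<inter> space \<mu>"
    then show "x \<in> act A' ` B"
      by (intro image_eqI[of _ _ "act A x"]) (simp_all add: act_mult A' act_one)
  next
    fix x assume "x \<in> act A' ` B"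
    then show "x \<in> act A -` B \<inter> space \<mu>"
      using BX A' by (auto simp: act_mult act_one intro: act_lattice_space)
  qed
  then show "emeasure (distr \<mu> \<mu> (act A)) B = emeasure \<mu> B"
    using A A' B invariant_mu by (simp add: emeasure_distr invariant_lattice_measure_def)
qed simp

lemma AE_act: "A \<in> SL_real \<Longrightarrow> AE x in \<mu>. P x \<Longrightarrow> AE x in \<mu>. P (act A x)"
  by (rule AE_distrD[OF measurable_act_mu, of A P], assumption, subst distr_act)

lemma emeasure_act_vimage:
  "A \<in> SL_real \<Longrightarrow> B \<in> sets \<mu> \<Longrightarrow> emeasure \<mu> (act A -` B \<inter> space \<mu>) = emeasure \<mu> B"
  using emeasure_distr[OF measurable_act_mu, of A B] distr_act by simp

lemma measure_act_vimage:
  "A \<in> SL_real \<Longrightarrow> B \<in> sets \<mu> \<Longrightarrow> measure \<mu> {x \<in> lattice_space. act A x \<in> B} = measure \<mu> B"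
proof -
  assume "A \<in> SL_real" "B \<in> sets \<mu>"
  moreover have "{x \<in> lattice_space. act A x \<in> B} = act A -` B \<inter> space \<mu>" by auto
  ultimately show ?thesis using emeasure_act_vimage[of A B] by (simp add: measure_def)
qed

text \<open>The symmetric difference of \<open>B\<close> and its preimage under
  \<open>act A\<close>; its measure quantifies how far \<open>B\<close> is from being invariant
  under \<open>A\<close>.\<close>

definition moved :: "(real^'n) set set \<Rightarrow> real^'n^'n \<Rightarrow> (real^'n) set set" where
  "moved B A = {x \<in> lattice_space. (act A x \<in> B) \<noteq> (x \<in> B)}"

lemma moved_sets [measurable]:
  assumes [measurable]: "A \<in> SL_real" "B \<in> sets \<mu>"
  shows "moved B A \<in> sets \<mu>"
proof -
  have [measurable]: "act A \<in> measurable \<mu> \<mu>" using assms(1) by (rule measurable_act_mu)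
  have "{x \<in> space \<mu>. (act A x \<in> B) \<noteq> (x \<in> B)} \<in> sets \<mu>" by measurable
  then show ?thesis by (simp add: moved_def)
qed

text \<open>A point of an open \<open>U\<close> stays in \<open>U\<close> for matrices close to the
  identity, so the set \<open>E k\<close> of points that leave has measure tending to zero by
  dominated convergence. Points that enter admit no such pointwise argument, but they have the same
  measure as those that leave, since the action preserves the finite measure.\<close>

lemma moved_open_tendsto_0:
  assumes u: "\<And>k. u k \<in> SL_real" and lim: "u \<longlonglongrightarrow> mat 1" and U: "U \<in> open_lattice_sets"
  shows "(\<lambda>k. measure \<mu> (moved U (u k))) \<longlonglongrightarrow> 0"
proof -
  have Um: "U \<in> sets \<mu>" using U by (simp add: sets_lattice_borel sigma_sets.Basic)
  have UX: "U \<subseteq> lattice_space" using U by (simp add: open_lattice_sets_def)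
  define E where "E k = {x \<in> lattice_space. x \<in> U \<and> act (u k) x \<notin> U}" for k
  have Vm: "{x \<in> lattice_space. act (u k) x \<in> U} \<in> sets \<mu>" for k
    using measurable_sets[OF measurable_act_mu[OF u] Um] by (simp add: vimage_def Int_def conj_commute)
  have Em [measurable]: "E k \<in> sets \<mu>" for k
  proof -
    have "E k = U - {x \<in> lattice_space. act (u k) x \<in> U}" using UX by (auto simp: E_def)
    then show ?thesis using Vm Um by auto
  qed
  have half: "measure \<mu> (moved U (u k)) = 2 * measure \<mu> (E k)" for k
  proof -
    let ?V = "{x \<in> lattice_space. act (u k) x \<in> U}"
    have "moved U (u k) = E k \<union> (?V - U)" using UX by (auto simp: moved_def E_def)
    then have "measure \<mu> (moved U (u k)) = measure \<mu> (E k) + measure \<mu> (?V - U)"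
      using finite_measure_Union[OF Em, of "?V - U" k] Vm Um by (auto simp: E_def)
    moreover have "measure \<mu> (?V - U) = measure \<mu> ?V - measure \<mu> (?V \<inter> U)"
      using finite_measure_Diff'[OF Vm Um] .
    moreover have "measure \<mu> (E k) = measure \<mu> U - measure \<mu> (U \<inter> ?V)"
    proof -
      have "E k = U - ?V" using UX by (auto simp: E_def)
      then show ?thesis using finite_measure_Diff'[OF Um Vm] by simp
    qed
    moreover have "measure \<mu> ?V = measure \<mu> U" by (rule measure_act_vimage[OF u Um])
    ultimately show ?thesis by (simp add: Int_commute)
  qed
  have "(\<lambda>k. \<integral>x. indicator (E k) x \<partial>\<mu>) \<longlonglongrightarrow> (\<integral>x. (0::real) \<partial>\<mu>)"
  proof (rule integral_dominated_convergence[where w = "\<lambda>_. 1"])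
    show "AE x in \<mu>. (\<lambda>k. indicator (E k) x) \<longlonglongrightarrow> (0::real)"
    proof (rule AE_I2)
      fix x assume x: "x \<in> space \<mu>"
      have "eventually (\<lambda>k. indicator (E k) x = (0::real)) sequentially"
      proof (cases "x \<in> U")
        case True
        obtain A where A: "A \<in> SL_real" "x = lattice_of A" using x by (auto simp: lattice_space_def)
        obtain T where T: "open T" "{A \<in> SL_real. lattice_of A \<in> U} = SL_real \<inter> T"
          using U unfolding open_lattice_sets_def openin_open by auto
        have "(\<lambda>k. u k ** A) \<longlonglongrightarrow> mat 1 ** A"
          unfolding matrix_matrix_mult_def by (intro tendsto_vec_lambda tendsto_intros lim)
        moreover have "mat 1 ** A \<in> T" using T(2) A True by auto
        ultimately have "eventually (\<lambda>k. u k ** A \<in> T) sequentially"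
          by (rule topological_tendstoD[OF _ T(1)])
        then show ?thesis
        proof eventually_elim
          case (elim k)
          then have "u k ** A \<in> {A \<in> SL_real. lattice_of A \<in> U}"
            unfolding T(2) using u A by (auto intro: SL_real_mult)
          then show ?case using A by (simp add: E_def act_lattice_of)
        qed
      qed (simp add: E_def)
      then show "(\<lambda>k. indicator (E k) x) \<longlonglongrightarrow> (0::real)" by (rule tendsto_eventually)
    qed
  qed auto
  then have "(\<lambda>k. measure \<mu> (E k)) \<longlonglongrightarrow> 0"
    using sets.sets_into_space[OF Em] by (simp add: Int_absorb2)
  from tendsto_mult_right[OF this, of 2] show ?thesis by (simp add: half)
qed

text \<open>Continuity of the action in the measure algebra, by induction over the generated
  \<sigma>-algebra. Complements are moved by the same points, and a countable union is approximated
  by finite ones up to a tail of small measure.\<close>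

lemma moved_tendsto_0:
  assumes u: "\<And>k. u k \<in> SL_real" and lim: "u \<longlonglongrightarrow> mat 1" and B: "B \<in> sets \<mu>"
  shows "(\<lambda>k. measure \<mu> (moved B (u k))) \<longlonglongrightarrow> 0"
proof -
  have "B \<in> sigma_sets lattice_space open_lattice_sets" using B by (simp add: sets_lattice_borel)
  then show ?thesis
  proof induction
    case (Basic U)
    then show ?case by (rule moved_open_tendsto_0[OF u lim])
  next
    case Empty
    then show ?case by (simp add: moved_def)
  next
    case (Compl B)
    have "moved (lattice_space - B) (u k) = moved B (u k)" for k
      using act_lattice_space[OF u] by (auto simp: moved_def)
    then show ?case using Compl by simp
  next
    case (Union A)
    have Am [measurable]: "A i \<in> sets \<mu>" for i using Union(1) by (simp add: sets_lattice_borel)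
    define P where "P m = (\<Union>i<m. A i)" for m
    define R where "R m = (\<Union>i. A i) - P m" for m
    have Pm: "P m \<in> sets \<mu>" and Rm: "R m \<in> sets \<mu>" for m
      unfolding P_def R_def by measurable
    have PL: "(\<lambda>k. measure \<mu> (moved (P m) (u k))) \<longlonglongrightarrow> 0" for m
    proof (induction m)
      case 0 then show ?case by (simp add: P_def moved_def)
    next
      case (Suc m)
      have "P (Suc m) = P m \<union> A m" by (auto simp: P_def less_Suc_eq)
      then have sub: "moved (P (Suc m)) (u k) \<subseteq> moved (P m) (u k) \<union> moved (A m) (u k)" for k
        by (auto simp: moved_def)
      have le: "measure \<mu> (moved (P (Suc m)) (u k)) \<le> measure \<mu> (moved (P m) (u k)) + measure \<mu> (moved (A m) (u k))" for k
        by (rule order_trans[OF finite_measure_mono[OF sub] measure_Un_le]) (intro sets.Un moved_sets u Pm Am)+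
      have lm: "(\<lambda>k. measure \<mu> (moved (P m) (u k)) + measure \<mu> (moved (A m) (u k))) \<longlonglongrightarrow> 0"
        using tendsto_add[OF Suc Union(2)[of m]] by simp
      show ?case
        by (rule tendsto_sandwich[OF _ _ tendsto_const lm]) (simp_all add: le)
    qed
    have R0: "(\<lambda>m. measure \<mu> (R m)) \<longlonglongrightarrow> 0"
    proof -
      have "(\<lambda>m. measure \<mu> (R m)) \<longlonglongrightarrow> measure \<mu> (\<Inter>m. R m)"
      proof (rule finite_Lim_measure_decseq)
        show "range R \<subseteq> sets \<mu>" using Rm by blast
        have "P m \<subseteq> P n" if "m \<le> n" for m n
          unfolding P_def using that by (intro UN_mono) auto
        then show "decseq R" unfolding decseq_def R_def by blast
      qed
      also have "(\<Inter>m. R m) = {}"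
      proof -
        have "x \<notin> (\<Inter>m. R m)" for x
        proof
          assume x: "x \<in> (\<Inter>m. R m)"
          then have "x \<in> R 0" by blast
          then obtain i where "x \<in> A i" unfolding R_def by blast
          then have "x \<in> P (Suc i)" unfolding P_def by blast
          then have "x \<notin> R (Suc i)" unfolding R_def by blast
          then show False using x by blast
        qed
        then show ?thesis by blast
      qed
      finally show ?thesis by simp
    qed
    \<comment> \<open>The tail \<open>R m\<close> enters twice, once for \<open>x\<close> and once
      for \<open>act (u k) x\<close>; invariance makes the two contributions equal.\<close>
    have bnd: "measure \<mu> (moved (\<Union>i. A i) (u k)) \<le> measure \<mu> (moved (P m) (u k)) + 2 * measure \<mu> (R m)" for k m
    proof -
      let ?V = "{x \<in> lattice_space. act (u k) x \<in> R m}"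
      have Vm: "?V \<in> sets \<mu>"
        using measurable_sets[OF measurable_act_mu[OF u] Rm] by (simp add: vimage_def Int_def conj_commute)
      have "P m \<subseteq> (\<Union>i. A i)" unfolding P_def by blast
      then have "moved (\<Union>i. A i) (u k) \<subseteq> moved (P m) (u k) \<union> (R m \<union> ?V)"
        unfolding moved_def R_def by blast
      then have "measure \<mu> (moved (\<Union>i. A i) (u k)) \<le> measure \<mu> (moved (P m) (u k) \<union> (R m \<union> ?V))"
        by (rule finite_measure_mono) (intro sets.Un moved_sets u Pm Rm Vm)
      also have "\<dots> \<le> measure \<mu> (moved (P m) (u k)) + measure \<mu> (R m \<union> ?V)"
        by (intro measure_Un_le sets.Un moved_sets u Pm Rm Vm)
      also have "measure \<mu> (R m \<union> ?V) \<le> measure \<mu> (R m) + measure \<mu> ?V"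
        by (intro measure_Un_le Rm Vm)
      also have "measure \<mu> ?V = measure \<mu> (R m)" by (rule measure_act_vimage[OF u Rm])
      finally show ?thesis by simp
    qed
    show ?case
    proof (rule LIMSEQ_I)
      fix r :: real assume r: "r > 0"
      obtain m where m: "measure \<mu> (R m) < r / 4"
        using order_tendstoD(2)[OF R0, of "r / 4"] r by (auto simp: eventually_sequentially)
      have "eventually (\<lambda>k. measure \<mu> (moved (P m) (u k)) < r / 2) sequentially"
        using order_tendstoD(2)[OF PL[of m], of "r / 2"] r by simp
      then have "eventually (\<lambda>k. norm (measure \<mu> (moved (\<Union>i. A i) (u k)) - 0) < r) sequentially"
      proof eventually_elim
        case (elim k)
        then show ?case using bnd[of k m] m by simp
      qed
      then show "\<exists>no. \<forall>n\<ge>no. norm (measure \<mu> (moved (\<Union>i. A i) (u n)) - 0) < r"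
        by (simp add: eventually_sequentially)
    qed
  qed
qed

text \<open>Mautner's argument: \<open>u P\<^sub>k = P\<^sub>k w\<^sub>k\<close> with \<open>w\<^sub>k\<close> tending to the identity.\<close>

lemma mautner:
  assumes B: "B \<in> sets \<mu>" and P: "\<And>k. P k \<in> SL_real"
    and inv: "\<And>k x. x \<in> lattice_space \<Longrightarrow> act (P k) x \<in> B \<longleftrightarrow> x \<in> B"
    and u: "u \<in> SL_real" and w: "\<And>k. w k \<in> SL_real" "w \<longlonglongrightarrow> mat 1"
    and conj: "\<And>k. u ** P k = P k ** w k"
  shows "AE x in \<mu>. act u x \<in> B \<longleftrightarrow> x \<in> B"
proof -
  have eq: "measure \<mu> (moved B u) = measure \<mu> (moved B (w k))" for k
  proof -
    have "measure \<mu> (moved B u) = measure \<mu> {x \<in> lattice_space. act (P k) x \<in> moved B u}"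
      by (rule measure_act_vimage[OF P moved_sets[OF u B], symmetric])
    also have "{x \<in> lattice_space. act (P k) x \<in> moved B u} = moved B (w k)"
    proof -
      have "act (P k) x \<in> moved B u \<longleftrightarrow> x \<in> moved B (w k)" if x: "x \<in> lattice_space" for x
      proof -
        have "act u (act (P k) x) = act (P k) (act (w k) x)" by (simp add: act_mult conj)
        then show ?thesis
          using x act_lattice_space[OF P x] inv[OF x] inv[OF act_lattice_space[OF w(1) x]]
          unfolding moved_def by simp
      qed
      moreover have "moved B (w k) \<subseteq> lattice_space" by (auto simp: moved_def)
      ultimately show ?thesis by blast
    qed
    finally show ?thesis .
  qed
  have "measure \<mu> (moved B u) = 0"
    using moved_tendsto_0[OF w B] by (simp add: eq[symmetric] LIMSEQ_const_iff)
  then have "moved B u \<in> null_sets \<mu>"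
    using moved_sets[OF u B] by (auto simp: null_sets_def emeasure_eq_measure)
  from AE_not_in[OF this] AE_space show ?thesis
  proof eventually_elim
    case (elim x)
    then show ?case unfolding moved_def space_mu by blast
  qed
qed

text \<open>Fubini for pairs of a matrix and a lattice. It converts "for each matrix, almost every
  lattice", which invariance supplies, into a statement about the orbit of a single typical lattice,
  and back.\<close>

lemma AE_unimodular_commute:
  assumes Q [measurable]: "Measurable.pred (lattice_borel \<Otimes>\<^sub>M lattice_borel) (\<lambda>p. Q (fst p) (snd p))"
  shows "(AE h in lborel. AE x in \<mu>. det h > 0 \<longrightarrow> Q (act (unimodular h) x) x)
     \<longleftrightarrow> (AE x in \<mu>. AE h in lborel. det h > 0 \<longrightarrow> Q (act (unimodular h) x) x)"
proof -
  interpret pair_sigma_finite lborel \<mu> ..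
  have m1: "(\<lambda>p. act (unimodular (fst p)) (snd p)) \<in> measurable (lborel \<Otimes>\<^sub>M \<mu>) lattice_borel"
    by (rule measurable_act) (auto simp: unimodular_SL)
  have m2: "snd \<in> measurable (lborel \<Otimes>\<^sub>M \<mu>) lattice_borel"
    using measurable_snd[of lborel \<mu>] by (simp cong: measurable_cong_sets)
  have "Measurable.pred (lborel \<Otimes>\<^sub>M \<mu>) (\<lambda>p. Q (fst (act (unimodular (fst p)) (snd p), snd p)) (snd (act (unimodular (fst p)) (snd p), snd p)))"
    by (rule measurable_compose[OF measurable_Pair[OF m1 m2] Q])
  then have [measurable]: "Measurable.pred (lborel \<Otimes>\<^sub>M \<mu>) (\<lambda>p. Q (act (unimodular (fst p)) (snd p)) (snd p))"
    by simp
  have "{p \<in> space (lborel \<Otimes>\<^sub>M \<mu>). det (fst p) > 0 \<longrightarrow> Q (act (unimodular (fst p)) (snd p)) (snd p)}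
      \<in> sets (lborel \<Otimes>\<^sub>M \<mu>)"
    by measurable
  from AE_commute[OF this] show ?thesis .
qed

text \<open>Otherwise there are typical lattices \<open>x\<close> in \<open>B\<close> and
  \<open>y\<close> outside, generated by \<open>X\<close> and \<open>Y\<close>. For almost every
  \<open>h\<close> of positive determinant the lattice of \<open>h ** X\<close> lies in
  \<open>B\<close> and that of \<open>h ** Y\<close> does not. Right translation by \<open>X\<close>
  and by \<open>Y\<close> turns both into statements about the lattice of one and the same
  \<open>h\<close>, and these contradict each other.\<close>

lemma SL_invariant_null_or_conull:
  assumes B [measurable]: "B \<in> sets \<mu>"
    and inv: "\<And>A. A \<in> SL_real \<Longrightarrow> AE x in \<mu>. act A x \<in> B \<longleftrightarrow> x \<in> B"
  shows "emeasure \<mu> B = 0 \<or> emeasure \<mu> (space \<mu> - B) = 0"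
proof (rule ccontr)
  assume "\<not> ?thesis"
  then have nz: "emeasure \<mu> B \<noteq> 0" "emeasure \<mu> (space \<mu> - B) \<noteq> 0" by auto
  have Bl [measurable]: "B \<in> sets lattice_borel" using B by simp
  have "AE x in \<mu>. AE h in lborel. det h > 0 \<longrightarrow> (act (unimodular h) x \<in> B \<longleftrightarrow> x \<in> B)"
    by (subst AE_unimodular_commute[where Q = "\<lambda>y x. y \<in> B \<longleftrightarrow> x \<in> B", symmetric])
       (use inv[OF unimodular_SL] in auto)
  then have good: "AE x in \<mu>. x \<in> lattice_space \<and>
      (AE h in lborel. det h > 0 \<longrightarrow> (act (unimodular h) x \<in> B \<longleftrightarrow> x \<in> B))"
    using AE_space by eventually_elim auto
  have ex: "\<exists>x\<in>C. x \<in> lattice_space \<and>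
      (AE h in lborel. det h > 0 \<longrightarrow> (act (unimodular h) x \<in> B \<longleftrightarrow> x \<in> B))"
    if C: "C \<in> sets \<mu>" "emeasure \<mu> C \<noteq> 0" for C
  proof (rule ccontr)
    assume "\<not> ?thesis"
    then have "AE x in \<mu>. x \<notin> C" using good by (auto elim: eventually_mono)
    then have "C \<in> null_sets \<mu>" by (simp only: AE_iff_null_sets[OF C(1)])
    then show False using C(2) by blast
  qed
  obtain x where x: "x \<in> B" "x \<in> lattice_space"
    "AE h in lborel. det h > 0 \<longrightarrow> (act (unimodular h) x \<in> B \<longleftrightarrow> x \<in> B)"
    using ex[OF B nz(1)] by blast
  obtain y where y: "y \<notin> B" "y \<in> lattice_space"
    "AE h in lborel. det h > 0 \<longrightarrow> (act (unimodular h) y \<in> B \<longleftrightarrow> y \<in> B)"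
    using ex[OF sets.compl_sets[OF B] nz(2)] by auto
  obtain X where X: "X \<in> SL_real" "x = lattice_of X" using x(2) by (auto simp: lattice_space_def)
  obtain Y where Y: "Y \<in> SL_real" "y = lattice_of Y" using y(2) by (auto simp: lattice_space_def)
  have shift: "lattice_of (unimodular (h ** A)) = act (unimodular h) (lattice_of A)"
    if "A \<in> SL_real" "det h > 0" for h A :: "real^'n^'n"
    using unimodular_mult_SL[OF that(1), of h] that(2) by (auto simp: act_lattice_of)
  have dt: "det (h ** A) = det h" if "A \<in> SL_real" for h A :: "real^'n^'n"
    using that by (simp add: det_mul SL_real_def)
  have "AE h in lborel. det h > 0 \<longrightarrow> lattice_of (unimodular h) \<in> B"
  proof (rule AE_lborel_mult_right[OF X(1)])
    show "AE h in lborel. det (h ** X) > 0 \<longrightarrow> lattice_of (unimodular (h ** X)) \<in> B"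
      using x(3)
    proof eventually_elim
      case (elim h)
      show ?case
      proof
        assume "det (h ** X) > 0"
        then have h: "det h > 0" by (simp add: dt[OF X(1)])
        then have "act (unimodular h) x \<in> B" using elim x(1) by simp
        then show "lattice_of (unimodular (h ** X)) \<in> B" using shift[OF X(1) h] X(2) by simp
      qed
    qed
  qed
  moreover have "AE h in lborel. det h > 0 \<longrightarrow> lattice_of (unimodular h) \<notin> B"
  proof (rule AE_lborel_mult_right[OF Y(1)])
    show "AE h in lborel. det (h ** Y) > 0 \<longrightarrow> lattice_of (unimodular (h ** Y)) \<notin> B"
      using y(3)
    proof eventually_elim
      case (elim h)
      show ?case
      proof
        assume "det (h ** Y) > 0"
        then have h: "det h > 0" by (simp add: dt[OF Y(1)])
        then have "act (unimodular h) y \<notin> B" using elim y(1) by simp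
        then show "lattice_of (unimodular (h ** Y)) \<notin> B" using shift[OF Y(1) h] Y(2) by simp
      qed
    qed
  qed
  ultimately have "AE h in lborel. \<not> det (h :: real^'n^'n) > 0"
    by eventually_elim auto
  then show False using not_AE_det_nonpos by blast
qed

end

section \<open>The diagonal flow and its ergodicity\<close>

lemma flow_matrix_diag:
  "(flow_matrix t :: real^('d::finite + 'c::finite)^('d + 'c))
    = diag (case_sum (\<lambda>_. exp (real CARD('c) * t)) (\<lambda>_. exp (- real CARD('d) * t)))"
  unfolding flow_matrix_def diag_def
  by (intro arg_cong[of _ _ vec_lambda] ext) (auto split: sum.splits)

lemma flow_matrix_0: "flow_matrix 0 = mat 1"
  unfolding flow_matrix_diag diag_1[symmetric] by (intro arg_cong[of _ _ diag]) (auto split: sum.splits)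

lemma flow_matrix_add: "flow_matrix s ** flow_matrix t = flow_matrix (s + t)"
  unfolding flow_matrix_diag diag_mult
  by (intro arg_cong[of _ _ diag]) (auto simp: exp_add[symmetric] algebra_simps split: sum.splits)

lemma flow_matrix_SL: "(flow_matrix t :: real^('d::finite + 'c::finite)^('d + 'c)) \<in> SL_real"
proof -
  let ?f = "case_sum (\<lambda>_ :: 'd. exp (real CARD('c) * t)) (\<lambda>_ :: 'c. exp (- real CARD('d) * t))"
  have "det (flow_matrix t :: real^('d + 'c)^('d + 'c)) = prod ?f UNIV"
    unfolding flow_matrix_diag by (rule det_diag)
  also have "\<dots> = prod ?f (Inl ` UNIV \<union> Inr ` UNIV)" by (simp only: UNIV_sum)
  also have "\<dots> = prod ?f (Inl ` UNIV) * prod ?f (Inr ` UNIV)"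
    by (rule prod.union_disjoint) auto
  also have "\<dots> = (\<Prod>i\<in>(UNIV::'d set). exp (real CARD('c) * t)) * (\<Prod>i\<in>(UNIV::'c set). exp (- real CARD('d) * t))"
    by (simp add: prod.reindex)
  also have "\<dots> = exp (real CARD('d) * (real CARD('c) * t)) * exp (real CARD('c) * (- real CARD('d) * t))"
    by (simp only: prod_constant exp_of_nat_mult)
  also have "\<dots> = 1" by (simp add: exp_add[symmetric] algebra_simps)
  finally show ?thesis by (simp add: SL_real_def)
qed

lemma flow_0: "flow 0 L = L"
  by (simp add: flow_def flow_matrix_0 act_one)

lemma flow_flow: "flow s (flow t L) = flow (s + t) L"
  by (simp add: flow_def act_mult flow_matrix_add)

lemma flow_lattice_space: "L \<in> lattice_space \<Longrightarrow> flow t L \<in> lattice_space"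
  unfolding flow_def by (rule act_lattice_space[OF flow_matrix_SL])

lemma flow_matrix_nth: "(flow_matrix t *v X) $ i
    = (case i of Inl _ \<Rightarrow> exp (real CARD('c) * t) | Inr _ \<Rightarrow> exp (- real CARD('d) * t)) * X $ i"
  for X :: "real^('d::finite + 'c::finite)"
proof -
  let ?a = "\<lambda>i :: 'd + 'c. case i of Inl _ \<Rightarrow> exp (real CARD('c) * t) | Inr _ \<Rightarrow> exp (- real CARD('d) * t)"
  have "(flow_matrix t *v X) $ i = (\<Sum>k\<in>UNIV. if k = i then ?a i * X $ k else 0)"
    unfolding matrix_vector_mult_def flow_matrix_def
    by (simp add: if_distrib[of "\<lambda>x. x * _"] cong: if_cong)
  then show ?thesis by simp
qed

lemma norm_plus_flow: "norm_plus (flow_matrix t *v X) = exp (real CARD('c) * t) * norm_plus X"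
  for X :: "real^('d::finite + 'c::finite)"
proof -
  have "u_part (flow_matrix t *v X) = exp (real CARD('c) * t) *\<^sub>R u_part X"
    by (simp add: u_part_def vec_eq_iff flow_matrix_nth)
  then show ?thesis by (simp add: norm_plus_def)
qed

lemma norm_minus_flow: "norm_minus (flow_matrix t *v X) = exp (- real CARD('d) * t) * norm_minus X"
  for X :: "real^('d::finite + 'c::finite)"
proof -
  have "h_part (flow_matrix t *v X) = exp (- real CARD('d) * t) *\<^sub>R h_part X"
    by (simp add: h_part_def vec_eq_iff flow_matrix_nth)
  then show ?thesis by (simp add: norm_minus_def)
qed

lemma norm_plus_scaleR: "norm_plus (a *\<^sub>R X) = \<bar>a\<bar> * norm_plus X"
proof -
  have "u_part (a *\<^sub>R X) = a *\<^sub>R u_part X" by (simp add: u_part_def vec_eq_iff)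
  then show ?thesis by (simp add: norm_plus_def)
qed

lemma norm_minus_scaleR: "norm_minus (a *\<^sub>R X) = \<bar>a\<bar> * norm_minus X"
proof -
  have "h_part (a *\<^sub>R X) = a *\<^sub>R h_part X" by (simp add: h_part_def vec_eq_iff)
  then show ?thesis by (simp add: norm_minus_def)
qed

lemma norm_plus_sq: "(norm_plus X)\<^sup>2 = (\<Sum>i\<in>range Inl. (X $ i)\<^sup>2)"
  by (simp add: norm_plus_def u_part_def norm_vec_def L2_set_def sum_nonneg sum.reindex)

lemma norm_minus_sq: "(norm_minus X)\<^sup>2 = (\<Sum>i\<in>range Inr. (X $ i)\<^sup>2)"
  by (simp add: norm_minus_def h_part_def norm_vec_def L2_set_def sum_nonneg sum.reindex)

lemma norm_plus_nonneg [simp]: "norm_plus X \<ge> 0" and norm_minus_nonneg [simp]: "norm_minus X \<ge> 0"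
  by (simp_all add: norm_plus_def norm_minus_def)

text \<open>Conjugation by \<open>flow_matrix t\<close> multiplies the entry of an off-block
  transvection by an exponential with rate \<open>d + c\<close>, of opposite sign for the two
  blocks. One block is therefore contracted to the identity as \<open>t\<close> grows, the other as
  \<open>t\<close> decreases.\<close>

lemma transv_conj_flow:
  fixes i :: "'d::finite" and j :: "'c::finite"
  shows "transv (Inl i) (Inr j) a ** flow_matrix t
      = flow_matrix t ** transv (Inl i) (Inr j) (a * exp (- real (CARD('d) + CARD('c)) * t))"
    and "transv (Inr j) (Inl i) a ** flow_matrix t
      = flow_matrix t ** transv (Inr j) (Inl i) (a * exp (real (CARD('d) + CARD('c)) * t))"
proof -
  have e1: "exp (- (real CARD('d) * t)) = exp (real CARD('c) * t) * exp (- real (CARD('d) + CARD('c)) * t)"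
    by (simp add: exp_add[symmetric] algebra_simps)
  have e2: "exp (real CARD('c) * t) = exp (- (real CARD('d) * t)) * exp (real (CARD('d) + CARD('c)) * t)"
    by (simp add: exp_add[symmetric] algebra_simps)
  show "transv (Inl i) (Inr j) a ** flow_matrix t
      = flow_matrix t ** transv (Inl i) (Inr j) (a * exp (- real (CARD('d) + CARD('c)) * t))"
    unfolding flow_matrix_diag using e1
    by (auto simp: vec_eq_iff diag_mult_nth mult_diag_nth transv_nth)
  show "transv (Inr j) (Inl i) a ** flow_matrix t
      = flow_matrix t ** transv (Inr j) (Inl i) (a * exp (real (CARD('d) + CARD('c)) * t))"
    unfolding flow_matrix_diag using e2
    by (auto simp: vec_eq_iff diag_mult_nth mult_diag_nth transv_nth)
qed

lemma transv_tendsto_mat_1: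
  fixes m n :: "'n::finite"
  assumes "m \<noteq> n" "c \<longlonglongrightarrow> 0"
  shows "(\<lambda>k. transv m n (c k)) \<longlonglongrightarrow> mat 1"
proof (rule vec_tendstoI, rule vec_tendstoI)
  fix i j
  show "(\<lambda>k. transv m n (c k) $ i $ j) \<longlonglongrightarrow> mat 1 $ i $ j"
    using assms by (cases "i = m \<and> j = n") (auto simp: transv_nth mat_1_nth)
qed

lemma transv_SL: "m \<noteq> n \<Longrightarrow> transv m n c \<in> SL_real"
  by (simp add: SL_real_def det_transv)

locale lattice_flow = lattice_measure \<mu> for \<mu> :: "(real^('d::finite + 'c::finite)) set measure"
begin

lemma measurable_flow [measurable]: "flow t \<in> measurable \<mu> \<mu>"
  unfolding flow_def[abs_def] by (rule measurable_act_mu[OF flow_matrix_SL])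

lemma distr_flow: "distr \<mu> \<mu> (flow t) = \<mu>"
  unfolding flow_def[abs_def] by (rule distr_act[OF flow_matrix_SL])

text \<open>Invariance under the time-one map gives invariance at all integer times of either sign,
  and Mautner's argument needs no more: it is run along \<open>t = k\<close> for one off-block and
  along \<open>t = - k\<close> for the other. The transvections so obtained generate
  \<open>SL_real\<close>.\<close>

lemma flow_ergodic:
  assumes B: "B \<in> sets \<mu>" and inv: "flow 1 -` B \<inter> space \<mu> = B"
  shows "emeasure \<mu> B = 0 \<or> emeasure \<mu> (space \<mu> - B) = 0"
proof -
  have inv1: "flow 1 x \<in> B \<longleftrightarrow> x \<in> B" if "x \<in> lattice_space" for x
    using inv that by auto
  have invp: "flow (real k) x \<in> B \<longleftrightarrow> x \<in> B" if "x \<in> lattice_space" for x and k :: nat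
  proof (induction k)
    case 0 show ?case by (simp add: flow_0)
  next
    case (Suc k)
    have "flow (real (Suc k)) x = flow 1 (flow (real k) x)" by (simp add: flow_flow)
    then show ?case using inv1[OF flow_lattice_space[OF that]] Suc by simp
  qed
  have invn: "flow (- real k) x \<in> B \<longleftrightarrow> x \<in> B" if "x \<in> lattice_space" for x and k :: nat
    using invp[OF flow_lattice_space[OF that, of "- real k"], of k] by (simp add: flow_flow flow_0)
  let ?n = "real (CARD('d) + CARD('c))"
  have lim: "(\<lambda>k. a * exp (- ?n * real k)) \<longlonglongrightarrow> 0" for a
  proof -
    have "filterlim (\<lambda>k. ?n * real k) at_top sequentially"
      by (intro filterlim_tendsto_pos_mult_at_top[OF tendsto_const] filterlim_real_sequentially) (simp add: add_pos_pos)
    then have "(\<lambda>k. exp (- (?n * real k))) \<longlonglongrightarrow> 0"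
      by (intro filterlim_compose[OF exp_at_bot] filterlim_compose[OF filterlim_uminus_at_bot_at_top])
    from tendsto_mult_left[OF this, of a] show ?thesis by (simp only: mult_minus_left mult_zero_right)
  qed
  have up: "AE x in \<mu>. act (transv (Inl i) (Inr j) a) x \<in> B \<longleftrightarrow> x \<in> B" for i :: 'd and j :: 'c and a
    by (rule mautner[OF B, where P = "\<lambda>k. flow_matrix (real k)"
          and w = "\<lambda>k. transv (Inl i) (Inr j) (a * exp (- ?n * real k))"])
       (simp_all only: flow_matrix_SL transv_SL transv_conj_flow invp[unfolded flow_def] transv_tendsto_mat_1 lim sum.distinct not_False_eq_True)
  have dn: "AE x in \<mu>. act (transv (Inr j) (Inl i) a) x \<in> B \<longleftrightarrow> x \<in> B" for i :: 'd and j :: 'c and a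
    by (rule mautner[OF B, where P = "\<lambda>k. flow_matrix (- real k)"
          and w = "\<lambda>k. transv (Inr j) (Inl i) (a * exp (?n * (- real k)))"])
       (simp_all only: flow_matrix_SL transv_SL transv_conj_flow invn[unfolded flow_def] transv_tendsto_mat_1
          lim mult_minus_left mult_minus_right sum.distinct not_False_eq_True lim[unfolded mult_minus_left])
  have "AE x in \<mu>. act A x \<in> B \<longleftrightarrow> x \<in> B" if "A \<in> SL_real" for A
  proof (rule SL_real_induct_blocks[OF that, where P = "\<lambda>A. AE x in \<mu>. act A x \<in> B \<longleftrightarrow> x \<in> B"])
    fix A A' :: "real^('d + 'c)^('d + 'c)"
    assume A': "A' \<in> SL_real" "AE x in \<mu>. act A x \<in> B \<longleftrightarrow> x \<in> B" "AE x in \<mu>. act A' x \<in> B \<longleftrightarrow> x \<in> B"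
    show "AE x in \<mu>. act (A ** A') x \<in> B \<longleftrightarrow> x \<in> B"
      using AE_act[OF A'(1,2)] A'(3) by eventually_elim (simp add: act_mult)
  qed (simp_all add: act_one up dn)
  then show ?thesis by (rule SL_invariant_null_or_conull[OF B])
qed

end

section \<open>Measurable enumeration of lattice vectors; nullity of the exceptional set\<close>

lemma countable_int_vectors: "countable {z :: real^'n::finite. \<forall>i. z $ i \<in> \<int>}"
proof -
  have "{z :: real^'n. \<forall>i. z $ i \<in> \<int>} \<subseteq> range (\<lambda>f :: 'n \<Rightarrow> int. \<chi> i. of_int (f i))"
  proof
    fix z :: "real^'n" assume "z \<in> {z. \<forall>i. z $ i \<in> \<int>}"
    then have "z = (\<chi> i. of_int \<lfloor>z $ i\<rfloor>)" by (simp add: vec_eq_iff)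
    then show "z \<in> range (\<lambda>f :: 'n \<Rightarrow> int. \<chi> i. of_int (f i))"
      by (rule image_eqI[where x = "\<lambda>i. \<lfloor>z $ i\<rfloor>"]) simp
  qed
  moreover have "countable (range (\<lambda>f :: 'n \<Rightarrow> int. \<chi> i. real_of_int (f i)))" by simp
  ultimately show ?thesis by (rule countable_subset)
qed

definition int_vec :: "nat \<Rightarrow> real^'n::finite" where
  "int_vec = from_nat_into {z. \<forall>i. z $ i \<in> \<int>}"

lemma range_int_vec: "range int_vec = {z :: real^'n::finite. \<forall>i. z $ i \<in> \<int>}"
  unfolding int_vec_def
  by (rule range_from_nat_into[OF _ countable_int_vectors]) (auto intro!: exI[of _ 0])

lemma lattice_of_eq_range: "lattice_of A = range (\<lambda>k. A *v int_vec k)"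
proof -
  have "lattice_of A = (\<lambda>z. A *v z) ` range int_vec"
    unfolding range_int_vec lattice_of_def by (rule image_Collect[symmetric])
  then show ?thesis by (simp add: image_image)
qed

lemma countable_lattice: "L \<in> lattice_space \<Longrightarrow> countable L"
  by (auto simp: lattice_space_def lattice_of_eq_range)

text \<open>For fixed \<open>k\<close> this is a Borel function of the lattice, and for fixed
  \<open>L\<close> it runs through all points of \<open>L\<close>.\<close>

definition lattice_vec :: "(real^'n::finite) set \<Rightarrow> nat \<Rightarrow> real^'n" where
  "lattice_vec L k = basis_of L *v int_vec k"

lemma lattice_eq_range: "L \<in> lattice_space \<Longrightarrow> L = range (lattice_vec L)"
  using lattice_of_basis_of[of L] by (simp add: lattice_of_eq_range lattice_vec_def[abs_def])

lemma bex_lattice: "L \<in> lattice_space \<Longrightarrow> (\<exists>v\<in>L. P v) \<longleftrightarrow> (\<exists>k. P (lattice_vec L k))"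
  using lattice_eq_range[of L] by (metis rangeE rangeI)

lemma ball_lattice: "L \<in> lattice_space \<Longrightarrow> (\<forall>v\<in>L. P v) \<longleftrightarrow> (\<forall>k. P (lattice_vec L k))"
  using bex_lattice[of L "\<lambda>v. \<not> P v"] by blast

lemma measurable_lattice_vec [measurable]: "(\<lambda>L. lattice_vec L k) \<in> borel_measurable lattice_borel"
  unfolding lattice_vec_def by measurable

lemma zero_in_lattice: "L \<in> lattice_space \<Longrightarrow> 0 \<in> L"
  unfolding lattice_space_def lattice_of_def by (force intro!: exI[of _ 0])

lemma diff_in_lattice:
  assumes "L \<in> lattice_space" "v \<in> L" "w \<in> L"
  shows "v - w \<in> L"
proof -
  obtain A where A: "L = lattice_of A" using assms(1) by (auto simp: lattice_space_def)
  obtain z z' where z: "v = A *v z" "\<forall>i. z $ i \<in> \<int>" "w = A *v z'" "\<forall>i. z' $ i \<in> \<int>"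
    using assms(2,3) unfolding A lattice_of_def by blast
  have "v - w = A *v (z - z')" by (simp add: z matrix_vector_mult_diff_distrib)
  moreover have "\<forall>i. (z - z') $ i \<in> \<int>" using z by simp
  ultimately show ?thesis unfolding A lattice_of_def by blast
qed

lemma uminus_in_lattice: "L \<in> lattice_space \<Longrightarrow> v \<in> L \<Longrightarrow> - v \<in> L"
  using diff_in_lattice[OF _ zero_in_lattice, of L v] by simp

lemma continuous_on_norm_plus: "continuous_on T (norm_plus :: real^('d::finite + 'c::finite) \<Rightarrow> real)"
  unfolding norm_plus_def u_part_def by (intro continuous_intros)

lemma continuous_on_norm_minus: "continuous_on T (norm_minus :: real^('d::finite + 'c::finite) \<Rightarrow> real)"
  unfolding norm_minus_def h_part_def by (intro continuous_intros)

lemma measurable_norm_plus [measurable]: "norm_plus \<in> borel_measurable borel"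
  and measurable_norm_minus [measurable]: "norm_minus \<in> borel_measurable borel"
  by (simp_all add: borel_measurable_continuous_onI continuous_on_norm_plus continuous_on_norm_minus)

lemma norm_plus_eq_0: "norm_plus X = 0 \<longleftrightarrow> u_part X = 0"
  and norm_minus_eq_0: "norm_minus X = 0 \<longleftrightarrow> h_part X = 0"
  by (simp_all add: norm_plus_def norm_minus_def)

lemma exceptional_sets [measurable]: "exceptional \<in> sets lattice_borel"
proof -
  have "exceptional = {L \<in> space lattice_borel.
     (\<exists>k1 k2. norm (lattice_vec L k1 - lattice_vec L k2) \<noteq> 0 \<and> norm (lattice_vec L k1 + lattice_vec L k2) \<noteq> 0 \<and>
        (norm_plus (lattice_vec L k1) = norm_plus (lattice_vec L k2) \<and> norm_plus (lattice_vec L k2) > 0 \<or>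
         norm_minus (lattice_vec L k1) = norm_minus (lattice_vec L k2) \<and> norm_minus (lattice_vec L k2) > 0)) \<or>
     (\<exists>k. norm (lattice_vec L k) \<noteq> 0 \<and> (norm_minus (lattice_vec L k) = 0 \<or> norm_plus (lattice_vec L k) = 0))}"
    unfolding exceptional_def space_lattice_borel
    by (intro Collect_cong conj_cong refl)
       (simp add: bex_lattice norm_plus_eq_0 norm_minus_eq_0 eq_neg_iff_add_eq_0)
  also have "\<dots> \<in> sets lattice_borel" by measurable
  finally show ?thesis .
qed

lemma continuous_on_matrix_vector_left: "continuous_on T (\<lambda>h :: real^'n::finite^'m::finite. h *v v)"
  unfolding matrix_vector_mult_def by (intro continuous_on_vec_lambda continuous_intros)

text \<open>Adding \<open>s\<close> times a matrix \<open>E\<close> that has \<open>e\<close> in row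
  \<open>i0\<close> and zeros elsewhere makes the difference of the two sides a polynomial in
  \<open>s\<close> with leading coefficient
  \<open>\<alpha> = (e \<bullet> a) * (e \<bullet> b)\<close>. For suitable \<open>e\<close> this is
  nonzero, so each line in direction \<open>E\<close> meets the set in finitely many points.\<close>

lemma quadratic_equality_null:
  fixes v w :: "real^'n::finite"
  assumes I: "i0 \<in> I" and vw: "v \<noteq> w" "v \<noteq> - w"
  shows "emeasure lborel {h :: real^'n^'n. (\<Sum>i\<in>I. ((h *v v) $ i)\<^sup>2) = (\<Sum>i\<in>I. ((h *v w) $ i)\<^sup>2)} = 0"
proof -
  define a where "a = v - w"
  define b where "b = v + w"
  have ab: "a \<noteq> 0" "b \<noteq> 0" using vw by (simp_all add: a_def b_def eq_neg_iff_add_eq_0)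
  \<comment> \<open>If \<open>a\<close> and \<open>b\<close> are orthogonal, \<open>a + b\<close>
    has inner products \<open>a \<bullet> a\<close> and \<open>b \<bullet> b\<close> with them;
    otherwise \<open>a\<close> itself works.\<close>
  define e where "e = (if a \<bullet> b = 0 then a + b else a)"
  have e: "(e \<bullet> a) * (e \<bullet> b) \<noteq> 0"
    using ab by (auto simp: e_def inner_add_left inner_commute[of b a])
  define \<alpha> where "\<alpha> = (e \<bullet> v)\<^sup>2 - (e \<bullet> w)\<^sup>2"
  have alpha: "\<alpha> \<noteq> 0"
    using e unfolding \<alpha>_def a_def b_def by (simp add: inner_diff_right inner_add_right power2_eq_square algebra_simps)
  define E where "E = (\<chi> i. if i = i0 then e else 0)"
  have Ev: "(E *v x) $ i = (if i = i0 then e \<bullet> x else 0)" for x i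
    by (simp add: E_def matrix_vector_mult_def inner_vec_def)
  have sq: "(\<Sum>i\<in>I. (((h + s *\<^sub>R E) *v x) $ i)\<^sup>2)
      = (\<Sum>i\<in>I. ((h *v x) $ i)\<^sup>2) + s * (2 * ((h *v x) $ i0) * (e \<bullet> x)) + s\<^sup>2 * (e \<bullet> x)\<^sup>2"
    for h :: "real^'n^'n" and s x
  proof -
    have "(\<Sum>i\<in>I. (((h + s *\<^sub>R E) *v x) $ i)\<^sup>2)
        = (\<Sum>i\<in>I. ((h *v x) $ i)\<^sup>2
            + (if i = i0 then s * (2 * ((h *v x) $ i0) * (e \<bullet> x)) + s\<^sup>2 * (e \<bullet> x)\<^sup>2 else 0))"
      by (rule sum.cong)
         (auto simp: matrix_vector_mult_add_rdistrib scaleR_matrix_vector_assoc[symmetric] Ev power2_eq_square algebra_simps)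
    also have "\<dots> = (\<Sum>i\<in>I. ((h *v x) $ i)\<^sup>2) + (s * (2 * ((h *v x) $ i0) * (e \<bullet> x)) + s\<^sup>2 * (e \<bullet> x)\<^sup>2)"
      using I by (simp add: sum.distrib)
    finally show ?thesis by simp
  qed
  show ?thesis
  proof (rule null_set_lborel_if_lines_countable[where e = E])
    show "{h :: real^'n^'n. (\<Sum>i\<in>I. ((h *v v) $ i)\<^sup>2) = (\<Sum>i\<in>I. ((h *v w) $ i)\<^sup>2)} \<in> sets borel"
      by (intro borel_closed closed_Collect_eq continuous_intros continuous_on_matrix_vector_left)
    fix h :: "real^'n^'n"
    define p where "p = [:(\<Sum>i\<in>I. ((h *v v) $ i)\<^sup>2) - (\<Sum>i\<in>I. ((h *v w) $ i)\<^sup>2),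
       2 * ((h *v v) $ i0) * (e \<bullet> v) - 2 * ((h *v w) $ i0) * (e \<bullet> w), \<alpha>:]"
    have "p \<noteq> 0" using alpha by (simp add: p_def)
    have "{s. h + s *\<^sub>R E \<in> {h. (\<Sum>i\<in>I. ((h *v v) $ i)\<^sup>2) = (\<Sum>i\<in>I. ((h *v w) $ i)\<^sup>2)}} \<subseteq> {s. poly p s = 0}"
    proof
      fix s assume "s \<in> {s. h + s *\<^sub>R E \<in> {h. (\<Sum>i\<in>I. ((h *v v) $ i)\<^sup>2) = (\<Sum>i\<in>I. ((h *v w) $ i)\<^sup>2)}}"
      then have "(\<Sum>i\<in>I. ((h *v v) $ i)\<^sup>2) + s * (2 * ((h *v v) $ i0) * (e \<bullet> v)) + s\<^sup>2 * (e \<bullet> v)\<^sup>2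
          = (\<Sum>i\<in>I. ((h *v w) $ i)\<^sup>2) + s * (2 * ((h *v w) $ i0) * (e \<bullet> w)) + s\<^sup>2 * (e \<bullet> w)\<^sup>2"
        by (simp only: mem_Collect_eq sq)
      then show "s \<in> {s. poly p s = 0}" by (simp add: p_def \<alpha>_def power2_eq_square algebra_simps)
    qed
    moreover have "finite {s. poly p s = 0}" using \<open>p \<noteq> 0\<close> by (rule poly_roots_finite)
    ultimately show "countable {s. h + s *\<^sub>R E \<in> {h. (\<Sum>i\<in>I. ((h *v v) $ i)\<^sup>2) = (\<Sum>i\<in>I. ((h *v w) $ i)\<^sup>2)}}"
      using finite_subset countable_finite by blast
  qed
qed

context lattice_flow
begin

text \<open>For each lattice, almost every \<open>h\<close> moves it off \<open>exceptional\<close>,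
  since only countably many pairs of vectors have to be avoided. By Fubini some single
  \<open>h\<close> moves almost every lattice off \<open>exceptional\<close>, and invariance of
  \<open>\<mu>\<close> under that \<open>h\<close> gives the claim.\<close>

lemma exceptional_null: "emeasure \<mu> exceptional = 0"
proof -
  have *: "AE h in lborel. det h > 0 \<longrightarrow> act (unimodular h) x \<notin> exceptional"
    if x: "x \<in> lattice_space" for x :: "(real^('d + 'c)) set"
  proof -
    define Z where "Z I v w = {h :: real^('d + 'c)^('d + 'c). (\<Sum>i\<in>I. ((h *v v) $ i)\<^sup>2) = (\<Sum>i\<in>I. ((h *v w) $ i)\<^sup>2)}" for I v w
    have Zm: "Z I v w \<in> sets lborel" for I v w
      unfolding Z_def sets_lborel
      by (intro borel_closed closed_Collect_eq continuous_intros continuous_on_matrix_vector_left)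
    have Z0: "AE h in lborel. v \<noteq> w \<and> v \<noteq> - w \<longrightarrow> h \<notin> Z (range Inl) v w \<and> h \<notin> Z (range Inr) v w"
      for v w :: "real^('d + 'c)"
    proof (cases "v \<noteq> w \<and> v \<noteq> - w")
      case True
      have "Z (range Inl) v w \<in> null_sets lborel" "Z (range Inr) v w \<in> null_sets lborel"
        using True quadratic_equality_null[of "Inl undefined" "range Inl" v w]
          quadratic_equality_null[of "Inr undefined" "range Inr" v w] Zm
        by (auto simp: null_sets_def Z_def)
      from this[THEN AE_not_in] show ?thesis by eventually_elim auto
    next
      case False
      then show ?thesis by (intro AE_I2) blast
    qed
    have "AE h in lborel. \<forall>v\<in>x. \<forall>w\<in>x. v \<noteq> w \<and> v \<noteq> - w \<longrightarrow> h \<notin> Z (range Inl) v w \<and> h \<notin> Z (range Inr) v w"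
      using Z0 countable_lattice[OF x] by (simp add: AE_ball_countable)
    then show ?thesis
    proof eventually_elim
      case (elim h)
      show ?case
      proof (intro impI notI)
        assume h: "det h > 0" and ex: "act (unimodular h) x \<in> exceptional"
        define s where "s = det h powr (- 1 / real CARD('d + 'c))"
        have s: "s > 0" using h by (simp add: s_def)
        have uh: "unimodular h *v v = s *\<^sub>R (h *v v)" for v
          using h by (simp add: unimodular_def s_def scaleR_matrix_vector_assoc)
        have np: "norm_plus (h *v v) \<noteq> norm_plus (h *v w)" "norm_minus (h *v v) \<noteq> norm_minus (h *v w)"
          if "v \<in> x" "w \<in> x" "v \<noteq> w" "v \<noteq> - w" for v w
        proof -
          have "h \<notin> Z (range Inl) v w" "h \<notin> Z (range Inr) v w" using elim that by blast+
          then have "(norm_plus (h *v v))\<^sup>2 \<noteq> (norm_plus (h *v w))\<^sup>2" "(norm_minus (h *v v))\<^sup>2 \<noteq> (norm_minus (h *v w))\<^sup>2"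
            by (simp_all add: Z_def norm_plus_sq norm_minus_sq)
          then show "norm_plus (h *v v) \<noteq> norm_plus (h *v w)" "norm_minus (h *v v) \<noteq> norm_minus (h *v w)"
            by metis+
        qed
        from ex consider
          (pair) w1 w2 where "w1 \<in> act (unimodular h) x" "w2 \<in> act (unimodular h) x" "w1 \<noteq> w2" "w1 \<noteq> - w2"
            "norm_plus w1 = norm_plus w2 \<or> norm_minus w1 = norm_minus w2"
          | (axis) w where "w \<in> act (unimodular h) x" "w \<noteq> 0" "h_part w = 0 \<or> u_part w = 0"
          unfolding exceptional_def by blast
        then show False
        proof cases
          case pair
          obtain v1 v2 where v: "v1 \<in> x" "w1 = unimodular h *v v1" "v2 \<in> x" "w2 = unimodular h *v v2"
            using pair(1,2) unfolding act_def by blast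
          have "v1 \<noteq> v2" using pair(3) v by blast
          moreover have "v1 \<noteq> - v2"
          proof
            assume "v1 = - v2"
            then have "w1 = - w2" using v by (simp add: uh linear_neg)
            then show False using pair(4) by simp
          qed
          ultimately have "norm_plus (h *v v1) \<noteq> norm_plus (h *v v2)" "norm_minus (h *v v1) \<noteq> norm_minus (h *v v2)"
            using np v by blast+
          then show False using pair(5) s by (simp add: v uh norm_plus_scaleR norm_minus_scaleR)
        next
          case axis
          obtain v where v: "v \<in> x" "w = unimodular h *v v" using axis(1) unfolding act_def by blast
          then have v0: "v \<noteq> 0" using axis(2) by auto
          \<comment> \<open>A vector in one of the two coordinate subspaces is the case where its
            companion in the pair is the lattice vector \<open>0\<close>.\<close>
          have "norm_plus (h *v v) \<noteq> norm_plus (h *v 0)" "norm_minus (h *v v) \<noteq> norm_minus (h *v 0)"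
            using np[OF v(1) zero_in_lattice[OF x]] v0 by simp_all
          moreover have "norm_plus (0 :: real^('d + 'c)) = 0" "norm_minus (0 :: real^('d + 'c)) = 0"
            using norm_plus_scaleR[of 0 0] norm_minus_scaleR[of 0 0] by simp_all
          ultimately have "norm_plus (h *v v) \<noteq> 0" "norm_minus (h *v v) \<noteq> 0" by simp_all
          then have "norm_plus w \<noteq> 0" "norm_minus w \<noteq> 0"
            using s by (simp_all add: v uh norm_plus_scaleR norm_minus_scaleR)
          then show False using axis(3) by (simp add: norm_plus_eq_0 norm_minus_eq_0)
        qed
      qed
    qed
  qed
  have "AE h in lborel. AE x in \<mu>. det h > 0 \<longrightarrow> act (unimodular h) x \<notin> exceptional"
    by (subst AE_unimodular_commute[where Q = "\<lambda>y x. y \<notin> exceptional"])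
       (measurable, rule AE_I2, simp add: *)
  then obtain h :: "real^('d + 'c)^('d + 'c)" where h: "det h > 0"
    "AE x in \<mu>. det h > 0 \<longrightarrow> act (unimodular h) x \<notin> exceptional"
    using not_AE_det_nonpos by (metis (mono_tags, lifting) eventually_mono)
  have "AE x in \<mu>. act (unimodular h) x \<notin> exceptional" using h by simp
  then have "AE x in distr \<mu> \<mu> (act (unimodular h)). x \<notin> exceptional"
    using sets.compl_sets[OF exceptional_sets]
    by (subst AE_distr_iff[OF measurable_act_mu[OF unimodular_SL]]) (simp_all add: set_diff_eq)
  then have "AE x in \<mu>. x \<notin> exceptional" unfolding distr_act[OF unimodular_SL] .
  then have "exceptional \<in> null_sets \<mu>" by (subst AE_iff_null_sets) auto
  then show ?thesis by blast
qed

end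

section \<open>Minimal vectors of generic lattices\<close>

lemma norm_sq_split: "(norm X)\<^sup>2 = (norm_plus X)\<^sup>2 + (norm_minus X)\<^sup>2"
  for X :: "real^('d::finite + 'c::finite)"
proof -
  have "(norm X)\<^sup>2 = (\<Sum>i\<in>UNIV. (X $ i)\<^sup>2)"
    by (simp add: norm_vec_def L2_set_def sum_nonneg)
  also have "(UNIV :: ('d + 'c) set) = range Inl \<union> range Inr" by (rule UNIV_sum)
  also have "(\<Sum>i\<in>range Inl \<union> range Inr. (X $ i)\<^sup>2) = (norm_plus X)\<^sup>2 + (norm_minus X)\<^sup>2"
    unfolding norm_plus_sq norm_minus_sq by (rule sum.union_disjoint) auto
  finally show ?thesis .
qed

lemma norm_le_plus_minus: "norm X \<le> norm_plus X + norm_minus X"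
  for X :: "real^('d::finite + 'c::finite)"
proof (rule power2_le_imp_le)
  show "(norm X)\<^sup>2 \<le> (norm_plus X + norm_minus X)\<^sup>2"
    unfolding norm_sq_split by (simp add: power2_sum)
qed simp

lemma norm_plus_le_norm: "norm_plus X \<le> norm X" and norm_minus_le_norm: "norm_minus X \<le> norm X"
  for X :: "real^('d::finite + 'c::finite)"
  by (rule power2_le_imp_le; simp add: norm_sq_split)+

lemma norm_plus_minus_uminus [simp]: "norm_plus (- X) = norm_plus X" "norm_minus (- X) = norm_minus X"
  using norm_plus_scaleR[of "-1" X] norm_minus_scaleR[of "-1" X] by simp_all

lemma norm_plus_0 [simp]: "norm_plus 0 = 0" and norm_minus_0 [simp]: "norm_minus 0 = 0"
  using norm_plus_scaleR[of 0 0] norm_minus_scaleR[of 0 0] by simp_all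

lemma norm_plus_le_sum: "norm_plus X \<le> (\<Sum>i\<in>UNIV. \<bar>X $ Inl i\<bar>)"
  unfolding norm_plus_def using norm_le_l1_cart[of "u_part X"] by (simp add: u_part_def)

lemma norm_minus_le_sum: "norm_minus X \<le> (\<Sum>i\<in>UNIV. \<bar>X $ Inr i\<bar>)"
  unfolding norm_minus_def using norm_le_l1_cart[of "h_part X"] by (simp add: h_part_def)

lemma nth_le_norm_plus: "\<bar>X $ Inl i\<bar> \<le> norm_plus X" and nth_le_norm_minus: "\<bar>X $ Inr j\<bar> \<le> norm_minus X"
  using component_le_norm_cart[of "u_part X" i] component_le_norm_cart[of "h_part X" j]
  by (simp_all add: norm_plus_def norm_minus_def u_part_def h_part_def)

lemma finite_lattice_cball:
  fixes L :: "(real^'n::finite) set"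
  assumes "L \<in> lattice_space"
  shows "finite {v \<in> L. norm v \<le> R}"
proof -
  obtain A where A: "A \<in> SL_real" "L = lattice_of A" using assms by (auto simp: lattice_space_def)
  have inj: "inj ((*v) A)"
    using A by (intro inj_matrix_vector_mult) (simp add: SL_real_def invertible_det_nz)
  obtain c where c: "c > 0" "\<And>v. c * norm v \<le> norm (A *v v)"
    by (rule linear_inj_bounded_below_pos[OF matrix_vector_mul_linear inj]) blast
  define N where "N = \<lceil>R / c\<rceil>"
  define F where "F = (\<lambda>f :: 'n \<Rightarrow> int. A *v (\<chi> i. of_int (f i))) ` (PiE UNIV (\<lambda>_. {-N..N}))"
  have "finite F" unfolding F_def by (intro finite_imageI finite_PiE) auto
  moreover have "{v \<in> L. norm v \<le> R} \<subseteq> F"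
  proof
    fix v assume "v \<in> {v \<in> L. norm v \<le> R}"
    then obtain z where z: "v = A *v z" "\<forall>i. z $ i \<in> \<int>" and R: "norm v \<le> R"
      unfolding A lattice_of_def by blast
    have zi: "z $ i = of_int \<lfloor>z $ i\<rfloor>" for i using z(2) by simp
    have "norm z \<le> R / c" using c(2)[of z] c(1) R z(1) by (simp add: field_simps)
    then have zN: "\<bar>z $ i\<bar> \<le> of_int N" for i
      using component_le_norm_cart[of z i] le_of_int_ceiling[of "R / c"] unfolding N_def by linarith
    have "- of_int N \<le> z $ i" "z $ i < of_int N + 1" for i using zN[of i] by linarith+
    then have "\<lfloor>z $ i\<rfloor> \<in> {-N..N}" for i by (simp add: le_floor_iff floor_le_iff)
    moreover have "z = (\<chi> i. of_int \<lfloor>z $ i\<rfloor>)" unfolding vec_eq_iff vec_lambda_beta using zi by blast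
    then have "v = A *v (\<chi> i. of_int \<lfloor>z $ i\<rfloor>)" unfolding z(1) by (rule arg_cong)
    ultimately show "v \<in> F" unfolding F_def by (intro image_eqI[of _ _ "\<lambda>i. \<lfloor>z $ i\<rfloor>"]) auto
  qed
  ultimately show ?thesis using finite_subset by blast
qed

lemma lattice_near:
  fixes L :: "(real^'n::finite) set"
  assumes "L \<in> lattice_space"
  obtains C where "C > 0" "\<And>y. \<exists>v\<in>L. norm (v - y) \<le> C"
proof -
  obtain A where A: "A \<in> SL_real" "L = lattice_of A" using assms by (auto simp: lattice_space_def)
  obtain B where B: "A ** B = mat 1" using SL_real_inverse[OF A(1)] by blast
  define C where "C = onorm ((*v) A) * real CARD('n) + 1"
  have on: "onorm ((*v) A) \<ge> 0" by (rule onorm_pos_le) simp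
  show thesis
  proof
    show "C > 0" using on by (simp add: C_def add_nonneg_pos)
    fix y
    define z :: "real^'n" where "z = (\<chi> i. of_int \<lfloor>(B *v y) $ i\<rfloor>)"
    have "norm (z - B *v y) \<le> (\<Sum>i\<in>UNIV. \<bar>(z - B *v y) $ i\<bar>)" by (rule norm_le_l1_cart)
    also have "\<dots> \<le> (\<Sum>i\<in>(UNIV::'n set). 1)"
      by (rule sum_mono) (simp add: z_def abs_le_iff, linarith)
    finally have nz: "norm (z - B *v y) \<le> real CARD('n)" by simp
    have "A *v z - y = A *v (z - B *v y)"
      using B by (simp add: matrix_vector_mult_diff_distrib matrix_vector_mul_assoc)
    then have "norm (A *v z - y) \<le> onorm ((*v) A) * norm (z - B *v y)"
      using onorm[of "(*v) A" "z - B *v y"] by simp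
    also have "\<dots> \<le> onorm ((*v) A) * real CARD('n)" by (rule mult_left_mono[OF nz on])
    finally have "norm (A *v z - y) \<le> C" by (simp add: C_def)
    moreover have "A *v z \<in> L" unfolding A lattice_of_def by (auto simp: z_def)
    ultimately show "\<exists>v\<in>L. norm (v - y) \<le> C" by blast
  qed
qed

text \<open>Lattice points close to the multiples of a vector \<open>e\<close> killed by the projection \<open>f\<close> have bounded
  images under \<open>f\<close>, so two of these images are close.\<close>

lemma lattice_small_projection:
  fixes L :: "(real^'n::finite) set" and f :: "real^'n \<Rightarrow> 'b::euclidean_space"
  assumes L: "L \<in> lattice_space" and f: "linear f" "\<And>v. norm (f v) \<le> norm v"
    and e: "f e = 0" "norm e = 1" and eps: "\<epsilon> > 0"
  shows "\<exists>v\<in>L. v \<noteq> 0 \<and> norm (f v) < \<epsilon>"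
proof -
  obtain C where C: "C > 0" "\<And>y. \<exists>v\<in>L. norm (v - y) \<le> C" using lattice_near[OF L] by blast
  have "\<exists>v\<in>L. norm (v - (3 * C * real k) *\<^sub>R e) \<le> C" for k by (rule C(2))
  then obtain v where v: "\<And>k. v k \<in> L" "\<And>k. norm (v k - (3 * C * real k) *\<^sub>R e) \<le> C" by metis
  have "norm (f (v k)) \<le> C" for k
  proof -
    have "f (v k) = f (v k - (3 * C * real k) *\<^sub>R e)"
      using e(1) by (simp add: linear_diff[OF f(1)] linear_scale[OF f(1)])
    then show ?thesis using f(2)[of "v k - (3 * C * real k) *\<^sub>R e"] v(2)[of k] by simp
  qed
  then have "bounded (range (\<lambda>k. f (v k)))" by (auto simp: bounded_iff)
  then obtain l r where r: "strict_mono (r :: nat \<Rightarrow> nat)" "((\<lambda>k. f (v k)) \<circ> r) \<longlonglongrightarrow> l"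
    using bounded_imp_convergent_subsequence by blast
  have "Cauchy ((\<lambda>k. f (v k)) \<circ> r)" using r(2) by (rule LIMSEQ_imp_Cauchy)
  then obtain M where M: "\<And>m n. m \<ge> M \<Longrightarrow> n \<ge> M \<Longrightarrow> norm (f (v (r m)) - f (v (r n))) < \<epsilon>"
    using CauchyD[OF _ eps] by (metis comp_apply)
  let ?i = "r (Suc M)" and ?j = "r M"
  have ij: "?j < ?i" using r(1) by (simp add: strict_mono_Suc_iff)
  have "v ?i - v ?j \<noteq> 0"
  proof
    assume "v ?i - v ?j = 0"
    then have eq: "v ?i = v ?j" by simp
    have "norm ((3 * C * real ?i) *\<^sub>R e - (3 * C * real ?j) *\<^sub>R e) \<le> 2 * C"
      using v(2)[of ?i] v(2)[of ?j] norm_triangle_ineq4[of "v ?j - (3 * C * real ?j) *\<^sub>R e" "v ?i - (3 * C * real ?i) *\<^sub>R e"]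
      by (simp add: eq)
    moreover have "(3 * C * real ?i) *\<^sub>R e - (3 * C * real ?j) *\<^sub>R e = (3 * C * (real ?i - real ?j)) *\<^sub>R e"
      by (simp add: algebra_simps)
    moreover have "norm ((3 * C * (real ?i - real ?j)) *\<^sub>R e) \<ge> 3 * C * 1"
      using C(1) ij e(2) by (auto simp: abs_mult)
    ultimately show False using C(1) by simp
  qed
  moreover have "norm (f (v ?i - v ?j)) < \<epsilon>" using M[of "Suc M" M] by (simp add: linear_diff[OF f(1)])
  ultimately show ?thesis using diff_in_lattice[OF L v(1) v(1)] by blast
qed

lemma linear_u_part: "linear u_part" and linear_h_part: "linear h_part"
  by (rule linearI; simp add: u_part_def h_part_def vec_eq_iff)+

lemma ex_small_norm_plus:
  fixes L :: "(real^('d::finite + 'c::finite)) set"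
  assumes "L \<in> lattice_space" "\<epsilon> > 0"
  shows "\<exists>v\<in>L. v \<noteq> 0 \<and> norm_plus v < \<epsilon>"
  unfolding norm_plus_def
proof (rule lattice_small_projection[OF assms(1) linear_u_part _ _ _ assms(2), where e = "axis (Inr undefined) 1"])
  show "norm (u_part v) \<le> norm v" for v :: "real^('d + 'c)"
    using norm_plus_le_norm[of v] by (simp add: norm_plus_def)
qed (simp_all add: u_part_def axis_def vec_eq_iff norm_axis_1[unfolded axis_def])

lemma ex_small_norm_minus:
  fixes L :: "(real^('d::finite + 'c::finite)) set"
  assumes "L \<in> lattice_space" "\<epsilon> > 0"
  shows "\<exists>v\<in>L. v \<noteq> 0 \<and> norm_minus v < \<epsilon>"
  unfolding norm_minus_def
proof (rule lattice_small_projection[OF assms(1) linear_h_part _ _ _ assms(2), where e = "axis (Inl undefined) 1"])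
  show "norm (h_part v) \<le> norm v" for v :: "real^('d + 'c)"
    using norm_minus_le_norm[of v] by (simp add: norm_minus_def)
qed (simp_all add: h_part_def axis_def vec_eq_iff norm_axis_1[unfolded axis_def])

text \<open>The floors of the coordinates sort the points into unit cells, and a coordinate bounded
  by \<open>M\<close> has at most \<open>2 * M + 1\<close> possible floors.\<close>

lemma pigeonhole_cells:
  fixes f :: "'a \<Rightarrow> 'm::finite \<Rightarrow> real"
  assumes P: "card P > (2 * M + 1) ^ CARD('m)" and b: "\<And>p i. p \<in> P \<Longrightarrow> \<bar>f p i\<bar> \<le> real M"
  obtains p p' where "p \<in> P" "p' \<in> P" "p \<noteq> p'" "\<And>i. \<bar>f p i - f p' i\<bar> < 1"
proof -
  define g where "g p = (\<lambda>i. \<lfloor>f p i\<rfloor>)" for p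
  let ?T = "PiE UNIV (\<lambda>_ :: 'm. {- int M..int M})"
  have finT: "finite ?T" by (intro finite_PiE) auto
  have "card ?T = (\<Prod>i\<in>(UNIV :: 'm set). card {- int M..int M})" by (rule card_PiE) simp
  moreover have "card {- int M..int M} = 2 * M + 1" by simp
  ultimately have cardT: "card ?T = (2 * M + 1) ^ CARD('m)" by (simp only: prod_constant)
  have sub: "g ` P \<subseteq> ?T"
  proof
    fix y assume "y \<in> g ` P"
    then obtain p where p: "p \<in> P" "y = g p" by blast
    have "- int M \<le> \<lfloor>f p i\<rfloor> \<and> \<lfloor>f p i\<rfloor> \<le> int M" for i
    proof -
      have "- real M \<le> f p i" "f p i < real M + 1" using b[OF p(1), of i] by linarith+
      then show ?thesis by (simp add: le_floor_iff floor_le_iff)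
    qed
    then show "y \<in> ?T" by (auto simp: p(2) g_def)
  qed
  have "\<not> inj_on g P"
  proof
    assume "inj_on g P"
    then have "card P \<le> card ?T" using card_inj_on_le[OF _ sub finT] by blast
    then show False using P cardT by simp
  qed
  then obtain p p' where p: "p \<in> P" "p' \<in> P" "p \<noteq> p'" "g p = g p'" unfolding inj_on_def by blast
  have "\<bar>f p i - f p' i\<bar> < 1" for i
  proof -
    have "\<lfloor>f p i\<rfloor> = \<lfloor>f p' i\<rfloor>" using p(4) unfolding g_def by metis
    then show ?thesis by linarith
  qed
  then show thesis using that p by blast
qed

section \<open>Minimal vectors of one fixed lattice outside the exceptional set\<close>

locale generic_lattice =
  fixes L :: "(real^('d::finite + 'c::finite)) set"
  assumes lat: "L \<in> lattice_space" and generic: "L \<notin> exceptional"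
begin

lemma norm_plus_pos: "v \<in> L \<Longrightarrow> v \<noteq> 0 \<Longrightarrow> norm_plus v > 0"
  and norm_minus_pos: "v \<in> L \<Longrightarrow> v \<noteq> 0 \<Longrightarrow> norm_minus v > 0"
  using lat generic norm_plus_nonneg[of v] norm_minus_nonneg[of v]
  unfolding exceptional_def norm_plus_eq_0[symmetric] norm_minus_eq_0[symmetric] less_le by auto

lemma norm_plus_inj: "v \<in> L \<Longrightarrow> w \<in> L \<Longrightarrow> v \<noteq> 0 \<Longrightarrow> norm_plus w = norm_plus v \<Longrightarrow> w = v \<or> w = - v"
  and norm_minus_inj: "v \<in> L \<Longrightarrow> w \<in> L \<Longrightarrow> v \<noteq> 0 \<Longrightarrow> norm_minus w = norm_minus v \<Longrightarrow> w = v \<or> w = - v"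
  using lat generic norm_plus_pos[of v] norm_minus_pos[of v] unfolding exceptional_def by blast+

lemma finite_box: "finite {v \<in> L. norm_plus v \<le> a \<and> norm_minus v \<le> b}"
proof (rule finite_subset[OF _ finite_lattice_cball[OF lat, of "a + b"]])
  show "{v \<in> L. norm_plus v \<le> a \<and> norm_minus v \<le> b} \<subseteq> {v \<in> L. norm v \<le> a + b}"
  proof clarify
    fix v assume "norm_plus v \<le> a" "norm_minus v \<le> b"
    then show "norm v \<le> a + b" using norm_le_plus_minus[of v] by linarith
  qed
qed

lemma minimal_vectorD:
  assumes "minimal_vector L X"
  shows "X \<in> L" "X \<noteq> 0" "norm_plus X > 0" "norm_minus X > 0"
    and "\<And>Y. Y \<in> L \<Longrightarrow> Y \<noteq> 0 \<Longrightarrow> norm_plus Y \<le> norm_plus X \<Longrightarrow> norm_minus Y \<le> norm_minus X \<Longrightarrow>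
      norm_plus Y = norm_plus X \<and> norm_minus Y = norm_minus X"
  using assms norm_plus_pos norm_minus_pos unfolding minimal_vector_def cylinder_def by blast+

text \<open>The box below \<open>Y\<close> contains finitely many lattice points, and one with least
  \<open>norm_plus\<close> is minimal: by genericity its only competitor with the same
  \<open>norm_plus\<close> is its negative, which has the same \<open>norm_minus\<close>.\<close>

lemma ex_minimal_vector_below:
  assumes Y: "Y \<in> L" "Y \<noteq> 0"
  obtains Z where "minimal_vector L Z" "norm_plus Z \<le> norm_plus Y" "norm_minus Z \<le> norm_minus Y"
proof -
  define F where "F = {v \<in> L. norm_plus v \<le> norm_plus Y \<and> norm_minus v \<le> norm_minus Y} - {0}"
  have F: "finite F" "F \<noteq> {}" unfolding F_def using finite_box Y by auto
  obtain Z where Z: "Z \<in> F" "\<And>v. v \<in> F \<Longrightarrow> norm_plus Z \<le> norm_plus v"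
  proof -
    have "Min (norm_plus ` F) \<in> norm_plus ` F" using F by (intro Min_in) auto
    then obtain Z where "Z \<in> F" "norm_plus Z = Min (norm_plus ` F)" by force
    then show thesis using that F(1) by simp
  qed
  have "minimal_vector L Z"
    unfolding minimal_vector_def
  proof (intro conjI ballI impI)
    show "Z \<in> L" "Z \<noteq> 0" using Z(1) by (simp_all add: F_def)
    fix W assume W: "W \<in> L \<inter> cylinder Z" "W \<noteq> 0"
    then have WL: "W \<in> L" "norm_plus W \<le> norm_plus Z" "norm_minus W \<le> norm_minus Z" by (auto simp: cylinder_def)
    have "W \<in> F" using WL W(2) Z(1) unfolding F_def by auto
    then show p: "norm_plus W = norm_plus Z" using Z(2) WL(2) by force
    have "W = Z \<or> W = - Z" by (rule norm_plus_inj[OF \<open>Z \<in> L\<close> WL(1) \<open>Z \<noteq> 0\<close> p])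
    then show "norm_minus W = norm_minus Z" by auto
  qed
  then show thesis using that Z(1) unfolding F_def by blast
qed

lemma minimal_vector_plus_le:
  assumes X: "minimal_vector L X" and Y: "Y \<in> L" "Y \<noteq> 0" "norm_minus Y < norm_minus X"
  shows "norm_plus X < norm_plus Y"
proof (rule ccontr)
  assume "\<not> norm_plus X < norm_plus Y"
  then have "norm_minus Y = norm_minus X" using minimal_vectorD(5)[OF X Y(1,2)] Y(3) by simp
  then show False using Y(3) by simp
qed

text \<open>These are the hypotheses of \<open>enumerate_int\<close>, stated for logarithms so that
  the values spread over the whole line. A lattice vector with \<open>norm_minus\<close> below
  \<open>exp a\<close> bounds \<open>norm_plus\<close> of all minimal vectors beyond it, which gives
  finiteness; arbitrarily small \<open>norm_plus\<close> and \<open>norm_minus\<close> give the two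
  unbounded directions.\<close>

lemma ln_minimal_values:
  defines "Q \<equiv> (\<lambda>X. ln (norm_minus X)) ` {X. minimal_vector L X}"
  shows "finite (Q \<inter> {a..b})" "\<exists>x\<in>Q. x > b" "\<exists>x\<in>Q. x < b"
proof -
  show "finite (Q \<inter> {a..b})"
  proof -
    obtain Y where Y: "Y \<in> L" "Y \<noteq> 0" "norm_minus Y < exp a"
      using ex_small_norm_minus[OF lat, of "exp a"] by auto
    have "Q \<inter> {a..b} \<subseteq> (\<lambda>X. ln (norm_minus X)) ` {v \<in> L. norm_plus v \<le> norm_plus Y \<and> norm_minus v \<le> exp b}"
    proof
      fix x assume "x \<in> Q \<inter> {a..b}"
      then obtain X where X: "minimal_vector L X" "x = ln (norm_minus X)" "a \<le> x" "x \<le> b"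
        unfolding Q_def by auto
      have e: "norm_minus X = exp x" using X(2) minimal_vectorD(4)[OF X(1)] by simp
      have "norm_plus X < norm_plus Y"
        by (rule minimal_vector_plus_le[OF X(1) Y(1,2)]) (use Y(3) X(3) e in \<open>simp add: less_le_trans[of _ "exp a"]\<close>)
      then show "x \<in> (\<lambda>X. ln (norm_minus X)) ` {v \<in> L. norm_plus v \<le> norm_plus Y \<and> norm_minus v \<le> exp b}"
        using X e minimal_vectorD(1)[OF X(1)] by (intro image_eqI[of _ _ X]) auto
    qed
    then show ?thesis using finite_box finite_subset by blast
  qed
  show "\<exists>x\<in>Q. x > b"
  proof -
    define F where "F = {v \<in> L. norm_plus v \<le> 1 \<and> norm_minus v \<le> exp b} - {0}"
    have F: "finite F" unfolding F_def using finite_box by auto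
    \<comment> \<open>A vector with \<open>norm_plus\<close> below this threshold lies outside the
      finite set \<open>F\<close>; having \<open>norm_plus\<close> at most \<open>1\<close>, it must
      then have \<open>norm_minus\<close> above \<open>exp b\<close>.\<close>
    define \<epsilon> where "\<epsilon> = Min (insert 1 (norm_plus ` F))"
    have "\<epsilon> > 0" unfolding \<epsilon>_def using F norm_plus_pos by (subst Min_gr_iff) (auto simp: F_def)
    then obtain Y where Y: "Y \<in> L" "Y \<noteq> 0" "norm_plus Y < \<epsilon>"
      using ex_small_norm_plus[OF lat] by blast
    obtain Z where Z: "minimal_vector L Z" "norm_plus Z \<le> norm_plus Y" "norm_minus Z \<le> norm_minus Y"
      using ex_minimal_vector_below[OF Y(1,2)] .
    have "Z \<notin> F"
    proof
      assume "Z \<in> F"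
      then have "\<epsilon> \<le> norm_plus Z" unfolding \<epsilon>_def using F by (intro Min_le) auto
      then show False using Z(2) Y(3) by simp
    qed
    moreover have "norm_plus Z \<le> 1"
    proof -
      have "\<epsilon> \<le> 1" unfolding \<epsilon>_def using F by (intro Min_le) auto
      then show ?thesis using Z(2) Y(3) by simp
    qed
    ultimately have "norm_minus Z > exp b" using minimal_vectorD(1,2)[OF Z(1)] unfolding F_def by auto
    then have "ln (norm_minus Z) > b" using minimal_vectorD(4)[OF Z(1)] by (metis exp_less_cancel_iff exp_ln)
    then show ?thesis using Z(1) unfolding Q_def by blast
  qed
  show "\<exists>x\<in>Q. x < b"
  proof -
    obtain Y where Y: "Y \<in> L" "Y \<noteq> 0" "norm_minus Y < exp b"
      using ex_small_norm_minus[OF lat, of "exp b"] by auto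
    obtain Z where Z: "minimal_vector L Z" "norm_plus Z \<le> norm_plus Y" "norm_minus Z \<le> norm_minus Y"
      using ex_minimal_vector_below[OF Y(1,2)] .
    have "norm_minus Z < exp b" using Z(3) Y(3) by simp
    then have "ln (norm_minus Z) < b" using minimal_vectorD(4)[OF Z(1)] by (metis exp_less_cancel_iff exp_ln)
    then show ?thesis using Z(1) unfolding Q_def by blast
  qed
qed

end

text \<open>The unique time \<open>t\<close> at which \<open>flow_matrix t\<close> makes
  \<open>norm_plus\<close> of the image of \<open>X n\<close> equal to \<open>norm_minus\<close> of
  the image of \<open>X (n + 1)\<close>, provided these seminorms are positive.\<close>

definition hit :: "(int \<Rightarrow> real^('d::finite + 'c::finite)) \<Rightarrow> int \<Rightarrow> real" where
  "hit X n = (ln (norm_minus (X (n + 1))) - ln (norm_plus (X n))) / real (CARD('d) + CARD('c))"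

lemma dim_pos: "real (CARD('d::finite) + CARD('c::finite)) > 0"
  by (simp add: add_pos_pos)

context generic_lattice
begin

lemma minimal_vector_eq:
  assumes "minimal_vector L X" "minimal_vector L Y" "norm_minus X = norm_minus Y"
  shows "norm_plus X = norm_plus Y"
  using norm_minus_inj[of Y X] minimal_vectorD(1,2)[OF assms(1)] minimal_vectorD(1,2)[OF assms(2)] assms(3) by auto

text \<open>This is \<open>minimal_sequence\<close> without the choice of the origin, with classes
  compared by \<open>norm_minus\<close>, which determines the class of a minimal vector for a
  generic lattice. In this form the notion is stable under shifts of the index and under the
  flow.\<close>

definition enum :: "(int \<Rightarrow> real^('d + 'c)) \<Rightarrow> bool" where
  "enum X \<longleftrightarrow> (\<forall>n. minimal_vector L (X n)) \<and> (\<forall>Y. minimal_vector L Y \<longrightarrow> (\<exists>n. norm_minus Y = norm_minus (X n))) \<and>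
     strict_mono (\<lambda>n. norm_minus (X n))"

lemma enumD:
  assumes "enum X"
  shows "minimal_vector L (X n)" "minimal_vector L Y \<Longrightarrow> \<exists>n. norm_minus Y = norm_minus (X n)"
    "strict_mono (\<lambda>n. norm_minus (X n))"
  using assms unfolding enum_def by blast+

lemma enum_shift: "enum X \<Longrightarrow> enum (\<lambda>n. X (n + k))"
  unfolding enum_def
proof (intro conjI allI impI)
  assume X: "(\<forall>n. minimal_vector L (X n)) \<and> (\<forall>Y. minimal_vector L Y \<longrightarrow> (\<exists>n. norm_minus Y = norm_minus (X n))) \<and>
     strict_mono (\<lambda>n. norm_minus (X n))"
  show "minimal_vector L (X (n + k))" for n using X by blast
  show "\<exists>n. norm_minus Y = norm_minus (X (n + k))" if Y: "minimal_vector L Y" for Y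
  proof -
    obtain n where "norm_minus Y = norm_minus (X n)" using X Y by blast
    then show ?thesis by (intro exI[of _ "n - k"]) simp
  qed
  show "strict_mono (\<lambda>n. norm_minus (X (n + k)))"
    using X by (simp add: strict_mono_def)
qed

lemma ex_enum: "\<exists>X. enum X"
proof -
  let ?Q = "(\<lambda>X. ln (norm_minus X)) ` {X. minimal_vector L X}"
  obtain f :: "int \<Rightarrow> real" where f: "strict_mono f" "range f = ?Q"
    using enumerate_int[of ?Q, OF ln_minimal_values] by blast
  have "\<exists>Y. minimal_vector L Y \<and> ln (norm_minus Y) = f n" for n
  proof -
    have "f n \<in> ?Q" using f(2) by blast
    then show ?thesis by auto
  qed
  then obtain X where X: "\<And>n. minimal_vector L (X n)" "\<And>n. ln (norm_minus (X n)) = f n" by metis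
  have e: "norm_minus (X n) = exp (f n)" for n
    using X(2)[of n] minimal_vectorD(4)[OF X(1)] by (metis exp_ln)
  have "enum X" unfolding enum_def
  proof (intro conjI allI impI)
    show "minimal_vector L (X n)" for n by (rule X(1))
    show "strict_mono (\<lambda>n. norm_minus (X n))" using f(1) by (simp add: e strict_mono_def)
    show "\<exists>n. norm_minus Y = norm_minus (X n)" if Y: "minimal_vector L Y" for Y
    proof -
      have "ln (norm_minus Y) \<in> range f" using Y f(2) by blast
      then obtain n where "ln (norm_minus Y) = f n" by blast
      then have "norm_minus Y = norm_minus (X n)" using minimal_vectorD(4)[OF Y] e by (metis exp_ln)
      then show ?thesis by blast
    qed
  qed
  then show ?thesis by blast
qed

lemma enum_minus_less: "enum X \<Longrightarrow> norm_minus (X m) < norm_minus (X n) \<longleftrightarrow> m < n"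
  using strict_mono_less[OF enumD(3)] .

lemma enum_plus_less:
  assumes X: "enum X" and "m < n"
  shows "norm_plus (X n) < norm_plus (X m)"
  using minimal_vector_plus_le[OF enumD(1)[OF X, of n] minimal_vectorD(1,2)[OF enumD(1)[OF X, of m]]]
    enum_minus_less[OF X, of m n] assms(2) by blast

lemma enum_pos: "enum X \<Longrightarrow> norm_plus (X n) > 0" "enum X \<Longrightarrow> norm_minus (X n) > 0"
  using minimal_vectorD(3,4)[OF enumD(1)] by blast+

lemma hit_strict_mono:
  assumes X: "enum X"
  shows "strict_mono (hit X)"
proof (rule strict_mono_int_Suc)
  fix n
  have "ln (norm_minus (X (n + 1))) < ln (norm_minus (X (n + 1 + 1)))"
    using enum_pos[OF X] enum_minus_less[OF X, of "n + 1" "n + 1 + 1"] by simp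
  moreover have "ln (norm_plus (X (n + 1))) < ln (norm_plus (X n))"
    using enum_pos[OF X] enum_plus_less[OF X, of n "n + 1"] by simp
  ultimately show "hit X n < hit X (n + 1)"
    unfolding hit_def by (intro divide_strict_right_mono dim_pos) simp
qed

lemma enum_ln_finite:
  assumes X: "enum X"
  shows "finite (range (\<lambda>n. ln (norm_minus (X n))) \<inter> {a..b})"
  by (rule finite_subset[OF _ ln_minimal_values(1)[of a b]]) (use enumD(1)[OF X] in auto)

lemma enum_ln_strict_mono: "enum X \<Longrightarrow> strict_mono (\<lambda>n. ln (norm_minus (X n)))"
  using enum_minus_less[of X] enum_pos[of X] by (auto intro!: strict_monoI)

lemma hit_unbounded:
  assumes X: "enum X"
  shows "\<exists>n. hit X n > b" "\<exists>n. hit X n < b"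
proof -
  let ?D = "real (CARD('d) + CARD('c))"
  note unb = strict_mono_int_unbounded[OF enum_ln_strict_mono[OF X] enum_ln_finite[OF X]]
  have mon: "m \<le> n \<Longrightarrow> ln (norm_minus (X m)) \<le> ln (norm_minus (X n))" for m n
    using strict_mono_less_eq[OF enum_ln_strict_mono[OF X], of m n] by simp
  have anti: "m \<le> n \<Longrightarrow> ln (norm_plus (X n)) \<le> ln (norm_plus (X m))" for m n
    using enum_plus_less[OF X, of m n] enum_pos(1)[OF X] by (cases "m = n") auto
  show "\<exists>n. hit X n > b"
  proof -
    obtain n where n: "ln (norm_minus (X n)) > b * ?D + ln (norm_plus (X 0))" using unb(1) by blast
    define m where "m = max 0 n"
    have "ln (norm_minus (X (m + 1))) > b * ?D + ln (norm_plus (X 0))"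
    proof -
      have "n \<le> m + 1" by (simp add: m_def)
      from mon[OF this] n show ?thesis by linarith
    qed
    moreover have "ln (norm_plus (X m)) \<le> ln (norm_plus (X 0))" by (rule anti) (simp add: m_def)
    ultimately have "b * ?D < ln (norm_minus (X (m + 1))) - ln (norm_plus (X m))" by linarith
    then have "hit X m > b" unfolding hit_def using dim_pos by (subst pos_less_divide_eq) auto
    then show ?thesis by blast
  qed
  show "\<exists>n. hit X n < b"
  proof -
    obtain n where n: "ln (norm_minus (X n)) < b * ?D + ln (norm_plus (X 0))" using unb(2) by blast
    define m where "m = min 0 (n - 1)"
    have "ln (norm_minus (X (m + 1))) < b * ?D + ln (norm_plus (X 0))"
    proof -
      have "m + 1 \<le> n" by (simp add: m_def)
      from mon[OF this] n show ?thesis by linarith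
    qed
    moreover have "ln (norm_plus (X 0)) \<le> ln (norm_plus (X m))" by (rule anti) (simp add: m_def)
    ultimately have "ln (norm_minus (X (m + 1))) - ln (norm_plus (X m)) < b * ?D" by linarith
    then have "hit X m < b" unfolding hit_def using dim_pos by (subst pos_divide_less_eq) auto
    then show ?thesis by blast
  qed
qed

lemma hit_ge_0_iff: "enum X \<Longrightarrow> hit X n \<ge> 0 \<longleftrightarrow> norm_minus (X (n + 1)) \<ge> norm_plus (X n)"
  using enum_pos[of X] dim_pos unfolding hit_def
  by (subst pos_le_divide_eq) auto

text \<open>The inequality that singles out the origin says that the hitting time is nonnegative. As
  hitting times increase with the index, the condition on all negative \<open>n\<close> reduces to
  \<open>n = - 1\<close>, and index \<open>0\<close> marks the first nonnegative hitting
  time.\<close>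

lemma minimal_sequence_iff:
  "minimal_sequence L X \<longleftrightarrow> enum X \<and> hit X 0 \<ge> 0 \<and> hit X (- 1) < 0"
proof -
  have eqc: "cylinder Y = cylinder (X n) \<longleftrightarrow> norm_minus Y = norm_minus (X n)"
    if "minimal_vector L Y" "minimal_vector L (X n)" for Y n
  proof
    assume c: "cylinder Y = cylinder (X n)"
    have "Y \<in> cylinder (X n)" unfolding c[symmetric] by (simp add: cylinder_def)
    moreover have "X n \<in> cylinder Y" unfolding c by (simp add: cylinder_def)
    ultimately show "norm_minus Y = norm_minus (X n)" by (simp add: cylinder_def)
  next
    assume "norm_minus Y = norm_minus (X n)"
    then show "cylinder Y = cylinder (X n)" using minimal_vector_eq[OF that] by (simp add: cylinder_def)
  qed
  have "minimal_sequence L X \<longleftrightarrow> enum X \<and> norm_minus (X 1) \<ge> norm_plus (X 0) \<and>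
     (\<forall>n<0. \<not> norm_minus (X (n + 1)) \<ge> norm_plus (X n))"
    unfolding minimal_sequence_def enum_def using eqc by blast
  also have "\<dots> \<longleftrightarrow> enum X \<and> hit X 0 \<ge> 0 \<and> (\<forall>n<0. \<not> hit X n \<ge> 0)"
    using hit_ge_0_iff[of X] by (metis add_0)
  also have "\<dots> \<longleftrightarrow> enum X \<and> hit X 0 \<ge> 0 \<and> hit X (- 1) < 0"
  proof (intro conj_cong refl iffI)
    assume a: "\<forall>n<0. \<not> hit X n \<ge> 0"
    have "\<not> hit X (- 1) \<ge> 0" using a[rule_format, of "- 1"] by simp
    then show "hit X (- 1) < 0" by simp
  next
    assume X: "enum X" and h: "hit X (- 1) < 0"
    show "\<forall>n<0. \<not> hit X n \<ge> 0"
    proof (intro allI impI)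
      fix n :: int assume "n < 0"
      then have "hit X n \<le> hit X (- 1)" using strict_mono_less_eq[OF hit_strict_mono[OF X], of n "- 1"] by simp
      then show "\<not> hit X n \<ge> 0" using h by simp
    qed
  qed
  finally show ?thesis .
qed

lemma hit_shift: "hit (\<lambda>n. X (n + k)) n = hit X (n + k)"
  unfolding hit_def by (simp add: ac_simps)

lemma ex_minimal_sequence: "\<exists>X. minimal_sequence L X"
proof -
  obtain X where X: "enum X" using ex_enum by blast
  obtain n where n: "hit X (n - 1) < 0" "0 \<le> hit X n"
  proof (rule strict_mono_int_switch[OF hit_strict_mono[OF X], of 0])
    show "\<exists>n. 0 \<le> hit X n" using hit_unbounded(1)[OF X, of 0] by (auto intro: less_imp_le)
    show "\<exists>n. hit X n < 0" by (rule hit_unbounded(2)[OF X])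
  qed
  have "minimal_sequence L (\<lambda>k. X (k + n))"
    unfolding minimal_sequence_iff hit_shift using enum_shift[OF X] n by simp
  then show ?thesis by blast
qed

lemma minimal_sequence_min_vec: "minimal_sequence L (min_vec L)"
  unfolding min_vec_def by (rule someI_ex[OF ex_minimal_sequence])

text \<open>Two enumerations differ by a shift \<open>k\<close>, and the signs of the hitting times
  with indices \<open>-1\<close> and \<open>0\<close> force \<open>k = 0\<close>. Hence
  \<open>q\<close> and the hitting times do not depend on the representatives picked by
  \<open>min_vec\<close>.\<close>

lemma minimal_sequence_unique:
  assumes X: "minimal_sequence L X" and Y: "minimal_sequence L Y"
  shows "norm_minus (X n) = norm_minus (Y n)" "norm_plus (X n) = norm_plus (Y n)"
proof -
  have eX: "enum X" and eY: "enum Y" and hX: "hit X 0 \<ge> 0" "hit X (-1) < 0" and hY: "hit Y 0 \<ge> 0" "hit Y (-1) < 0"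
    using X Y unfolding minimal_sequence_iff by blast+
  have rr: "range (\<lambda>n. norm_minus (Z n)) = norm_minus ` {X. minimal_vector L X}" if "enum Z" for Z
  proof (intro set_eqI iffI)
    fix x assume "x \<in> range (\<lambda>n. norm_minus (Z n))"
    then show "x \<in> norm_minus ` {X. minimal_vector L X}" using enumD(1)[OF that] by blast
  next
    fix x assume "x \<in> norm_minus ` {X. minimal_vector L X}"
    then obtain W where "minimal_vector L W" "x = norm_minus W" by blast
    then show "x \<in> range (\<lambda>n. norm_minus (Z n))" using enumD(2)[OF that] by blast
  qed
  obtain k where k: "\<And>n. norm_minus (Y n) = norm_minus (X (n + k))"
    by (rule strict_mono_int_same_range[OF enumD(3)[OF eX] enumD(3)[OF eY]]) (simp_all only: rr[OF eX] rr[OF eY])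
  have kp: "norm_plus (Y n) = norm_plus (X (n + k))" for n
    by (rule minimal_vector_eq[OF enumD(1)[OF eY] enumD(1)[OF eX] k])
  have hk: "hit Y n = hit X (n + k)" for n
    unfolding hit_def k kp by (simp add: ac_simps)
  have "k \<ge> 0" using hk[of 0] hY(1) hX(2) strict_mono_less_eq[OF hit_strict_mono[OF eX], of k "-1"] by force
  moreover have "- 1 + k < 0" using hk[of "-1"] hY(2) hX(1) strict_mono_less_eq[OF hit_strict_mono[OF eX], of 0 "-1 + k"] by force
  ultimately have "k = 0" by simp
  then show "norm_minus (X n) = norm_minus (Y n)" "norm_plus (X n) = norm_plus (Y n)"
    using k[of n] kp[of n] by simp_all
qed

end

text \<open>A number \<open>K\<close> of consecutive minimal vectors, all with hitting times in a unit interval, would after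
  rescaling lie in a fixed box, and the difference of two of them would contradict minimality.\<close>

definition packing_bound :: "'d::finite itself \<Rightarrow> 'c::finite itself \<Rightarrow> nat" where
  "packing_bound _ _ = Suc ((2 * nat \<lceil>real (CARD('d) + CARD('c)) * exp (real (CARD('d) + CARD('c)))\<rceil> + 1) ^ CARD('d + 'c))"

context generic_lattice
begin

lemma hit_packing:
  assumes X: "enum X"
  shows "hit X (n + int (packing_bound TYPE('d) TYPE('c))) \<ge> hit X n + 1"
proof (rule ccontr)
  let ?D = "real (CARD('d) + CARD('c))" and ?K = "packing_bound TYPE('d) TYPE('c)"
  define E where "E = exp ?D"
  define M where "M = nat \<lceil>?D * E\<rceil>"
  have E1: "E > 1" using dim_pos[where 'd = 'd and 'c = 'c] by (simp add: E_def)
  have M: "?D * E \<le> real M" unfolding M_def by (rule real_nat_ceiling_ge)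
  have cd: "real CARD('d) \<ge> 1" "real CARD('c) \<ge> 1" by (simp_all add: Suc_leI)
  let ?N = "n + int ?K"
  assume "\<not> ?thesis"
  then have "hit X ?N - hit X n < 1" by simp
  moreover have "hit X ?N - hit X n = (ln (norm_minus (X (?N + 1))) - ln (norm_minus (X (n + 1))) +
      (ln (norm_plus (X n)) - ln (norm_plus (X ?N)))) / ?D"
    unfolding hit_def diff_divide_distrib add_divide_distrib by simp
  ultimately have "(ln (norm_minus (X (?N + 1))) - ln (norm_minus (X (n + 1))) +
      (ln (norm_plus (X n)) - ln (norm_plus (X ?N)))) / ?D < 1" by simp
  \<comment> \<open>Both summands are nonnegative, so each of them is below \<open>?D\<close>: over
    the \<open>?K\<close> steps either seminorm changes by a factor less than
    \<open>E\<close>.\<close>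
  then have lt: "(ln (norm_minus (X (?N + 1))) - ln (norm_minus (X (n + 1)))) +
      (ln (norm_plus (X n)) - ln (norm_plus (X ?N))) < ?D"
    using dim_pos[where 'd = 'd and 'c = 'c] by (simp add: pos_divide_less_eq)
  have Kpos: "?K > 0" by (simp add: packing_bound_def)
  have "norm_minus (X (n + 1)) \<le> norm_minus (X (?N + 1))"
    using enum_minus_less[OF X, of "n + 1" "?N + 1"] Kpos by simp
  then have p1: "ln (norm_minus (X (n + 1))) \<le> ln (norm_minus (X (?N + 1)))" using enum_pos(2)[OF X] by simp
  have "norm_plus (X ?N) \<le> norm_plus (X n)" using enum_plus_less[OF X, of n ?N] Kpos by simp
  then have p2: "ln (norm_plus (X ?N)) \<le> ln (norm_plus (X n))" using enum_pos(1)[OF X] by simp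
  have expand: "a < E * b" if "a > 0" "b > 0" "ln a - ln b < ?D" for a b :: real
  proof -
    have "ln a < ln (E * b)" using that E1 by (simp add: ln_mult E_def)
    then show ?thesis using that E1 by simp
  qed
  have q: "norm_minus (X (?N + 1)) < E * norm_minus (X (n + 1))"
  proof (rule expand)
    show "ln (norm_minus (X (?N + 1))) - ln (norm_minus (X (n + 1))) < ?D" using lt p2 by linarith
  qed (rule enum_pos[OF X])+
  have r: "norm_plus (X n) < E * norm_plus (X ?N)"
  proof (rule expand)
    show "ln (norm_plus (X n)) - ln (norm_plus (X ?N)) < ?D" using lt p1 by linarith
  qed (rule enum_pos[OF X])+
  define P where "P = {n + 1..n + int ?K}"
  \<comment> \<open>The weights are chosen for a difference \<open>w\<close> of two points in one
    cell. The factors \<open>d\<close> and \<open>c\<close> absorb the summation over coordinates,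
    and the extra \<open>E\<close> pushes \<open>norm_plus w\<close> below the smallest
    \<open>norm_plus\<close> that occurs, that of \<open>X ?N\<close>; this makes the inequality
    strict.\<close>
  define f where "f k i = (case i of Inl a \<Rightarrow> X k $ Inl a * (real CARD('d) * E / norm_plus (X n))
     | Inr b \<Rightarrow> X k $ Inr b * (real CARD('c) / norm_minus (X (n + 1))))" for k and i :: "'d + 'c"
  have cardP: "card P > (2 * M + 1) ^ CARD('d + 'c)"
  proof -
    have "card P = ?K" by (simp add: P_def)
    then show ?thesis by (simp only: packing_bound_def M_def E_def lessI)
  qed
  have rk: "norm_plus (X k) \<le> norm_plus (X n)" "norm_plus (X ?N) \<le> norm_plus (X k)"
    "norm_minus (X (n + 1)) \<le> norm_minus (X k)" "norm_minus (X k) \<le> E * norm_minus (X (n + 1))" if "k \<in> P" for k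
  proof -
    show "norm_plus (X k) \<le> norm_plus (X n)" using enum_plus_less[OF X, of n k] that by (auto simp: P_def)
    show "norm_plus (X ?N) \<le> norm_plus (X k)"
      using enum_plus_less[OF X, of k ?N] that by (cases "k = ?N") (auto simp: P_def)
    show "norm_minus (X (n + 1)) \<le> norm_minus (X k)"
      using enum_minus_less[OF X, of "n + 1" k] that by (cases "k = n + 1") (auto simp: P_def)
    have "norm_minus (X k) < norm_minus (X (?N + 1))"
      using enum_minus_less[OF X, of k "?N + 1"] that by (auto simp: P_def)
    then show "norm_minus (X k) \<le> E * norm_minus (X (n + 1))" using q by simp
  qed
  have bf: "\<bar>f k i\<bar> \<le> real M" if k: "k \<in> P" for k i
  proof (cases i)
    case (Inl a)
    have "\<bar>X k $ Inl a\<bar> \<le> norm_plus (X n)" using nth_le_norm_plus[of "X k" a] rk(1)[OF k] by simp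
    then have "\<bar>X k $ Inl a\<bar> * (real CARD('d) * E / norm_plus (X n)) \<le> norm_plus (X n) * (real CARD('d) * E / norm_plus (X n))"
      using E1 enum_pos(1)[OF X, of n] by (intro mult_right_mono) auto
    also have "\<dots> = real CARD('d) * E" using enum_pos(1)[OF X, of n] by simp
    also have "\<dots> \<le> ?D * E" using E1 by (intro mult_right_mono) auto
    finally show ?thesis using M E1 enum_pos(1)[OF X, of n] by (simp add: f_def Inl abs_mult)
  next
    case (Inr b)
    have "\<bar>X k $ Inr b\<bar> \<le> E * norm_minus (X (n + 1))" using nth_le_norm_minus[of "X k" b] rk(4)[OF k] by simp
    then have "\<bar>X k $ Inr b\<bar> * (real CARD('c) / norm_minus (X (n + 1))) \<le> E * norm_minus (X (n + 1)) * (real CARD('c) / norm_minus (X (n + 1)))"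
      using E1 enum_pos(2)[OF X, of "n + 1"] by (intro mult_right_mono) auto
    also have "\<dots> = real CARD('c) * E" using enum_pos(2)[OF X, of "n + 1"] by simp
    also have "\<dots> \<le> ?D * E" using E1 by (intro mult_right_mono) auto
    finally show ?thesis using M E1 enum_pos(2)[OF X, of "n + 1"] by (simp add: f_def Inr abs_mult)
  qed
  obtain k l where kl: "k \<in> P" "l \<in> P" "k \<noteq> l" "\<And>i. \<bar>f k i - f l i\<bar> < 1"
  proof (rule pigeonhole_cells[OF cardP, where f = f])
    show "\<And>p i. p \<in> P \<Longrightarrow> \<bar>f p i\<bar> \<le> real M" by (rule bf)
  qed (rule that)
  define w where "w = X k - X l"
  have wl: "\<bar>w $ Inl a\<bar> < norm_plus (X n) / (real CARD('d) * E)" for a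
  proof -
    let ?s = "real CARD('d) * E / norm_plus (X n)"
    have s: "?s > 0" using E1 enum_pos(1)[OF X, of n] cd by simp
    have "f k (Inl a) - f l (Inl a) = w $ Inl a * ?s"
      by (simp only: f_def w_def sum.case vector_minus_component left_diff_distrib)
    then have "\<bar>w $ Inl a\<bar> * ?s < 1" using kl(4)[of "Inl a"] s by (simp only: abs_mult abs_of_pos)
    then have "\<bar>w $ Inl a\<bar> < 1 / ?s" using s by (simp only: pos_less_divide_eq)
    then show ?thesis by simp
  qed
  have wr: "\<bar>w $ Inr b\<bar> < norm_minus (X (n + 1)) / real CARD('c)" for b
  proof -
    let ?s = "real CARD('c) / norm_minus (X (n + 1))"
    have s: "?s > 0" using enum_pos(2)[OF X, of "n + 1"] cd by simp
    have "f k (Inr b) - f l (Inr b) = w $ Inr b * ?s"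
      by (simp only: f_def w_def sum.case vector_minus_component left_diff_distrib)
    then have "\<bar>w $ Inr b\<bar> * ?s < 1" using kl(4)[of "Inr b"] s by (simp only: abs_mult abs_of_pos)
    then have "\<bar>w $ Inr b\<bar> < 1 / ?s" using s by (simp only: pos_less_divide_eq)
    then show ?thesis by simp
  qed
  have "norm_plus w \<le> (\<Sum>i\<in>(UNIV::'d set). norm_plus (X n) / (real CARD('d) * E))"
    by (rule order_trans[OF norm_plus_le_sum sum_mono]) (use wl in \<open>auto intro: less_imp_le\<close>)
  also have "\<dots> = norm_plus (X n) / E" by simp
  also have "\<dots> < norm_plus (X ?N)" using r E1 by (simp add: field_simps)
  also have "\<dots> \<le> norm_plus (X l)" by (rule rk(2)[OF kl(2)])
  finally have wp: "norm_plus w < norm_plus (X l)" .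
  have "norm_minus w \<le> (\<Sum>i\<in>(UNIV::'c set). norm_minus (X (n + 1)) / real CARD('c))"
    by (rule order_trans[OF norm_minus_le_sum sum_mono]) (use wr in \<open>auto intro: less_imp_le\<close>)
  also have "\<dots> = norm_minus (X (n + 1))" by simp
  also have "\<dots> \<le> norm_minus (X l)" by (rule rk(3)[OF kl(2)])
  finally have wm: "norm_minus w \<le> norm_minus (X l)" .
  have "norm_minus (X k) \<noteq> norm_minus (X l)"
    using strict_mono_eq[OF enumD(3)[OF X], of k l] kl(3) by simp
  then have "w \<noteq> 0" unfolding w_def by auto
  moreover have "w \<in> L" unfolding w_def
    by (rule diff_in_lattice[OF lat minimal_vectorD(1)[OF enumD(1)[OF X]] minimal_vectorD(1)[OF enumD(1)[OF X]]])
  ultimately have "norm_plus w = norm_plus (X l)"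
    using minimal_vectorD(5)[OF enumD(1)[OF X, of l], of w] wp wm by simp
  then show False using wp by simp
qed

end

section \<open>Return times to the transversal\<close>

text \<open>Independence is automatic: of two proportional vectors one is at least as large in both
  seminorms, whereas \<open>v0\<close> is strictly larger in \<open>norm_plus\<close> and
  \<open>v1\<close> in \<open>norm_minus\<close>. The value of \<open>lambda1\<close> is forced to
  be \<open>norm_plus v0\<close>, because the cube of that radius contains no other nonzero points
  than the four listed, all of this norm.\<close>

lemma S_pair_iff:
  assumes L: "L \<in> lattice_space"
  shows "S_pair L v0 v1 \<longleftrightarrow> v0 \<in> L \<and> v1 \<in> L \<and> norm_plus v1 < norm_minus v1 \<and> norm_minus v0 < norm_minus v1 \<and>
     norm_minus v1 = norm_plus v0 \<and>
     (\<forall>Y\<in>L. Y \<noteq> 0 \<and> norm_plus Y \<le> norm_plus v0 \<and> norm_minus Y \<le> norm_plus v0 \<longrightarrow> Y \<in> {v0, - v0, v1, - v1})"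
    (is "_ \<longleftrightarrow> ?R")
proof
  assume S: "S_pair L v0 v1"
  then have b: "norm_plus v1 < norm_minus v1" "norm_minus v0 < norm_minus v1" "norm_minus v1 = norm_plus v0"
    and eq: "(L - {0}) \<inter> ball_dc (lambda1 L) = {v0, - v0, v1, - v1}"
    unfolding S_pair_def by blast+
  have "v0 \<in> ball_dc (lambda1 L)" using eq by blast
  then have le: "norm_plus v0 \<le> lambda1 L" by (simp add: ball_dc_def norm_dc_def)
  have "Y \<in> {v0, - v0, v1, - v1}"
    if "Y \<in> L" "Y \<noteq> 0" "norm_plus Y \<le> norm_plus v0" "norm_minus Y \<le> norm_plus v0" for Y
  proof -
    have "Y \<in> (L - {0}) \<inter> ball_dc (lambda1 L)" using that le by (simp add: ball_dc_def norm_dc_def)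
    then show ?thesis unfolding eq .
  qed
  then show ?R using S b unfolding S_pair_def by blast
next
  assume R: ?R
  then have v: "v0 \<in> L" "v1 \<in> L" and b: "norm_plus v1 < norm_minus v1" "norm_minus v0 < norm_minus v1" "norm_minus v1 = norm_plus v0"
    and Y: "\<And>Y. Y \<in> L \<Longrightarrow> Y \<noteq> 0 \<Longrightarrow> norm_plus Y \<le> norm_plus v0 \<Longrightarrow> norm_minus Y \<le> norm_plus v0 \<Longrightarrow> Y \<in> {v0, - v0, v1, - v1}"
    by blast+
  have p1: "norm_plus v1 \<ge> 0" by simp
  have nz: "v0 \<noteq> 0" "v1 \<noteq> 0" using b p1 by auto
  have ne: "v0 \<noteq> v1" using b by auto
  have "v0 \<notin> span {v1}"
  proof
    assume "v0 \<in> span {v1}"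
    then obtain k where k: "v0 = k *\<^sub>R v1" by (auto simp: span_singleton)
    then have kk: "norm_plus v0 = \<bar>k\<bar> * norm_plus v1" "norm_minus v0 = \<bar>k\<bar> * norm_minus v1"
      by (simp_all add: norm_plus_scaleR norm_minus_scaleR)
    show False
    proof (cases "\<bar>k\<bar> \<le> 1")
      case True
      then have "norm_plus v0 \<le> norm_plus v1" using kk(1) p1 by (simp add: mult_left_le_one_le)
      then show False using b by simp
    next
      case False
      then have "1 * norm_minus v1 \<le> \<bar>k\<bar> * norm_minus v1" by (intro mult_right_mono) auto
      then show False using kk(2) b(2) by simp
    qed
  qed
  then have ind: "independent {v0, v1}"
    using ne nz(2) by (simp add: independent_insert)
  have dc: "norm_dc v0 = norm_plus v0" "norm_dc v1 = norm_plus v0" "norm_dc (- v0) = norm_plus v0" "norm_dc (- v1) = norm_plus v0"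
    using b by (auto simp: norm_dc_def)
  have ge: "norm_plus v0 \<le> norm_dc Y" if "Y \<in> L - {0}" for Y
  proof (rule ccontr)
    assume c: "\<not> norm_plus v0 \<le> norm_dc Y"
    then have "Y \<in> {v0, - v0, v1, - v1}" using Y[of Y] that by (auto simp: norm_dc_def)
    then show False using c dc by auto
  qed
  have l1: "lambda1 L = norm_plus v0"
    unfolding lambda1_def
  proof (rule cInf_eq_minimum)
    show "norm_plus v0 \<in> norm_dc ` (L - {0})" using v(1) nz(1) dc(1) by force
    show "\<And>x. x \<in> norm_dc ` (L - {0}) \<Longrightarrow> norm_plus v0 \<le> x" using ge by blast
  qed
  have eq: "(L - {0}) \<inter> ball_dc (lambda1 L) = {v0, - v0, v1, - v1}"
  proof (intro set_eqI iffI)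
    fix Z assume "Z \<in> (L - {0}) \<inter> ball_dc (lambda1 L)"
    then show "Z \<in> {v0, - v0, v1, - v1}" using Y[of Z] by (simp add: l1 ball_dc_def norm_dc_def)
  next
    fix Z assume "Z \<in> {v0, - v0, v1, - v1}"
    then have "Z \<in> L \<and> Z \<noteq> 0 \<and> norm_dc Z = norm_plus v0"
      using v nz dc uminus_in_lattice[OF L v(1)] uminus_in_lattice[OF L v(2)] by (elim insertE emptyE) simp_all
    then show "Z \<in> (L - {0}) \<inter> ball_dc (lambda1 L)" by (simp add: l1 ball_dc_def)
  qed
  show "S_pair L v0 v1" unfolding S_pair_def by (intro conjI v ne ind b eq)
qed

lemma mem_flow: "Y \<in> flow t L \<longleftrightarrow> (\<exists>y\<in>L. Y = flow_matrix t *v y)"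
  unfolding flow_def act_def by blast

lemma flow_matrix_inverse: "flow_matrix (- t) *v (flow_matrix t *v y) = y"
  by (simp add: matrix_vector_mul_assoc flow_matrix_add flow_matrix_0)

lemma flow_matrix_eq_iff: "flow_matrix t *v y = flow_matrix t *v z \<longleftrightarrow> y = z"
  by (metis flow_matrix_inverse)

lemma flow_matrix_mem: "flow_matrix t *v y \<in> flow t L \<longleftrightarrow> y \<in> L"
  unfolding mem_flow by (auto simp: flow_matrix_eq_iff)

lemma ball_flow: "(\<forall>Y\<in>flow t L. P Y) \<longleftrightarrow> (\<forall>y\<in>L. P (flow_matrix t *v y))"
  unfolding flow_def act_def by simp

lemma bex_flow: "(\<exists>Y\<in>flow t L. P Y) \<longleftrightarrow> (\<exists>y\<in>L. P (flow_matrix t *v y))"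
  unfolding flow_def act_def by simp

lemma flow_matrix_uminus: "flow_matrix t *v (- y) = - (flow_matrix t *v y)"
  by (rule linear_neg) simp

lemma flow_matrix_eq_0_iff: "flow_matrix t *v y = 0 \<longleftrightarrow> y = 0"
  using flow_matrix_eq_iff[of t y 0] by simp

lemma flow_exceptional_imp:
  fixes L :: "(real^('d::finite + 'c::finite)) set"
  assumes "L \<in> exceptional"
  shows "flow t L \<in> exceptional"
proof -
  have L: "flow t L \<in> lattice_space" using assms by (auto simp: exceptional_def intro: flow_lattice_space)
  show ?thesis
    using assms L unfolding exceptional_def mem_Collect_eq bex_flow
      norm_plus_eq_0[symmetric] norm_minus_eq_0[symmetric] norm_plus_flow norm_minus_flow
      flow_matrix_uminus[symmetric] flow_matrix_eq_iff flow_matrix_eq_0_iff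
    by (simp add: zero_less_mult_iff)
qed

lemma flow_exceptional_iff: "flow t L \<in> exceptional \<longleftrightarrow> L \<in> exceptional"
  using flow_exceptional_imp[of L t] flow_exceptional_imp[of "flow t L" "- t"] by (auto simp: flow_flow flow_0)

text \<open>Pulled back to \<open>L\<close>, the cube becomes the box with sides
  \<open>norm_plus v0\<close> and \<open>norm_minus v1\<close>, in which \<open>t\<close> no longer
  occurs. Membership in \<open>S\<close> thus splits into an emptiness condition on \<open>L\<close>
  and an equation that determines \<open>t\<close>.\<close>

lemma S_pair_flow:
  fixes L :: "(real^('d::finite + 'c::finite)) set" and t :: real
  assumes L: "L \<in> lattice_space"
  defines "a \<equiv> exp (real CARD('c) * t)" and "b \<equiv> exp (- real CARD('d) * t)"
  shows "S_pair (flow t L) (flow_matrix t *v v0) (flow_matrix t *v v1) \<longleftrightarrow>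
     v0 \<in> L \<and> v1 \<in> L \<and> a * norm_plus v1 < b * norm_minus v1 \<and> norm_minus v0 < norm_minus v1 \<and>
     b * norm_minus v1 = a * norm_plus v0 \<and>
     (\<forall>Y\<in>L. Y \<noteq> 0 \<and> norm_plus Y \<le> norm_plus v0 \<and> norm_minus Y \<le> norm_minus v1 \<longrightarrow> Y \<in> {v0, - v0, v1, - v1})"
proof -
  have ab: "a > 0" "b > 0" by (simp_all add: a_def b_def)
  have "S_pair (flow t L) (flow_matrix t *v v0) (flow_matrix t *v v1) \<longleftrightarrow>
     v0 \<in> L \<and> v1 \<in> L \<and> a * norm_plus v1 < b * norm_minus v1 \<and> b * norm_minus v0 < b * norm_minus v1 \<and>
     b * norm_minus v1 = a * norm_plus v0 \<and>
     (\<forall>Y\<in>L. Y \<noteq> 0 \<and> a * norm_plus Y \<le> a * norm_plus v0 \<and> b * norm_minus Y \<le> a * norm_plus v0 \<longrightarrow> Y \<in> {v0, - v0, v1, - v1})"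
    unfolding S_pair_iff[OF flow_lattice_space[OF L]] ball_flow flow_matrix_mem norm_plus_flow norm_minus_flow
      insert_iff empty_iff flow_matrix_uminus[symmetric] flow_matrix_eq_iff flow_matrix_eq_0_iff a_def[symmetric] b_def[symmetric]
    by blast
  also have "\<dots> \<longleftrightarrow> v0 \<in> L \<and> v1 \<in> L \<and> a * norm_plus v1 < b * norm_minus v1 \<and> norm_minus v0 < norm_minus v1 \<and>
     b * norm_minus v1 = a * norm_plus v0 \<and>
     (\<forall>Y\<in>L. Y \<noteq> 0 \<and> norm_plus Y \<le> norm_plus v0 \<and> norm_minus Y \<le> norm_minus v1 \<longrightarrow> Y \<in> {v0, - v0, v1, - v1})"
  proof (intro conj_cong refl)
    show "b * norm_minus v0 < b * norm_minus v1 \<longleftrightarrow> norm_minus v0 < norm_minus v1" using ab by simp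
    assume eq: "b * norm_minus v1 = a * norm_plus v0"
    show "(\<forall>Y\<in>L. Y \<noteq> 0 \<and> a * norm_plus Y \<le> a * norm_plus v0 \<and> b * norm_minus Y \<le> a * norm_plus v0 \<longrightarrow> Y \<in> {v0, - v0, v1, - v1})
      \<longleftrightarrow> (\<forall>Y\<in>L. Y \<noteq> 0 \<and> norm_plus Y \<le> norm_plus v0 \<and> norm_minus Y \<le> norm_minus v1 \<longrightarrow> Y \<in> {v0, - v0, v1, - v1})"
    proof -
      have "a * norm_plus Y \<le> a * norm_plus v0 \<longleftrightarrow> norm_plus Y \<le> norm_plus v0"
        "b * norm_minus Y \<le> a * norm_plus v0 \<longleftrightarrow> norm_minus Y \<le> norm_minus v1" for Y :: "real^('d + 'c)"
        using ab by (simp, simp add: eq[symmetric])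
      then show ?thesis by (simp only:)
    qed
  qed
  finally show ?thesis .
qed

lemma flow_in_S_iff:
  assumes L: "L \<in> lattice_space"
  shows "flow t L \<in> S \<longleftrightarrow> (\<exists>v0 v1. S_pair (flow t L) (flow_matrix t *v v0) (flow_matrix t *v v1))"
proof -
  have "(\<exists>w0 w1. S_pair (flow t L) w0 w1) \<longleftrightarrow> (\<exists>v0 v1. S_pair (flow t L) (flow_matrix t *v v0) (flow_matrix t *v v1))"
  proof
    assume "\<exists>w0 w1. S_pair (flow t L) w0 w1"
    then obtain w0 w1 where w: "S_pair (flow t L) w0 w1" by blast
    then have "w0 \<in> flow t L" "w1 \<in> flow t L" unfolding S_pair_def by blast+
    then obtain v0 v1 where "w0 = flow_matrix t *v v0" "w1 = flow_matrix t *v v1" unfolding mem_flow by blast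
    then show "\<exists>v0 v1. S_pair (flow t L) (flow_matrix t *v v0) (flow_matrix t *v v1)" using w by blast
  qed blast
  then show ?thesis unfolding S_def using flow_lattice_space[OF L] by simp
qed

context generic_lattice
begin

lemma enum_nonzero: "enum X \<Longrightarrow> norm_plus (X n) \<noteq> 0" "enum X \<Longrightarrow> norm_minus (X n) \<noteq> 0"
  using enum_pos[of X n] by auto

lemma exp_hit_iff:
  assumes X: "enum X"
  shows "exp (- real CARD('d) * t) * norm_minus (X (n + 1)) = exp (real CARD('c) * t) * norm_plus (X n) \<longleftrightarrow> t = hit X n"
proof -
  let ?D = "real (CARD('d) + CARD('c))"
  have p: "norm_minus (X (n + 1)) > 0" "norm_plus (X n) > 0" using enum_pos[OF X] by blast+
  have "exp (- real CARD('d) * t) * norm_minus (X (n + 1)) = exp (real CARD('c) * t) * norm_plus (X n)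
    \<longleftrightarrow> ln (exp (- real CARD('d) * t) * norm_minus (X (n + 1))) = ln (exp (real CARD('c) * t) * norm_plus (X n))"
    using p by simp
  also have "\<dots> \<longleftrightarrow> - real CARD('d) * t + ln (norm_minus (X (n + 1))) = real CARD('c) * t + ln (norm_plus (X n))"
    using p by (simp add: ln_mult)
  also have "\<dots> \<longleftrightarrow> t * ?D = ln (norm_minus (X (n + 1))) - ln (norm_plus (X n))"
    by (auto simp: algebra_simps)
  also have "\<dots> \<longleftrightarrow> t = hit X n"
    unfolding hit_def using dim_pos[where 'd = 'd and 'c = 'c] by (simp add: eq_divide_eq)
  finally show ?thesis .
qed

text \<open>A nonzero lattice point in the box spanned by \<open>X n\<close> and
  \<open>X (n + 1)\<close> lies above some minimal vector \<open>X m\<close>. The two sides of the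
  box leave only \<open>m = n\<close> and \<open>m = n + 1\<close>, where one seminorm agrees, and
  genericity identifies the point up to sign.\<close>

lemma S_pair_hit:
  assumes X: "enum X"
  shows "S_pair (flow (hit X n) L) (flow_matrix (hit X n) *v X n) (flow_matrix (hit X n) *v X (n + 1))"
proof -
  let ?a = "exp (real CARD('c) * hit X n)" and ?b = "exp (- real CARD('d) * hit X n)"
  have eq: "?b * norm_minus (X (n + 1)) = ?a * norm_plus (X n)" using exp_hit_iff[OF X] by blast
  have lt: "norm_plus (X (n + 1)) < norm_plus (X n)" "norm_minus (X n) < norm_minus (X (n + 1))"
    using enum_plus_less[OF X, of n "n + 1"] enum_minus_less[OF X, of n "n + 1"] by simp_all
  have Y: "Y \<in> {X n, - X n, X (n + 1), - X (n + 1)}"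
    if Y: "Y \<in> L" "Y \<noteq> 0" "norm_plus Y \<le> norm_plus (X n)" "norm_minus Y \<le> norm_minus (X (n + 1))" for Y
  proof -
    obtain Z where Z: "minimal_vector L Z" "norm_plus Z \<le> norm_plus Y" "norm_minus Z \<le> norm_minus Y"
      using ex_minimal_vector_below[OF Y(1,2)] .
    obtain m where m: "norm_minus Z = norm_minus (X m)" using enumD(2)[OF X Z(1)] by blast
    then have mp: "norm_plus Z = norm_plus (X m)" by (rule minimal_vector_eq[OF Z(1) enumD(1)[OF X]])
    have "\<not> n + 1 < m" using enum_minus_less[OF X, of "n + 1" m] m Z(3) Y(4) by simp
    moreover have "\<not> m < n" using enum_plus_less[OF X, of m n] mp Z(2) Y(3) by force
    ultimately have "m = n \<or> m = n + 1" by linarith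
    then show ?thesis
    proof
      assume "m = n"
      then have "norm_plus Y = norm_plus (X n)" using mp Z(2) Y(3) by simp
      then show ?thesis
        using norm_plus_inj[OF minimal_vectorD(1)[OF enumD(1)[OF X, of n]] Y(1) minimal_vectorD(2)[OF enumD(1)[OF X, of n]]] by blast
    next
      assume "m = n + 1"
      then have "norm_minus Y = norm_minus (X (n + 1))" using m Z(3) Y(4) by simp
      then show ?thesis
        using norm_minus_inj[OF minimal_vectorD(1)[OF enumD(1)[OF X, of "n + 1"]] Y(1) minimal_vectorD(2)[OF enumD(1)[OF X, of "n + 1"]]] by blast
    qed
  qed
  have "?a * norm_plus (X (n + 1)) < ?b * norm_minus (X (n + 1))"
    unfolding eq using lt(1) by simp
  then show ?thesis unfolding S_pair_flow[OF lat]
    using minimal_vectorD(1)[OF enumD(1)[OF X]] lt(2) eq by (intro conjI ballI impI Y) (blast | assumption)+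
qed

text \<open>Emptiness of the box makes \<open>v0\<close> and \<open>v1\<close> minimal. They are
  consecutive, because a minimal vector between them would lie in the box. The equation for
  \<open>t\<close> then identifies it as a hitting time.\<close>

lemma S_pair_imp_hit:
  assumes X: "enum X" and S: "S_pair (flow t L) (flow_matrix t *v v0) (flow_matrix t *v v1)"
  obtains n where "t = hit X n" "norm_minus v0 = norm_minus (X n)" "norm_minus v1 = norm_minus (X (n + 1))"
proof -
  let ?a = "exp (real CARD('c) * t)" and ?b = "exp (- real CARD('d) * t)"
  have v: "v0 \<in> L" "v1 \<in> L" and b: "?a * norm_plus v1 < ?b * norm_minus v1" "norm_minus v0 < norm_minus v1" "?b * norm_minus v1 = ?a * norm_plus v0"
    and Y: "\<And>Y. Y \<in> L \<Longrightarrow> Y \<noteq> 0 \<Longrightarrow> norm_plus Y \<le> norm_plus v0 \<Longrightarrow> norm_minus Y \<le> norm_minus v1 \<Longrightarrow> Y \<in> {v0, - v0, v1, - v1}"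
    using S unfolding S_pair_flow[OF lat] by blast+
  have r: "norm_plus v1 < norm_plus v0" using b(1) unfolding b(3) by simp
  have "norm_plus v0 > 0" "norm_minus v1 > 0"
    using r b(2) norm_plus_nonneg[of v1] norm_minus_nonneg[of v0] by linarith+
  then have nz: "v0 \<noteq> 0" "v1 \<noteq> 0" by auto
  have m0: "minimal_vector L v0"
    unfolding minimal_vector_def
  proof (intro conjI ballI impI)
    fix W assume W: "W \<in> L \<inter> cylinder v0" "W \<noteq> 0"
    then have Wc: "W \<in> L" "norm_plus W \<le> norm_plus v0" "norm_minus W \<le> norm_minus v0" by (auto simp: cylinder_def)
    then have "W \<in> {v0, - v0, v1, - v1}" using Y W(2) b(2) by simp
    moreover have "W \<noteq> v1" "W \<noteq> - v1" using Wc(3) b(2) by auto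
    ultimately show "norm_plus W = norm_plus v0" "norm_minus W = norm_minus v0" by auto
  qed (use v nz in auto)
  have m1: "minimal_vector L v1"
    unfolding minimal_vector_def
  proof (intro conjI ballI impI)
    fix W assume W: "W \<in> L \<inter> cylinder v1" "W \<noteq> 0"
    then have Wc: "W \<in> L" "norm_plus W \<le> norm_plus v1" "norm_minus W \<le> norm_minus v1" by (auto simp: cylinder_def)
    then have "W \<in> {v0, - v0, v1, - v1}" using Y W(2) r by simp
    moreover have "W \<noteq> v0" "W \<noteq> - v0" using Wc(2) r by auto
    ultimately show "norm_plus W = norm_plus v1" "norm_minus W = norm_minus v1" by auto
  qed (use v nz in auto)
  obtain n where n: "norm_minus v0 = norm_minus (X n)" using enumD(2)[OF X m0] by blast
  obtain m where m: "norm_minus v1 = norm_minus (X m)" using enumD(2)[OF X m1] by blast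
  have np: "norm_plus v0 = norm_plus (X n)" by (rule minimal_vector_eq[OF m0 enumD(1)[OF X] n])
  have nm: "n < m" using enum_minus_less[OF X, of n m] n m b(2) by simp
  have "m = n + 1"
  proof (rule ccontr)
    assume "m \<noteq> n + 1"
    then have lt: "n < n + 1" "n + 1 < m" using nm by simp_all
    have "X (n + 1) \<in> {v0, - v0, v1, - v1}"
    proof (rule Y)
      show "norm_plus (X (n + 1)) \<le> norm_plus v0" using enum_plus_less[OF X lt(1)] np by simp
      show "norm_minus (X (n + 1)) \<le> norm_minus v1" using enum_minus_less[OF X, of "n + 1" m] lt(2) m by simp
    qed (rule minimal_vectorD[OF enumD(1)[OF X]])+
    then have "norm_minus (X (n + 1)) = norm_minus (X n) \<or> norm_minus (X (n + 1)) = norm_minus (X m)"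
      using n m by auto
    then show False using enum_minus_less[OF X, of n "n + 1"] enum_minus_less[OF X, of "n + 1" m] lt by auto
  qed
  moreover have "t = hit X n"
    using b(3) exp_hit_iff[OF X, of t n] np m calculation by simp
  ultimately show thesis using that n m by blast
qed

lemma flow_in_S_iff_hit: "enum X \<Longrightarrow> flow t L \<in> S \<longleftrightarrow> t \<in> range (hit X)"
proof
  assume X: "enum X"
  {
    assume "flow t L \<in> S"
    then obtain v0 v1 where "S_pair (flow t L) (flow_matrix t *v v0) (flow_matrix t *v v1)"
      unfolding flow_in_S_iff[OF lat] by blast
    then obtain n where "t = hit X n" by (rule S_pair_imp_hit[OF X])
    then show "t \<in> range (hit X)" by blast
  }
  assume "t \<in> range (hit X)"
  then obtain n where "t = hit X n" by blast
  then show "flow t L \<in> S" unfolding flow_in_S_iff[OF lat] using S_pair_hit[OF X] by blast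
qed

lemma rho_hit:
  assumes X: "enum X"
  shows "rho (flow (hit X n) L) = ln (norm_minus (X (n + 1))) - ln (norm_minus (X n))"
proof -
  let ?t = "hit X n" and ?g = "flow_matrix (hit X n)"
  \<comment> \<open>Whichever pair is chosen, it comes from consecutive minimal vectors with the
    same hitting time, and the hitting time determines the index. The factor by which the flow
    contracts \<open>norm_minus\<close> cancels in the quotient.\<close>
  define p where "p = (SOME (v0, v1). S_pair (flow ?t L) v0 v1)"
  have "case p of (v0, v1) \<Rightarrow> S_pair (flow ?t L) v0 v1"
    unfolding p_def by (rule someI[where x = "(?g *v X n, ?g *v X (n + 1))"]) (simp add: S_pair_hit[OF X])
  then obtain w0 w1 where p: "p = (w0, w1)" "S_pair (flow ?t L) w0 w1" by (cases p) auto
  then have "w0 \<in> flow ?t L" "w1 \<in> flow ?t L" unfolding S_pair_def by blast+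
  then obtain v0 v1 where v: "w0 = ?g *v v0" "w1 = ?g *v v1" unfolding mem_flow by blast
  obtain m where m: "?t = hit X m" "norm_minus v0 = norm_minus (X m)" "norm_minus v1 = norm_minus (X (m + 1))"
    using S_pair_imp_hit[OF X p(2)[unfolded v]] .
  have "m = n" using m(1) strict_mono_eq[OF hit_strict_mono[OF X]] by simp
  have "rho (flow ?t L) = ln (norm_minus w1 / norm_minus w0)"
    unfolding rho_def p_def[symmetric] p(1) by simp
  also have "\<dots> = ln (norm_minus (X (n + 1)) / norm_minus (X n))"
    unfolding v norm_minus_flow m(2,3) \<open>m = n\<close> by simp
  finally show ?thesis by (simp add: ln_div enum_nonzero[OF X])
qed

lemma tau_hit:
  assumes X: "enum X"
  shows "tau (flow (hit X n) L) = hit X (n + 1) - hit X n"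
  unfolding tau_def flow_flow flow_in_S_iff_hit[OF X]
proof (rule cInf_eq_minimum)
  show "hit X (n + 1) - hit X n \<in> {t. t > 0 \<and> t + hit X n \<in> range (hit X)}"
    using strict_mono_less[OF hit_strict_mono[OF X], of n "n + 1"] by simp
  fix t assume "t \<in> {t. t > 0 \<and> t + hit X n \<in> range (hit X)}"
  then obtain m where m: "t > 0" "t + hit X n = hit X m" by auto
  then have "n < m" using strict_mono_less[OF hit_strict_mono[OF X], of n m] by simp
  then have "hit X (n + 1) \<le> hit X m" using strict_mono_less_eq[OF hit_strict_mono[OF X], of "n + 1" m] by simp
  then show "hit X (n + 1) - hit X n \<le> t" using m(2) by simp
qed

section \<open>How the flow acts on the numbering of minimal vectors\<close>

lemma generic_flow: "generic_lattice (flow s L)"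
  by unfold_locales (use lat generic in \<open>simp_all add: flow_lattice_space flow_exceptional_iff\<close>)

lemma minimal_vector_flow: "minimal_vector (flow s L) (flow_matrix s *v Y) \<longleftrightarrow> minimal_vector L Y"
proof -
  have "minimal_vector (flow s L) (flow_matrix s *v Y) \<longleftrightarrow> Y \<in> L \<and> Y \<noteq> 0 \<and>
    (\<forall>Z\<in>flow s L. norm_plus Z \<le> norm_plus (flow_matrix s *v Y) \<and> norm_minus Z \<le> norm_minus (flow_matrix s *v Y) \<and> Z \<noteq> 0 \<longrightarrow>
      norm_plus Z = norm_plus (flow_matrix s *v Y) \<and> norm_minus Z = norm_minus (flow_matrix s *v Y))"
    unfolding minimal_vector_def cylinder_def flow_matrix_mem flow_matrix_eq_0_iff by blast
  also have "\<dots> \<longleftrightarrow> minimal_vector L Y"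
    unfolding ball_flow norm_plus_flow norm_minus_flow flow_matrix_eq_0_iff minimal_vector_def cylinder_def by auto
  finally show ?thesis .
qed

lemma enum_flow:
  assumes X: "enum X"
  shows "generic_lattice.enum (flow s L) (\<lambda>n. flow_matrix s *v X n)"
proof -
  interpret F: generic_lattice "flow s L" by (rule generic_flow)
  show ?thesis unfolding F.enum_def
  proof (intro conjI allI impI)
    show "minimal_vector (flow s L) (flow_matrix s *v X n)" for n
      unfolding minimal_vector_flow by (rule enumD(1)[OF X])
    show "\<exists>n. norm_minus Y = norm_minus (flow_matrix s *v X n)" if Y: "minimal_vector (flow s L) Y" for Y
    proof -
      obtain y where y: "Y = flow_matrix s *v y" using F.minimal_vectorD(1)[OF Y] unfolding mem_flow by blast
      then obtain n where "norm_minus y = norm_minus (X n)" using Y enumD(2)[OF X] minimal_vector_flow by blast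
      then show ?thesis by (intro exI[of _ n]) (simp add: y norm_minus_flow)
    qed
    show "strict_mono (\<lambda>n. norm_minus (flow_matrix s *v X n))"
      using enum_minus_less[OF X] by (intro strict_monoI) (simp add: norm_minus_flow)
  qed
qed

lemma hit_flow:
  assumes X: "enum X"
  shows "hit (\<lambda>n. flow_matrix s *v X n) n = hit X n - s"
proof -
  let ?D = "real (CARD('d) + CARD('c))"
  have "hit (\<lambda>n. flow_matrix s *v X n) n
      = (ln (norm_minus (X (n + 1))) - ln (norm_plus (X n)) - s * ?D) / ?D"
    unfolding hit_def norm_plus_flow norm_minus_flow
    by (simp add: ln_mult enum_nonzero[OF X] algebra_simps)
  also have "\<dots> = hit X n - s" unfolding hit_def using dim_pos[where 'd = 'd and 'c = 'c] by (simp add: diff_divide_distrib)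
  finally show ?thesis .
qed

lemma min_vec_enum: "enum (min_vec L)" "hit (min_vec L) 0 \<ge> 0" "hit (min_vec L) (- 1) < 0"
  using minimal_sequence_min_vec unfolding minimal_sequence_iff by blast+

text \<open>Flowing by \<open>s\<close> subtracts \<open>s\<close> from all hitting times, so the
  origin moves to the index \<open>k\<close> of the first hit not before \<open>s\<close>. This
  relation makes the sums over hits telescope.\<close>

lemma min_vec_flow:
  assumes k: "hit (min_vec L) (k - 1) < s" "s \<le> hit (min_vec L) k"
  shows "q (flow s L) n = exp (- real CARD('d) * s) * q L (n + k)"
    "hit (min_vec (flow s L)) n = hit (min_vec L) (n + k) - s"
proof -
  interpret F: generic_lattice "flow s L" by (rule generic_flow)
  let ?Y = "\<lambda>n. flow_matrix s *v min_vec L (n + k)"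
  note e = min_vec_enum(1)
  have "minimal_sequence (flow s L) ?Y"
    unfolding F.minimal_sequence_iff hit_flow[OF enum_shift[OF e]] hit_shift
    using enum_flow[OF enum_shift[OF e]] k by simp
  note u = F.minimal_sequence_unique[OF F.minimal_sequence_min_vec this]
  show "q (flow s L) n = exp (- real CARD('d) * s) * q L (n + k)"
    unfolding q_def u norm_minus_flow by simp
  have "hit (min_vec (flow s L)) n = hit ?Y n" unfolding hit_def u ..
  then show "hit (min_vec (flow s L)) n = hit (min_vec L) (n + k) - s"
    unfolding hit_flow[OF enum_shift[OF e]] hit_shift .
qed

section \<open>Counting and summing over the hits in a time window\<close>

lemma hits_interval:
  assumes "m \<ge> 0"
  obtains k where "hit (min_vec L) (int k - 1) < m" "m \<le> hit (min_vec L) (int k)"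
    "{t \<in> {0..<m}. flow t L \<in> S} = (\<lambda>i. hit (min_vec L) (int i)) ` {..<k}"
proof -
  let ?h = "hit (min_vec L)"
  note e = min_vec_enum(1) and sm = hit_strict_mono[OF min_vec_enum(1)]
  obtain n where n: "?h (n - 1) < m" "m \<le> ?h n"
  proof (rule strict_mono_int_switch[OF sm, of m])
    show "\<exists>n. m \<le> ?h n" using hit_unbounded(1)[OF e, of m] by (auto intro: less_imp_le)
    show "\<exists>n. ?h n < m" by (rule hit_unbounded(2)[OF e])
  qed
  have "?h (-1) < ?h n" using n(2) assms min_vec_enum(3) by simp
  then have "n \<ge> 0" using strict_mono_less[OF sm, of "-1" n] by simp
  then have k: "n = int (nat n)" by simp
  have "{t \<in> {0..<m}. flow t L \<in> S} = (\<lambda>i. ?h (int i)) ` {..<nat n}"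
  proof (intro set_eqI iffI)
    fix t assume "t \<in> {t \<in> {0..<m}. flow t L \<in> S}"
    then obtain j where j: "t = ?h j" "0 \<le> ?h j" "?h j < m" unfolding flow_in_S_iff_hit[OF e] by auto
    have "j \<ge> 0" using j(2) min_vec_enum(3) strict_mono_less[OF sm, of "-1" j] by simp
    moreover have "j < n" using j(3) n(2) strict_mono_less[OF sm, of j n] by simp
    ultimately show "t \<in> (\<lambda>i. ?h (int i)) ` {..<nat n}" by (intro image_eqI[of _ _ "nat j"]) (auto simp: j(1))
  next
    fix t assume "t \<in> (\<lambda>i. ?h (int i)) ` {..<nat n}"
    then obtain i where i: "t = ?h (int i)" "i < nat n" by auto
    have "?h 0 \<le> ?h (int i)" "?h (int i) \<le> ?h (n - 1)"
      using i strict_mono_less_eq[OF sm, of 0 "int i"] strict_mono_less_eq[OF sm, of "int i" "n - 1"] by simp_all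
    then show "t \<in> {t \<in> {0..<m}. flow t L \<in> S}"
      using min_vec_enum(2) n(1) flow_in_S_iff_hit[OF e] i(1) by auto
  qed
  then show thesis using that[of "nat n"] n k by simp
qed

lemma inj_hit: "inj_on (\<lambda>i. hit (min_vec L) (int i)) A"
  using strict_mono_eq[OF hit_strict_mono[OF min_vec_enum(1)]] by (auto intro: inj_onI)

lemma finite_hits:
  assumes "m \<ge> 0"
  shows "finite {t \<in> {0..<m}. flow t L \<in> S}"
proof -
  obtain k where "{t \<in> {0..<m}. flow t L \<in> S} = (\<lambda>i. hit (min_vec L) (int i)) ` {..<k}"
    by (rule hits_interval[OF assms])
  then show ?thesis by simp
qed

text \<open>The hits in \<open>[0, m)\<close> are those with indices \<open>0\<close> to
  \<open>k - 1\<close>, so their number is also the index of the first hit not before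
  \<open>m\<close>, as \<open>min_vec_flow\<close> requires. The window is half-open to match
  \<open>hit X 0 \<ge> 0\<close> in the normalisation.\<close>

lemma card_hits:
  assumes "m \<ge> 0"
  defines "k \<equiv> card {t \<in> {0..<m}. flow t L \<in> S}"
  shows "hit (min_vec L) (int k - 1) < m" "m \<le> hit (min_vec L) (int k)"
    "{t \<in> {0..<m}. flow t L \<in> S} = (\<lambda>i. hit (min_vec L) (int i)) ` {..<k}"
proof -
  obtain k' where k': "hit (min_vec L) (int k' - 1) < m" "m \<le> hit (min_vec L) (int k')"
    "{t \<in> {0..<m}. flow t L \<in> S} = (\<lambda>i. hit (min_vec L) (int i)) ` {..<k'}"
    by (rule hits_interval[OF assms(1)])
  have "k = k'" unfolding k_def k'(3) by (simp add: card_image[OF inj_hit])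
  then show "hit (min_vec L) (int k - 1) < m" "m \<le> hit (min_vec L) (int k)"
    "{t \<in> {0..<m}. flow t L \<in> S} = (\<lambda>i. hit (min_vec L) (int i)) ` {..<k}" using k' by simp_all
qed

lemma card_hits_le: "card {t \<in> {0..<1}. flow t L \<in> S} \<le> packing_bound TYPE('d) TYPE('c)"
proof (rule ccontr)
  let ?k = "card {t \<in> {0..<1}. flow t L \<in> S}" and ?K = "packing_bound TYPE('d) TYPE('c)"
  assume "\<not> ?k \<le> ?K"
  then have "hit (min_vec L) (int ?K) \<le> hit (min_vec L) (int ?k - 1)"
    using strict_mono_less_eq[OF hit_strict_mono[OF min_vec_enum(1)]] by simp
  moreover have "hit (min_vec L) (int ?k - 1) < 1" by (rule card_hits(1)) simp
  moreover have "hit (min_vec L) (int ?K) \<ge> 1" using hit_packing[OF min_vec_enum(1), of 0] min_vec_enum(2) by simp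
  ultimately show False by simp
qed

lemma q_pos: "q L n > 0"
  unfolding q_def by (rule enum_pos(2)[OF min_vec_enum(1)])

lemma q_card_hits:
  assumes "m \<ge> 0"
  shows "ln (q (flow m L) 0) = ln (q L (int (card {t \<in> {0..<m}. flow t L \<in> S}))) - real CARD('d) * m"
  using min_vec_flow(1)[OF card_hits(1,2)[OF assms], of 0] q_pos[THEN less_imp_neq, THEN not_sym] by (simp add: ln_mult)

text \<open>The sum telescopes to \<open>ln (q L k) - ln (q L 0)\<close> with \<open>k\<close> the
  number of hits. Up to the contraction \<open>exp (- d * m)\<close> of \<open>norm_minus\<close>,
  \<open>q L k\<close> is the initial \<open>q\<close> of the lattice at time \<open>m\<close>,
  which is where \<open>d * m\<close> comes from.\<close>

lemma sum_rho_hits: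
  assumes "m \<ge> 0"
  shows "(\<Sum>t\<in>{t \<in> {0..<m}. flow t L \<in> S}. rho (flow t L)) = real CARD('d) * m + (ln (q (flow m L) 0) - ln (q L 0))"
proof -
  let ?k = "card {t \<in> {0..<m}. flow t L \<in> S}"
  have "(\<Sum>t\<in>{t \<in> {0..<m}. flow t L \<in> S}. rho (flow t L))
      = (\<Sum>i<?k. ln (q L (int (Suc i))) - ln (q L (int i)))"
    by (subst card_hits(3)[OF assms], subst sum.reindex[OF inj_hit])
       (simp add: rho_hit[OF min_vec_enum(1)] q_def add.commute)
  also have "\<dots> = ln (q L (int ?k)) - ln (q L 0)"
    using sum_lessThan_telescope[of "\<lambda>i. ln (q L (int i))" ?k] by simp
  finally show ?thesis using q_card_hits[OF assms] by simp
qed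

lemma sum_tau_hits:
  assumes "m \<ge> 0"
  shows "(\<Sum>t\<in>{t \<in> {0..<m}. flow t L \<in> S}. tau (flow t L)) = m + (hit (min_vec (flow m L)) 0 - hit (min_vec L) 0)"
proof -
  let ?k = "card {t \<in> {0..<m}. flow t L \<in> S}"
  have "(\<Sum>t\<in>{t \<in> {0..<m}. flow t L \<in> S}. tau (flow t L))
      = (\<Sum>i<?k. hit (min_vec L) (int (Suc i)) - hit (min_vec L) (int i))"
    by (subst card_hits(3)[OF assms], subst sum.reindex[OF inj_hit])
       (simp add: tau_hit[OF min_vec_enum(1)] add.commute)
  also have "\<dots> = hit (min_vec L) (int ?k) - hit (min_vec L) 0"
    using sum_lessThan_telescope[of "\<lambda>i. hit (min_vec L) (int i)" ?k] by simp
  finally show ?thesis using min_vec_flow(2)[OF card_hits(1,2)[OF assms], of 0] by simp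
qed

lemma card_hits_add:
  assumes "s \<ge> 0" "m \<ge> 0"
  shows "card {t \<in> {0..<s + m}. flow t L \<in> S}
    = card {t \<in> {0..<s}. flow t L \<in> S} + card {t \<in> {0..<m}. flow t (flow s L) \<in> S}"
proof -
  have "{t \<in> {0..<s + m}. flow t L \<in> S}
      = {t \<in> {0..<s}. flow t L \<in> S} \<union> (\<lambda>t. t + s) ` {t \<in> {0..<m}. flow t (flow s L) \<in> S}"
  proof (intro set_eqI iffI)
    fix t assume t: "t \<in> {t \<in> {0..<s + m}. flow t L \<in> S}"
    show "t \<in> {t \<in> {0..<s}. flow t L \<in> S} \<union> (\<lambda>t. t + s) ` {t \<in> {0..<m}. flow t (flow s L) \<in> S}"
    proof (cases "t < s")
      case False
      then have "t - s \<in> {t \<in> {0..<m}. flow t (flow s L) \<in> S}" using t by (simp add: flow_flow)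
      then have "t \<in> (\<lambda>t. t + s) ` {t \<in> {0..<m}. flow t (flow s L) \<in> S}" by (rule image_eqI[rotated]) simp
      then show ?thesis by (rule UnI2)
    next
      case True
      then have "t \<in> {t \<in> {0..<s}. flow t L \<in> S}" using t by simp
      then show ?thesis by (rule UnI1)
    qed
  next
    fix t assume "t \<in> {t \<in> {0..<s}. flow t L \<in> S} \<union> (\<lambda>t. t + s) ` {t \<in> {0..<m}. flow t (flow s L) \<in> S}"
    then show "t \<in> {t \<in> {0..<s + m}. flow t L \<in> S}" using assms by (auto simp: flow_flow)
  qed
  moreover have "card ((\<lambda>t. t + s) ` {t \<in> {0..<m}. flow t (flow s L) \<in> S}) = card {t \<in> {0..<m}. flow t (flow s L) \<in> S}"
    by (rule card_image) (auto intro: inj_onI)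
  moreover have "finite {t \<in> {0..<m}. flow t (flow s L) \<in> S}"
    by (rule generic_lattice.finite_hits[OF generic_flow assms(2)])
  moreover have "{t \<in> {0..<s}. flow t L \<in> S} \<inter> (\<lambda>t. t + s) ` {t \<in> {0..<m}. flow t (flow s L) \<in> S} = {}"
    by auto
  ultimately show ?thesis
    using card_Un_disjoint[OF finite_hits[OF assms(1)], of "(\<lambda>t. t + s) ` {t \<in> {0..<m}. flow t (flow s L) \<in> S}"]
    by (simp only: finite_imageI)
qed

lemma tau_pos: "L \<in> S \<Longrightarrow> tau L > 0"
proof -
  assume "L \<in> S"
  then have "0 \<in> range (hit (min_vec L))" using flow_in_S_iff_hit[OF min_vec_enum(1), of 0] by (simp add: flow_0)
  then obtain n where "hit (min_vec L) n = 0" by force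
  then show "tau L > 0"
    using tau_hit[OF min_vec_enum(1), of n] strict_mono_less[OF hit_strict_mono[OF min_vec_enum(1)], of n "n + 1"] by (simp add: flow_0)
qed

lemma tau_le: "t > 0 \<Longrightarrow> flow t L \<in> S \<Longrightarrow> tau L \<le> t"
  unfolding tau_def by (rule cInf_lower) (auto intro!: bdd_belowI[of _ 0])

lemma rho_nonneg: "L \<in> S \<Longrightarrow> rho L \<ge> 0"
proof -
  assume "L \<in> S"
  then have "0 \<in> range (hit (min_vec L))" using flow_in_S_iff_hit[OF min_vec_enum(1), of 0] by (simp add: flow_0)
  then obtain n where n: "hit (min_vec L) n = 0" by force
  have "norm_minus (min_vec L n) < norm_minus (min_vec L (n + 1))"
    using enum_minus_less[OF min_vec_enum(1), of n "n + 1"] by simp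
  then show "rho L \<ge> 0"
    using rho_hit[OF min_vec_enum(1), of n] n enum_pos(2)[OF min_vec_enum(1)] by (simp add: flow_0)
qed

lemma q_strict_mono: "strict_mono (q L)"
  using enumD(3)[OF min_vec_enum(1)] unfolding q_def .

end

section \<open>Measurability of the return data\<close>

lemma continuous_on_flow_matrix:
  "continuous_on T (flow_matrix :: real \<Rightarrow> real^('d::finite + 'c::finite)^('d + 'c))"
  unfolding flow_matrix_def
proof (intro continuous_on_vec_lambda)
  fix i j :: "'d + 'c"
  show "continuous_on T (\<lambda>t. if i = j then (case i of Inl _ \<Rightarrow> exp (real CARD('c) * t) | Inr _ \<Rightarrow> exp (- real CARD('d) * t)) else 0)"
    by (cases "i = j"; cases i) (auto intro!: continuous_intros)
qed

lemma measurable_flow_matrix [measurable]: "flow_matrix \<in> borel_measurable borel"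
  by (rule borel_measurable_continuous_onI[OF continuous_on_flow_matrix])

lemma measurable_flow_time:
  assumes [measurable]: "f \<in> borel_measurable lattice_borel"
  shows "(\<lambda>L. flow (f L) L) \<in> measurable lattice_borel lattice_borel"
  unfolding flow_def by (rule measurable_act) (simp_all add: flow_matrix_SL)

text \<open>All ordered pairs of lattice vectors are coded by natural numbers. For the
  \<open>i\<close>-th pair, \<open>pair_time i\<close> is the only time at which it can witness
  membership in \<open>S\<close>, and \<open>pair_valid i\<close> tests whether it does. The hits of
  an orbit become values of countably many Borel functions.\<close>

definition pair0 :: "nat \<Rightarrow> (real^'n::finite) set \<Rightarrow> real^'n" where
  "pair0 i L = lattice_vec L (fst (prod_decode i))"

definition pair1 :: "nat \<Rightarrow> (real^'n::finite) set \<Rightarrow> real^'n" where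
  "pair1 i L = lattice_vec L (snd (prod_decode i))"

definition pair_time :: "nat \<Rightarrow> (real^('d::finite + 'c::finite)) set \<Rightarrow> real" where
  "pair_time i L = (ln (norm_minus (pair1 i L)) - ln (norm_plus (pair0 i L))) / real (CARD('d) + CARD('c))"

definition pair_valid :: "nat \<Rightarrow> (real^('d::finite + 'c::finite)) set \<Rightarrow> bool" where
  "pair_valid i L \<longleftrightarrow> S_pair (flow (pair_time i L) L)
     (flow_matrix (pair_time i L) *v pair0 i L) (flow_matrix (pair_time i L) *v pair1 i L)"

lemma measurable_pair [measurable]:
  "pair0 i \<in> borel_measurable lattice_borel" "pair1 i \<in> borel_measurable lattice_borel"
  "pair_time i \<in> borel_measurable lattice_borel"
  unfolding pair0_def[abs_def] pair1_def[abs_def] pair_time_def[abs_def] by measurable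

lemma pair_in_lattice: "L \<in> lattice_space \<Longrightarrow> pair0 i L \<in> L" "L \<in> lattice_space \<Longrightarrow> pair1 i L \<in> L"
  using lattice_eq_range[of L] unfolding pair0_def pair1_def by blast+

text \<open>Pulled back to \<open>L\<close>, the condition involves only seminorms of enumerated
  vectors; equality of vectors is tested through vanishing norms.\<close>

lemma measurable_pair_valid [measurable]:
  "Measurable.pred lattice_borel (pair_valid i :: (real^('d::finite + 'c::finite)) set \<Rightarrow> bool)"
proof -
  have "pair_valid i L \<longleftrightarrow>
     exp (real CARD('c) * pair_time i L) * norm_plus (pair1 i L) < exp (- real CARD('d) * pair_time i L) * norm_minus (pair1 i L) \<and>
     norm_minus (pair0 i L) < norm_minus (pair1 i L) \<and>
     exp (- real CARD('d) * pair_time i L) * norm_minus (pair1 i L) = exp (real CARD('c) * pair_time i L) * norm_plus (pair0 i L) \<and>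
     (\<forall>k. norm (lattice_vec L k) \<noteq> 0 \<and> norm_plus (lattice_vec L k) \<le> norm_plus (pair0 i L) \<and>
        norm_minus (lattice_vec L k) \<le> norm_minus (pair1 i L) \<longrightarrow>
        norm (lattice_vec L k - pair0 i L) = 0 \<or> norm (lattice_vec L k + pair0 i L) = 0 \<or>
        norm (lattice_vec L k - pair1 i L) = 0 \<or> norm (lattice_vec L k + pair1 i L) = 0)"
    if L: "L \<in> space lattice_borel" for L :: "(real^('d + 'c)) set"
  proof -
    have L': "L \<in> lattice_space" using L by simp
    show ?thesis
      unfolding pair_valid_def S_pair_flow[OF L'] ball_lattice[OF L']
      by (simp add: pair_in_lattice[OF L'] eq_neg_iff_add_eq_0)
  qed
  then show ?thesis by (subst measurable_cong) measurable
qed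

text \<open>The equation for the two seminorms can be solved for \<open>t\<close> in any lattice, so
  this holds on the exceptional set as well and yields measurability of \<open>S\<close> and
  \<open>tau\<close> on the whole space.\<close>

lemma hits_eq_pairs:
  fixes L :: "(real^('d::finite + 'c::finite)) set"
  assumes L: "L \<in> lattice_space"
  shows "{t. flow t L \<in> S} = {pair_time i L | i. pair_valid i L}"
proof (intro set_eqI iffI)
  fix t assume "t \<in> {t. flow t L \<in> S}"
  then obtain v0 v1 where S: "S_pair (flow t L) (flow_matrix t *v v0) (flow_matrix t *v v1)"
    using flow_in_S_iff[OF L] by blast
  then have v: "v0 \<in> L" "v1 \<in> L" "norm_minus v0 < norm_minus v1"
    and eq: "exp (- real CARD('d) * t) * norm_minus v1 = exp (real CARD('c) * t) * norm_plus v0"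
    unfolding S_pair_flow[OF L] by blast+
  obtain k0 k1 where k: "v0 = lattice_vec L k0" "v1 = lattice_vec L k1"
    using v(1,2) lattice_eq_range[OF L] by blast
  define i where "i = prod_encode (k0, k1)"
  have p: "pair0 i L = v0" "pair1 i L = v1" by (simp_all add: pair0_def pair1_def i_def k)
  have p1: "norm_minus v1 > 0" using v(3) norm_minus_nonneg[of v0] by linarith
  then have "exp (real CARD('c) * t) * norm_plus v0 > 0" unfolding eq[symmetric] by simp
  then have p0: "norm_plus v0 > 0" by (simp add: zero_less_mult_iff)
  have "- real CARD('d) * t + ln (norm_minus v1) = real CARD('c) * t + ln (norm_plus v0)"
    using arg_cong[OF eq, of ln] p0 p1 by (simp add: ln_mult less_imp_neq[THEN not_sym])
  then have "t * real (CARD('d) + CARD('c)) = ln (norm_minus v1) - ln (norm_plus v0)"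
    by (simp add: algebra_simps)
  then have "t = pair_time i L"
    unfolding pair_time_def p using dim_pos[where 'd = 'd and 'c = 'c] by (simp add: eq_divide_eq)
  moreover have "pair_valid i L" unfolding pair_valid_def calculation[symmetric] p by (rule S)
  ultimately show "t \<in> {pair_time i L | i. pair_valid i L}" by blast
next
  fix t assume "t \<in> {pair_time i L | i. pair_valid i L}"
  then show "t \<in> {t. flow t L \<in> S}" using flow_in_S_iff[OF L] unfolding pair_valid_def by blast
qed

lemma ex_hit_iff:
  assumes L: "L \<in> lattice_space"
  shows "(\<exists>t. flow t L \<in> S \<and> P t) \<longleftrightarrow> (\<exists>i. pair_valid i L \<and> P (pair_time i L))"
proof -
  have "flow t L \<in> S \<longleftrightarrow> (\<exists>i. t = pair_time i L \<and> pair_valid i L)" for t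
    using hits_eq_pairs[OF L] by (simp add: set_eq_iff)
  then show ?thesis by auto
qed

lemma S_subset: "S \<subseteq> lattice_space"
  unfolding S_def by blast

lemma S_sets [measurable]: "S \<in> sets lattice_borel"
proof -
  have "L \<in> S \<longleftrightarrow> L \<in> space lattice_borel \<and> (\<exists>i. pair_valid i L \<and> pair_time i L = 0)" for L :: "(real^('a + 'b)) set"
    using ex_hit_iff[of L "\<lambda>t. t = 0"] S_subset by (auto simp: flow_0)
  then have "S = {L \<in> space lattice_borel. \<exists>i. pair_valid i L \<and> pair_time i (L :: (real^('a + 'b)) set) = 0}"
    by blast
  also have "\<dots> \<in> sets lattice_borel" by measurable
  finally show ?thesis .
qed

lemma tau_measurable [measurable]: "tau \<in> borel_measurable lattice_borel"
  unfolding borel_measurable_iff_less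
proof
  fix a :: real
  \<comment> \<open>For lattices that never return, \<open>tau\<close> has the unspecified constant
    value \<open>Inf {}\<close>; keeping it as a separate case makes the sublevel sets Borel
    whatever that constant is.\<close>
  have key: "tau L < a \<longleftrightarrow> (\<exists>i. pair_valid i L \<and> pair_time i L > 0 \<and> pair_time i L < a) \<or>
      (\<not> (\<exists>i. pair_valid i L \<and> pair_time i L > 0) \<and> Inf {} < a)"
    if L: "L \<in> lattice_space" for L :: "(real^('a + 'b)) set"
  proof (cases "{t. t > 0 \<and> flow t L \<in> S} = {}")
    case True
    then have "\<not> (\<exists>t. flow t L \<in> S \<and> t > 0)" by blast
    then have "\<not> (\<exists>i. pair_valid i L \<and> pair_time i L > 0)" unfolding ex_hit_iff[OF L] .
    then show ?thesis unfolding tau_def True by blast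
  next
    case False
    have "tau L < a \<longleftrightarrow> (\<exists>t\<in>{t. t > 0 \<and> flow t L \<in> S}. t < a)"
      unfolding tau_def by (rule cInf_less_iff[OF False]) (auto intro!: bdd_belowI[of _ 0])
    also have "\<dots> \<longleftrightarrow> (\<exists>t. flow t L \<in> S \<and> (t > 0 \<and> t < a))" by blast
    also have "\<dots> \<longleftrightarrow> (\<exists>i. pair_valid i L \<and> pair_time i L > 0 \<and> pair_time i L < a)" by (rule ex_hit_iff[OF L])
    finally have 1: "tau L < a \<longleftrightarrow> (\<exists>i. pair_valid i L \<and> pair_time i L > 0 \<and> pair_time i L < a)" .
    have "\<exists>t. flow t L \<in> S \<and> t > 0" using False by blast
    then have "\<exists>i. pair_valid i L \<and> pair_time i L > 0" unfolding ex_hit_iff[OF L] .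
    then show ?thesis using 1 by blast
  qed
  have "{L \<in> space lattice_borel. tau (L :: (real^('a + 'b)) set) < a} = {L \<in> space lattice_borel.
      (\<exists>i. pair_valid i L \<and> pair_time i L > 0 \<and> pair_time i L < a) \<or>
      (\<not> (\<exists>i. pair_valid i L \<and> pair_time i L > 0) \<and> Inf {} < a)}"
    by (intro Collect_cong conj_cong refl key) simp
  also have "\<dots> \<in> sets lattice_borel" by measurable
  finally show "{L \<in> space lattice_borel. tau (L :: (real^('a + 'b)) set) < a} \<in> sets lattice_borel" .
qed

lemma S_pairD:
  assumes "S_pair L v0 v1"
  shows "norm_plus v1 < norm_minus v1" "norm_minus v0 < norm_minus v1" "norm_minus v1 = norm_plus v0"
    and "(L - {0}) \<inter> ball_dc (lambda1 L) = {v0, - v0, v1, - v1}"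
  using assms unfolding S_pair_def by - (elim conjE, assumption)+

text \<open>The short vectors determine the set of the four vectors, and within it the classes of
  \<open>v0\<close> and \<open>v1\<close> are told apart by which seminorm is the larger one. No
  genericity is assumed, so the choice in \<open>rho\<close> is harmless on all of
  \<open>S\<close>.\<close>

lemma S_pair_norm_minus_unique:
  assumes V: "S_pair L v0 v1" and W: "S_pair L w0 w1"
  shows "norm_minus w0 = norm_minus v0" "norm_minus w1 = norm_minus v1"
proof -
  note v = S_pairD(1-3)[OF V] and w = S_pairD(1-3)[OF W]
  have eq: "{v0, - v0, v1, - v1} = {w0, - w0, w1, - w1}"
    by (rule trans[OF S_pairD(4)[OF V, symmetric] S_pairD(4)[OF W]])
  have mem: "w0 \<in> {v0, - v0, v1, - v1}" "w1 \<in> {v0, - v0, v1, - v1}"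
    by (rule ssubst[OF eq], simp)+
  have "\<not> (w0 = v1 \<or> w0 = - v1)"
  proof
    assume "w0 = v1 \<or> w0 = - v1"
    then have "norm_plus w0 = norm_plus v1 \<and> norm_minus w0 = norm_minus v1" by (elim disjE) simp_all
    then show False using v w by linarith
  qed
  moreover have "\<not> (w1 = v0 \<or> w1 = - v0)"
  proof
    assume "w1 = v0 \<or> w1 = - v0"
    then have "norm_plus w1 = norm_plus v0 \<and> norm_minus w1 = norm_minus v0" by (elim disjE) simp_all
    then show False using v w by linarith
  qed
  ultimately have c: "w0 = v0 \<or> w0 = - v0" "w1 = v1 \<or> w1 = - v1" using mem by blast+
  show "norm_minus w0 = norm_minus v0" using c(1) by (elim disjE) simp_all
  show "norm_minus w1 = norm_minus v1" using c(2) by (elim disjE) simp_all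
qed

lemma rho_eq:
  assumes "S_pair L v0 v1"
  shows "rho L = ln (norm_minus v1 / norm_minus v0)"
proof -
  define p where "p = (SOME (v0, v1). S_pair L v0 v1)"
  have "case p of (v0, v1) \<Rightarrow> S_pair L v0 v1"
    unfolding p_def by (rule someI[where x = "(v0, v1)"]) (simp add: assms)
  then obtain w0 w1 where p: "p = (w0, w1)" "S_pair L w0 w1" by (cases p) auto
  have "rho L = ln (norm_minus w1 / norm_minus w0)"
    unfolding rho_def p_def[symmetric] p(1) by simp
  then show ?thesis using S_pair_norm_minus_unique[OF assms p(2)] by simp
qed

text \<open>Any valid pair with \<open>pair_time\<close> zero computes \<open>rho\<close> on
  \<open>S\<close>, so the sublevel sets are countable unions. Measurability is claimed on
  \<open>S\<close> only, where the choice in the definition has a witness.\<close>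

lemma rho_measurable: "rho \<in> borel_measurable (restrict_space lattice_borel S)"
  unfolding borel_measurable_iff_less
proof
  fix a :: real
  have "rho L < a \<longleftrightarrow> (\<exists>i. pair_valid i L \<and> pair_time i L = 0 \<and> ln (norm_minus (pair1 i L) / norm_minus (pair0 i L)) < a)"
    if L: "L \<in> S" for L :: "(real^('a + 'b)) set"
  proof -
    have Ls: "L \<in> lattice_space" using L S_subset by blast
    obtain i0 where i0: "pair_valid i0 L" "pair_time i0 L = 0" using ex_hit_iff[OF Ls, of "\<lambda>t. t = 0"] L by (auto simp: flow_0)
    have re: "rho L = ln (norm_minus (pair1 i L) / norm_minus (pair0 i L))"
      if "pair_valid i L" "pair_time i L = 0" for i
      by (rule rho_eq) (use that in \<open>simp add: pair_valid_def flow_0 flow_matrix_0\<close>)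
    show ?thesis
    proof
      assume "rho L < a"
      then show "\<exists>i. pair_valid i L \<and> pair_time i L = 0 \<and> ln (norm_minus (pair1 i L) / norm_minus (pair0 i L)) < a"
        using i0 re[OF i0] by (intro exI[of _ i0]) simp
    next
      assume "\<exists>i. pair_valid i L \<and> pair_time i L = 0 \<and> ln (norm_minus (pair1 i L) / norm_minus (pair0 i L)) < a"
      then show "rho L < a" using re by (elim exE conjE) simp
    qed
  qed
  then have "{L \<in> S. rho L < a}
     = S \<inter> {L \<in> space lattice_borel. \<exists>i. pair_valid i L \<and> pair_time i L = 0 \<and>
          ln (norm_minus (pair1 i L) / norm_minus (pair0 i (L :: (real^('a + 'b)) set))) < a}" (is "_ = S \<inter> ?T")
    using S_subset unfolding space_lattice_borel by blast
  moreover have "?T \<in> sets lattice_borel" by measurable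
  then have "S \<inter> ?T \<in> sets lattice_borel" using S_sets by (rule sets.Int[rotated])
  ultimately have "{L \<in> S. rho (L :: (real^('a + 'b)) set) < a} \<in> sets lattice_borel" by (simp only:)
  moreover have "S \<inter> lattice_space = (S :: (real^('a + 'b)) set set)" using S_subset by blast
  ultimately show "{L \<in> space (restrict_space lattice_borel S). rho (L :: (real^('a + 'b)) set) < a} \<in> sets (restrict_space lattice_borel S)"
    using S_sets by (subst sets_restrict_space_iff) (simp_all add: space_restrict_space)
qed

text \<open>A coded pair realising the first nonnegative hit. It gives Borel access to
  \<open>q L 0\<close> and to the first hitting time, which are defined through the arbitrary choice
  \<open>min_vec\<close>.\<close>

definition first_pair :: "nat \<Rightarrow> (real^('d::finite + 'c::finite)) set \<Rightarrow> bool" where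
  "first_pair i L \<longleftrightarrow> pair_valid i L \<and> pair_time i L \<ge> 0 \<and>
     (\<forall>j. pair_valid j L \<and> pair_time j L \<ge> 0 \<longrightarrow> pair_time i L \<le> pair_time j L)"

lemma measurable_first_pair [measurable]: "Measurable.pred lattice_borel (first_pair i)"
  unfolding first_pair_def[abs_def] by measurable

context generic_lattice
begin

lemma first_pair_ex: "\<exists>i. first_pair i L"
  and first_pair_eq: "first_pair i L \<Longrightarrow> pair_time i L = hit (min_vec L) 0 \<and> norm_minus (pair0 i L) = q L 0"
proof -
  let ?h = "hit (min_vec L)"
  note e = min_vec_enum(1) and sm = hit_strict_mono[OF min_vec_enum(1)]
  have valid: "\<exists>n. pair_time i L = ?h n \<and> norm_minus (pair0 i L) = norm_minus (min_vec L n)" if "pair_valid i L" for i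
    using S_pair_imp_hit[OF e that[unfolded pair_valid_def]] by metis
  have nonneg: "n \<ge> 0" if "?h n \<ge> 0" for n
    using that min_vec_enum(3) strict_mono_less[OF sm, of "-1" n] by simp
  have "flow (?h 0) L \<in> S" using flow_in_S_iff_hit[OF e] by blast
  then obtain i0 where i0: "pair_valid i0 L" "pair_time i0 L = ?h 0" using ex_hit_iff[OF lat, of "\<lambda>t. t = ?h 0"] by blast
  have "first_pair i0 L"
    unfolding first_pair_def
  proof (intro conjI allI impI)
    show "pair_valid i0 L" "pair_time i0 L \<ge> 0" using i0 min_vec_enum(2) by simp_all
    fix j assume j: "pair_valid j L \<and> pair_time j L \<ge> 0"
    then obtain n where n: "pair_time j L = ?h n" using valid by blast
    then have "n \<ge> 0" using nonneg j by simp
    then show "pair_time i0 L \<le> pair_time j L" using i0(2) n strict_mono_less_eq[OF sm, of 0 n] by simp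
  qed
  then show "\<exists>i. first_pair i L" by blast
  assume f: "first_pair i L"
  then obtain n where n: "pair_time i L = ?h n" "norm_minus (pair0 i L) = norm_minus (min_vec L n)"
    using valid unfolding first_pair_def by blast
  have "n \<ge> 0" using nonneg f n(1) unfolding first_pair_def by simp
  moreover have "?h n \<le> ?h 0" using f i0 n(1) min_vec_enum(2) unfolding first_pair_def by metis
  ultimately have "n = 0" using strict_mono_less_eq[OF sm, of n 0] by simp
  then show "pair_time i L = ?h 0 \<and> norm_minus (pair0 i L) = q L 0" using n unfolding q_def by simp
qed

end

text \<open>The value \<open>0\<close> on \<open>exceptional\<close> makes this function, like
  \<open>first_hit\<close> below, Borel on the whole space.\<close>

definition log_q0 :: "(real^('d::finite + 'c::finite)) set \<Rightarrow> real" where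
  "log_q0 L = (if L \<in> exceptional then 0 else ln (q L 0))"

definition first_hit :: "(real^('d::finite + 'c::finite)) set \<Rightarrow> real" where
  "first_hit L = (if L \<in> exceptional then 0 else hit (min_vec L) 0)"

lemma first_pair_measurable:
  fixes f :: "(real^('d::finite + 'c::finite)) set \<Rightarrow> real"
  assumes g [measurable]: "\<And>i. g i \<in> borel_measurable lattice_borel"
    and f: "\<And>L i. generic_lattice L \<Longrightarrow> first_pair i L \<Longrightarrow> f L = g i L" "\<And>L. L \<in> exceptional \<Longrightarrow> f L = 0"
  shows "f \<in> borel_measurable lattice_borel"
  unfolding borel_measurable_iff_less
proof
  fix a :: real
  have "f L < a \<longleftrightarrow> (L \<in> exceptional \<and> 0 < a) \<or> (L \<notin> exceptional \<and> (\<exists>i. first_pair i L \<and> g i L < a))"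
    if L: "L \<in> lattice_space" for L
  proof (cases "L \<in> exceptional")
    case False
    interpret generic_lattice L by unfold_locales (use L False in auto)
    have fg: "f L = g i L" if "first_pair i L" for i by (rule f(1)[OF generic_lattice_axioms that])
    obtain i0 where i0: "first_pair i0 L" using first_pair_ex by blast
    show ?thesis
    proof
      assume "f L < a"
      then have "first_pair i0 L \<and> g i0 L < a" using i0 fg[OF i0] by simp
      then show "(L \<in> exceptional \<and> 0 < a) \<or> (L \<notin> exceptional \<and> (\<exists>i. first_pair i L \<and> g i L < a))"
        using False by blast
    next
      assume "(L \<in> exceptional \<and> 0 < a) \<or> (L \<notin> exceptional \<and> (\<exists>i. first_pair i L \<and> g i L < a))"
      then obtain i where "first_pair i L" "g i L < a" using False by blast
      then show "f L < a" using fg by simp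
    qed
  qed (simp add: f(2))
  then have "{L \<in> space lattice_borel. f L < a} = {L \<in> space lattice_borel.
      (L \<in> exceptional \<and> 0 < a) \<or> (L \<notin> exceptional \<and> (\<exists>i. first_pair i L \<and> g i L < a))}"
    by (intro Collect_cong) auto
  also have "\<dots> \<in> sets lattice_borel" by measurable
  finally show "{L \<in> space lattice_borel. f L < a} \<in> sets lattice_borel" .
qed

lemma log_q0_measurable [measurable]: "log_q0 \<in> borel_measurable lattice_borel"
proof (rule first_pair_measurable[where g = "\<lambda>i L. ln (norm_minus (pair0 i L))"])
  fix L :: "(real^('a + 'b)) set" and i
  assume g: "generic_lattice L" and p: "first_pair i L"
  show "log_q0 L = ln (norm_minus (pair0 i L))"
    using generic_lattice.first_pair_eq[OF g p] generic_lattice.generic[OF g] by (simp add: log_q0_def)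
qed (simp_all add: log_q0_def)

lemma first_hit_measurable [measurable]: "first_hit \<in> borel_measurable lattice_borel"
proof (rule first_pair_measurable[where g = pair_time])
  fix L :: "(real^('a + 'b)) set" and i
  assume g: "generic_lattice L" and p: "first_pair i L"
  show "first_hit L = pair_time i L"
    using generic_lattice.first_pair_eq[OF g p] generic_lattice.generic[OF g] by (simp add: first_hit_def)
qed (simp_all add: first_hit_def)

text \<open>An integral over counting measure, so that the sum has a value for every window
  \<open>J\<close> and every lattice, including those for which finiteness of the set of hits is not
  established.\<close>

definition hit_sum :: "real set \<Rightarrow> ((real^('d::finite + 'c::finite)) set \<Rightarrow> ennreal) \<Rightarrow> (real^('d + 'c)) set \<Rightarrow> ennreal" where
  "hit_sum J F L = (\<integral>\<^sup>+t. F (flow t L) \<partial>count_space {t \<in> J. flow t L \<in> S})"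

lemma hit_sum_measurable:
  fixes F :: "(real^('d::finite + 'c::finite)) set \<Rightarrow> ennreal"
  assumes J [measurable]: "J \<in> sets borel" and F: "F \<in> borel_measurable (restrict_space lattice_borel S)"
  shows "hit_sum J F \<in> borel_measurable lattice_borel"
proof -
  \<comment> \<open>\<open>F\<close> is Borel on \<open>S\<close> only; extension by zero makes it
    composable with the flow on the whole space, and the sum never sees the difference.\<close>
  define F' where "F' L = F L * indicator S L" for L
  have F' [measurable]: "F' \<in> borel_measurable lattice_borel"
  proof -
    have "S \<inter> space lattice_borel \<in> sets lattice_borel" by (rule sets.Int[OF S_sets sets.top])
    from borel_measurable_restrict_space_iff_ennreal[OF this, of F] F show ?thesis
      by (simp add: F'_def[abs_def])
  qed
  have m: "(\<lambda>L. \<integral>\<^sup>+t. F' (flow t L) \<partial>count_space {pair_time i L | i. pair_valid i L \<and> pair_time i L \<in> J})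
      \<in> borel_measurable lattice_borel"
  proof (rule measurable_nn_integral_countable_graph)
    show "(\<lambda>L. F' (flow (pair_time i L) L)) \<in> borel_measurable lattice_borel" for i
      using measurable_compose[OF measurable_flow_time F'] by simp
  qed measurable
  have eq2: "hit_sum J F L = (\<integral>\<^sup>+t. F' (flow t L) \<partial>count_space {pair_time i L | i. pair_valid i L \<and> pair_time i L \<in> J})"
    if L: "L \<in> space lattice_borel" for L
  proof -
    have "{t \<in> J. flow t L \<in> S} = J \<inter> {t. flow t L \<in> S}" by blast
    also have "\<dots> = {pair_time i L | i. pair_valid i L \<and> pair_time i L \<in> J}"
      using hits_eq_pairs[of L] L by auto
    finally have eq: "{t \<in> J. flow t L \<in> S} = {pair_time i L | i. pair_valid i L \<and> pair_time i L \<in> J}" .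
    have "hit_sum J F L = (\<integral>\<^sup>+t. F' (flow t L) \<partial>count_space {t \<in> J. flow t L \<in> S})"
      unfolding hit_sum_def by (rule nn_integral_cong) (auto simp: F'_def)
    then show ?thesis unfolding eq .
  qed
  show ?thesis by (rule measurable_cong[OF eq2, THEN iffD2, OF _ m])
qed

lemma hit_sum_flow: "hit_sum J F (flow s L) = hit_sum ((\<lambda>t. t + s) ` J) F L"
proof -
  have "bij_betw (\<lambda>t. t + s) {t \<in> J. flow t (flow s L) \<in> S} {t \<in> (\<lambda>t. t + s) ` J. flow t L \<in> S}"
    by (rule bij_betwI[where g = "\<lambda>t. t - s"]) (auto simp: flow_flow)
  from nn_integral_bij_count_space[OF this, of "\<lambda>t. F (flow t L)"] show ?thesis
    unfolding hit_sum_def flow_flow by simp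
qed

lemma hit_sum_Un:
  assumes "J \<inter> J' = {}"
  shows "hit_sum (J \<union> J') F L = hit_sum J F L + hit_sum J' F L"
proof -
  have e: "hit_sum K F L = (\<integral>\<^sup>+t. F (flow t L) * indicator {t \<in> K. flow t L \<in> S} t \<partial>count_space UNIV)" for K
    unfolding hit_sum_def by (simp add: nn_integral_count_space_indicator)
  show ?thesis unfolding e
    by (subst nn_integral_add[symmetric])
       (use assms in \<open>auto simp: indicator_def intro!: nn_integral_cong\<close>)
qed

section \<open>Integration over the transversal\<close>

locale section_flow = lattice_flow \<mu> for \<mu> :: "(real^('d::finite + 'c::finite)) set measure" +
  fixes \<mu>S :: "(real^('d + 'c)) set measure"
  assumes transversal: "transversal_measure \<mu> \<mu>S"
begin

lemma sets_muS: "sets \<mu>S = sets (restrict_space lattice_borel S)"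
  using transversal by (simp add: transversal_measure_def)

lemma space_muS [simp]: "space \<mu>S = S"
  using sets_eq_imp_space_eq[OF sets_muS] S_subset by (auto simp: space_restrict_space)

lemma sets_muS_iff: "B \<in> sets \<mu>S \<longleftrightarrow> B \<in> sets lattice_borel \<and> B \<subseteq> S"
proof -
  have "S \<inter> space lattice_borel \<in> sets lattice_borel" by (rule sets.Int[OF S_sets sets.top])
  from sets_restrict_space_iff[OF this, of B] show ?thesis unfolding sets_muS by blast
qed

lemma measurable_muS: "borel_measurable \<mu>S = borel_measurable (restrict_space lattice_borel S)"
  by (rule measurable_cong_sets[OF sets_muS refl])

lemma indicator_muS: "B \<in> sets lattice_borel \<Longrightarrow> indicator B \<in> borel_measurable \<mu>S"
  unfolding measurable_muS by (rule measurable_restrict_space1) simp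

lemma muS_exceptional: "emeasure \<mu>S (S \<inter> exceptional) = 0"
  using transversal by (simp add: transversal_measure_def)

lemma AE_muS_generic: "AE L in \<mu>S. generic_lattice L"
proof -
  have "S \<inter> exceptional \<in> null_sets \<mu>S"
    using muS_exceptional S_sets exceptional_sets by (auto simp: null_sets_def sets_muS_iff)
  from AE_not_in[OF this] AE_space show ?thesis
  proof eventually_elim
    case (elim L)
    show ?case by unfold_locales (use elim S_subset in auto)
  qed
qed

lemma AE_generic: "AE L in \<mu>. generic_lattice L"
proof -
  have "exceptional \<in> null_sets \<mu>" using exceptional_null by (simp add: null_sets_def)
  from AE_not_in[OF this] AE_space show ?thesis
  proof eventually_elim
    case (elim L)
    show ?case by unfold_locales (use elim in auto)
  qed
qed

lemma flow_box: "B \<in> sets lattice_borel \<Longrightarrow> B \<subseteq> S - exceptional \<Longrightarrow> \<delta> > 0 \<Longrightarrow> (\<And>L. L \<in> B \<Longrightarrow> tau L > \<delta>) \<Longrightarrow>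
    emeasure \<mu> (\<Union>t\<in>{0..\<delta>}. flow t ` B) = ennreal \<delta> * emeasure \<mu>S B"
  using transversal unfolding transversal_measure_def by metis

lemma hit_sum_mu: "J \<in> sets borel \<Longrightarrow> F \<in> borel_measurable \<mu>S \<Longrightarrow> hit_sum J F \<in> borel_measurable \<mu>"
  using hit_sum_measurable[of J F] by (simp add: measurable_muS cong: measurable_cong_sets)

text \<open>As a function of the window \<open>J\<close> this is additive and, \<open>\<mu>\<close>
  being flow invariant, unchanged by translations. It is therefore proportional to length on
  intervals, and short windows, where \<open>transversal\<close> applies, determine the unit
  window.\<close>

definition hit_integral :: "real set \<Rightarrow> ((real^('d + 'c)) set \<Rightarrow> ennreal) \<Rightarrow> ennreal" where
  "hit_integral J F = (\<integral>\<^sup>+L. hit_sum J F L \<partial>\<mu>)"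

lemma hit_integral_shift:
  assumes "J \<in> sets borel" "F \<in> borel_measurable \<mu>S"
  shows "hit_integral ((\<lambda>t. t + s) ` J) F = hit_integral J F"
proof -
  have "hit_integral J F = (\<integral>\<^sup>+L. hit_sum J F L \<partial>distr \<mu> \<mu> (flow s))"
    unfolding hit_integral_def distr_flow ..
  also have "\<dots> = (\<integral>\<^sup>+L. hit_sum J F (flow s L) \<partial>\<mu>)"
    by (rule nn_integral_distr[OF measurable_flow]) (simp add: hit_sum_mu[OF assms])
  finally show ?thesis unfolding hit_sum_flow hit_integral_def by simp
qed

lemma hit_integral_Un:
  assumes "J \<in> sets borel" "J' \<in> sets borel" "J \<inter> J' = {}" "F \<in> borel_measurable \<mu>S"
  shows "hit_integral (J \<union> J') F = hit_integral J F + hit_integral J' F"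
  unfolding hit_integral_def hit_sum_Un[OF assms(3)]
  by (rule nn_integral_add[OF hit_sum_mu[OF assms(1,4)] hit_sum_mu[OF assms(2,4)]])

text \<open>A lattice lies in the flow box over \<open>B\<close> when its orbit meets
  \<open>B\<close> at some time in \<open>[-\<delta>, 0]\<close>, the sign being reversed because
  the box flows forward from \<open>B\<close>. The bound on \<open>tau\<close> allows at most one
  such time, so the sum takes only the values \<open>0\<close> and \<open>1\<close>.\<close>

lemma hit_sum_indicator_box:
  assumes B: "B \<subseteq> S - exceptional" and tau: "\<And>L. L \<in> B \<Longrightarrow> tau L > \<delta>"
  shows "hit_sum {-\<delta>..0} (indicator B) L = indicator (\<Union>t\<in>{0..\<delta>}. flow t ` B) L"
proof -
  have box: "L \<in> (\<Union>t\<in>{0..\<delta>}. flow t ` B) \<longleftrightarrow> (\<exists>t\<in>{-\<delta>..0}. flow t L \<in> B)"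
  proof
    assume "L \<in> (\<Union>t\<in>{0..\<delta>}. flow t ` B)"
    then obtain t b where t: "t \<in> {0..\<delta>}" "b \<in> B" "L = flow t b" by blast
    then have "flow (- t) L \<in> B" by (simp add: flow_flow flow_0)
    moreover have "- t \<in> {-\<delta>..0}" using t(1) by simp
    ultimately show "\<exists>t\<in>{-\<delta>..0}. flow t L \<in> B" by blast
  next
    assume "\<exists>t\<in>{-\<delta>..0}. flow t L \<in> B"
    then obtain t where t: "t \<in> {-\<delta>..0}" "flow t L \<in> B" by blast
    have "L = flow (- t) (flow t L)" by (simp add: flow_flow flow_0)
    moreover have "- t \<in> {0..\<delta>}" using t(1) by simp
    ultimately show "L \<in> (\<Union>t\<in>{0..\<delta>}. flow t ` B)" using t(2) by blast
  qed
  have uniq: False if t: "flow s L \<in> B" "flow t L \<in> B" "s < t" "t - s \<le> \<delta>" for s t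
  proof -
    have "flow s L \<in> lattice_space" "flow s L \<notin> exceptional" using t(1) B S_subset by blast+
    then interpret generic_lattice "flow s L" by unfold_locales
    have "tau (flow s L) \<le> t - s"
      by (rule tau_le) (use t B in \<open>auto simp: flow_flow\<close>)
    then show False using tau[OF t(1)] t(4) by simp
  qed
  show ?thesis
  proof (cases "\<exists>t\<in>{-\<delta>..0}. flow t L \<in> B")
    case True
    then obtain t where t: "t \<in> {-\<delta>..0}" "flow t L \<in> B" by blast
    let ?A = "{t \<in> {-\<delta>..0}. flow t L \<in> S}"
    have tA: "t \<in> ?A" using t B by blast
    have "indicator B (flow u L) = (indicator {t} u :: ennreal)" if "u \<in> ?A" for u
    proof (cases "flow u L \<in> B")
      case True
      have "u = t"
      proof (rule ccontr)
        assume "u \<noteq> t"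
        then consider "u < t" | "t < u" by linarith
        then show False using uniq[OF True t(2)] uniq[OF t(2) True] t(1) that by cases auto
      qed
      then show ?thesis using True by simp
    next
      case False
      then show ?thesis using t(2) by (auto simp: indicator_def)
    qed
    then have "hit_sum {-\<delta>..0} (indicator B) L = (\<integral>\<^sup>+u. indicator {t} u \<partial>count_space ?A)"
      unfolding hit_sum_def by (intro nn_integral_cong) simp
    also have "\<dots> = emeasure (count_space ?A) {t}" by (rule nn_integral_indicator) (use tA in simp)
    also have "\<dots> = 1" by (subst emeasure_count_space_finite) (use tA in auto)
    finally show ?thesis using box True by simp
  next
    case False
    then have "hit_sum {-\<delta>..0} (indicator B) L = (\<integral>\<^sup>+u. 0 \<partial>count_space {t \<in> {-\<delta>..0}. flow t L \<in> S})"
      unfolding hit_sum_def by (intro nn_integral_cong) (auto simp: indicator_def)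
    then show ?thesis using box False by simp
  qed
qed

text \<open>The defining identity of \<open>\<mu>S\<close> gives the measure of the flow box but not
  its measurability; the latter follows as the box is a level set of the Borel function
  \<open>hit_sum\<close>.\<close>

lemma hit_integral_box:
  assumes Bm: "B \<in> sets lattice_borel" and B: "B \<subseteq> S - exceptional" and d: "\<delta> > 0"
    and tau: "\<And>L. L \<in> B \<Longrightarrow> tau L > \<delta>"
  defines "U \<equiv> \<Union>t\<in>{0..\<delta>}. flow t ` B"
  shows "U \<in> sets \<mu>" "hit_integral {-\<delta>..0} (indicator B) = ennreal \<delta> * emeasure \<mu>S B"
proof -
  have hs: "hit_sum {-\<delta>..0} (indicator B) L = indicator U L" for L
    unfolding U_def by (rule hit_sum_indicator_box[OF B tau])
  have UX: "U \<subseteq> lattice_space" unfolding U_def using B S_subset flow_lattice_space by blast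
  have "{L \<in> space \<mu>. hit_sum {-\<delta>..0} (indicator B) L = 1} \<in> sets \<mu>"
    using hit_sum_mu[OF _ indicator_muS[OF Bm], of "{-\<delta>..0}"] by measurable
  moreover have "{L \<in> space \<mu>. hit_sum {-\<delta>..0} (indicator B) L = 1} = U"
    using UX by (auto simp: hs indicator_def)
  ultimately show U: "U \<in> sets \<mu>" by simp
  show "hit_integral {-\<delta>..0} (indicator B) = ennreal \<delta> * emeasure \<mu>S B"
    unfolding hit_integral_def hs using flow_box[OF Bm B d tau] U by (simp add: U_def)
qed

text \<open>\<open>B\<close> is contained in its flow boxes of every height
  \<open>e \<le> \<delta>\<close>, whose measures \<open>e * \<mu>S B\<close> tend to zero;
  \<open>\<mu>S B\<close> is finite since the box of height \<open>\<delta>\<close> has finite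
  measure. This permits passing from closed to half-open windows.\<close>

lemma section_piece_null:
  assumes Bm: "B \<in> sets lattice_borel" and B: "B \<subseteq> S - exceptional" and d: "\<delta> > 0"
    and tau: "\<And>L. L \<in> B \<Longrightarrow> tau L > \<delta>"
  shows "emeasure \<mu> B = 0"
proof -
  have le: "emeasure \<mu> B \<le> ennreal e * emeasure \<mu>S B" if e: "0 < e" "e \<le> \<delta>" for e
  proof -
    have te: "tau L > e" if "L \<in> B" for L using tau[OF that] e(2) by simp
    have "B \<subseteq> (\<Union>t\<in>{0..e}. flow t ` B)"
    proof
      fix L assume "L \<in> B"
      then have "L \<in> flow 0 ` B" by (intro image_eqI[of _ _ L]) (simp_all add: flow_0)
      then show "L \<in> (\<Union>t\<in>{0..e}. flow t ` B)" using e(1) by (intro UN_I[of 0]) simp_all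
    qed
    then have "emeasure \<mu> B \<le> emeasure \<mu> (\<Union>t\<in>{0..e}. flow t ` B)"
      by (rule emeasure_mono) (rule hit_integral_box(1)[OF Bm B e(1) te])
    then show ?thesis using flow_box[OF Bm B e(1) te] by simp
  qed
  have "emeasure \<mu>S B \<noteq> top"
  proof
    assume "emeasure \<mu>S B = top"
    then have "emeasure \<mu> (\<Union>t\<in>{0..\<delta>}. flow t ` B) = top"
      using flow_box[OF Bm B d tau] d by (simp add: ennreal_mult_top)
    then show False using emeasure_finite by blast
  qed
  moreover define m where "m = enn2real (emeasure \<mu>S B)"
  ultimately have m: "emeasure \<mu>S B = ennreal m" "m \<ge> 0" by (simp_all add: less_top)
  define b where "b = measure \<mu> B"
  have b: "emeasure \<mu> B = ennreal b" unfolding b_def by (rule emeasure_eq_measure)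
  have "\<not> b > 0"
  proof
    assume b0: "b > 0"
    define e where "e = min \<delta> (b / (2 * (m + 1)))"
    have e: "0 < e" "e \<le> \<delta>" using d b0 m(2) by (simp_all add: e_def)
    have "ennreal b \<le> ennreal (e * m)" using le[OF e] m b e(1) by (simp add: ennreal_mult)
    then have "b \<le> e * m" using e(1) m(2) by simp
    also have "\<dots> \<le> b / (2 * (m + 1)) * m" using m(2) by (intro mult_right_mono) (simp_all add: e_def)
    also have "\<dots> = (b * m) / (2 * (m + 1))" by simp
    also have "\<dots> < b"
    proof -
      have "b * m < b * (2 * (m + 1))" using b0 m(2) by (intro mult_strict_left_mono) auto
      then show ?thesis using m(2) by (subst pos_divide_less_eq) auto
    qed
    finally show False by simp
  qed
  then show ?thesis using b by (simp add: ennreal_neg)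
qed

text \<open>The closed window \<open>[-e, 0]\<close> loses its null end point, is shifted to
  \<open>[0, e)\<close>, and its translates are added up to \<open>[0, 1)\<close>.\<close>

lemma hit_integral_unit_piece:
  assumes Bm: "B \<in> sets lattice_borel" and B: "B \<subseteq> S - exceptional" and d: "\<delta> > 0"
    and tau: "\<And>L. L \<in> B \<Longrightarrow> tau L > \<delta>"
  shows "hit_integral {0..<1} (indicator B) = emeasure \<mu>S B"
proof -
  note ind = indicator_muS[OF Bm]
  \<comment> \<open>The length \<open>e\<close> is the reciprocal of an integer so that
    \<open>Suc k0\<close> windows tile the unit interval exactly, and it is below
    \<open>\<delta>\<close> so that \<open>B\<close> returns to \<open>S\<close> only after time
    \<open>e\<close>.\<close>
  obtain k0 where k0: "inverse (real (Suc k0)) < \<delta>" using reals_Archimedean[OF d] by blast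
  define e where "e = inverse (real (Suc k0))"
  have e: "0 < e" "e \<le> \<delta>" using k0 by (simp_all add: e_def)
  have te: "tau L > e" if "L \<in> B" for L using tau[OF that] e(2) by simp
  have "hit_sum {0} (indicator B) L = indicator B L" for L
  proof (cases "L \<in> S")
    case True
    then have "{t \<in> {0}. flow t L \<in> S} = {0}" by (auto simp: flow_0)
    then show ?thesis unfolding hit_sum_def by (simp add: nn_integral_count_space_finite flow_0)
  next
    case False
    then have "{t \<in> {0}. flow t L \<in> S} = {}" by (auto simp: flow_0)
    then show ?thesis unfolding hit_sum_def using False B by (auto simp: nn_integral_count_space_finite indicator_def)
  qed
  then have "hit_sum {0} (indicator B) = indicator B" by (rule ext)
  then have z: "hit_integral {0} (indicator B) = 0"
    unfolding hit_integral_def using section_piece_null[OF Bm B d tau] Bm by simp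
  have "{-e..0} = {-e..<0} \<union> {0}" using e(1) by auto
  then have "hit_integral {-e..0} (indicator B) = hit_integral {-e..<0} (indicator B) + hit_integral {0} (indicator B)"
    using hit_integral_Un[OF _ _ _ ind, of "{-e..<0}" "{0}"] by simp
  then have "hit_integral {-e..<0} (indicator B) = ennreal e * emeasure \<mu>S B"
    using hit_integral_box(2)[OF Bm B e(1) te] z by simp
  moreover have "(\<lambda>t. t + e) ` {-e..<0} = {0..<e}"
    using image_add_atLeastLessThan[of e "-e" 0] by (simp add: add.commute)
  ultimately have he: "hit_integral {0..<e} (indicator B) = ennreal e * emeasure \<mu>S B"
    using hit_integral_shift[OF _ ind, of "{-e..<0}" e] by simp
  have "hit_integral {0..<real n * e} (indicator B) = ennreal (real n * e) * emeasure \<mu>S B" for n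
  proof (induction n)
    case 0
    show ?case by (simp add: hit_integral_def hit_sum_def nn_integral_count_space_finite)
  next
    case (Suc n)
    have "(\<lambda>t. t + real n * e) ` {0..<e} = {real n * e..<real (Suc n) * e}"
      using image_add_atLeastLessThan[of "real n * e" 0 e] by (simp add: add.commute algebra_simps)
    then have s: "hit_integral {real n * e..<real (Suc n) * e} (indicator B) = ennreal e * emeasure \<mu>S B"
      using hit_integral_shift[OF _ ind, of "{0..<e}" "real n * e"] he by simp
    have "real n * e \<le> real (Suc n) * e" "0 \<le> real n * e" using e(1) by (simp_all add: mult_right_mono)
    then have "{0..<real (Suc n) * e} = {0..<real n * e} \<union> {real n * e..<real (Suc n) * e}"
      by (simp add: ivl_disj_un_two(3))
    then have "hit_integral {0..<real (Suc n) * e} (indicator B)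
        = ennreal (real n * e) * emeasure \<mu>S B + ennreal e * emeasure \<mu>S B"
      using hit_integral_Un[OF _ _ _ ind, of "{0..<real n * e}" "{real n * e..<real (Suc n) * e}"] Suc s by simp
    also have "\<dots> = (ennreal (real n * e) + ennreal e) * emeasure \<mu>S B" by (simp only: distrib_right)
    also have "ennreal (real n * e) + ennreal e = ennreal (real n * e + e)"
      by (rule ennreal_plus[symmetric]) (use e(1) in auto)
    also have "real n * e + e = real (Suc n) * e" by (simp add: algebra_simps)
    finally show ?case .
  qed
  from this[of "Suc k0"] show ?thesis by (simp add: e_def)
qed

lemma hit_integral_SUP:
  assumes F: "\<And>k. F k \<in> borel_measurable \<mu>S" "incseq F" and J: "J \<in> sets borel"
  shows "hit_integral J (\<lambda>L. SUP k. F k L) = (SUP k. hit_integral J (F k))"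
proof -
  have inc: "incseq (\<lambda>k t. F k (flow t L))" for L
    using F(2) by (auto simp: incseq_def le_fun_def)
  have "hit_sum J (\<lambda>L. SUP k. F k L) L = (SUP k. hit_sum J (F k) L)" for L
    unfolding hit_sum_def by (rule nn_integral_monotone_convergence_SUP[OF inc]) simp
  moreover have "incseq (\<lambda>k. hit_sum J (F k))"
    using F(2) unfolding incseq_def le_fun_def hit_sum_def by (auto intro!: nn_integral_mono)
  then have "(\<integral>\<^sup>+L. (SUP k. hit_sum J (F k) L) \<partial>\<mu>) = (SUP k. \<integral>\<^sup>+L. hit_sum J (F k) L \<partial>\<mu>)"
    by (rule nn_integral_monotone_convergence_SUP) (rule hit_sum_mu[OF J F(1)])
  moreover have "hit_sum J (\<lambda>L. SUP k. F k L) = (\<lambda>L. SUP k. hit_sum J (F k) L)"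
    by (rule ext) fact
  ultimately show ?thesis unfolding hit_integral_def by (simp only:)
qed

lemma hit_integral_cong_generic:
  assumes "\<And>L. generic_lattice L \<Longrightarrow> L \<in> S \<Longrightarrow> F L = G L"
  shows "hit_integral J F = hit_integral J G"
  unfolding hit_integral_def
proof (rule nn_integral_cong_AE)
  show "AE L in \<mu>. hit_sum J F L = hit_sum J G L"
    using AE_generic
  proof eventually_elim
    case (elim L)
    then interpret generic_lattice L .
    show ?case unfolding hit_sum_def by (rule nn_integral_cong) (use assms generic_flow in auto)
  qed
qed

text \<open>\<open>tau\<close> is positive on generic points of \<open>S\<close> but need not be
  bounded below, so \<open>B\<close> is exhausted by the pieces where
  \<open>tau > 1 / Suc k\<close>. The exceptional part is ignored by both sides.\<close>

lemma hit_integral_indicator: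
  assumes Bm: "B \<in> sets lattice_borel" and B: "B \<subseteq> S"
  shows "hit_integral {0..<1} (indicator B) = emeasure \<mu>S B"
proof -
  define C where "C k = {L \<in> space lattice_borel. L \<in> B \<and> L \<notin> exceptional \<and> tau L > 1 / real (Suc k)}" for k
  have Cm: "C k \<in> sets lattice_borel" for k unfolding C_def using Bm by measurable
  have CS: "C k \<subseteq> S - exceptional" for k unfolding C_def using B by blast
  have CmS: "C k \<in> sets \<mu>S" for k unfolding sets_muS_iff using Cm[of k] CS[of k] by blast
  have eqk: "hit_integral {0..<1} (indicator (C k)) = emeasure \<mu>S (C k)" for k
    by (rule hit_integral_unit_piece[OF Cm CS, where \<delta> = "1 / real (Suc k)"]) (auto simp: C_def)
  have inc: "incseq C"
  proof (rule incseq_SucI)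
    fix k
    have "1 / real (Suc (Suc k)) \<le> 1 / real (Suc k)" by (intro divide_left_mono) auto
    then show "C k \<le> C (Suc k)" unfolding C_def by auto
  qed
  have un: "(\<Union>k. C k) = B - exceptional"
  proof (intro set_eqI iffI)
    fix L assume "L \<in> B - exceptional"
    then have L: "L \<in> B" "L \<notin> exceptional" "L \<in> S" "L \<in> lattice_space" using B S_subset by blast+
    then interpret generic_lattice L by unfold_locales
    obtain k where "inverse (real (Suc k)) < tau L" using reals_Archimedean[OF tau_pos[OF L(3)]] by blast
    then show "L \<in> (\<Union>k. C k)" using L by (auto simp: C_def inverse_eq_divide)
  qed (auto simp: C_def)
  have "hit_integral {0..<1} (indicator B) = hit_integral {0..<1} (indicator (\<Union>k. C k))"
    by (rule hit_integral_cong_generic) (auto simp: un indicator_def generic_lattice_def)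
  also have "indicator (\<Union>k. C k) = (\<lambda>L. SUP k. indicator (C k) L :: ennreal)"
  proof
    fix L
    show "indicator (\<Union>k. C k) L = (SUP k. indicator (C k) L :: ennreal)"
    proof (cases "L \<in> (\<Union>k. C k)")
      case True
      then obtain k where "L \<in> C k" by blast
      then have "1 \<le> (SUP k. indicator (C k) L :: ennreal)" by (intro SUP_upper2[of k]) auto
      moreover have "(SUP k. indicator (C k) L :: ennreal) \<le> 1" by (intro SUP_least) (simp add: indicator_def)
      ultimately have "(SUP k. indicator (C k) L :: ennreal) = 1" by (rule antisym[rotated])
      then show ?thesis using True by simp
    qed simp
  qed
  also have "hit_integral {0..<1} (\<lambda>L. SUP k. indicator (C k) L) = (SUP k. hit_integral {0..<1} (indicator (C k)))"
  proof (rule hit_integral_SUP)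
    show "indicator (C k) \<in> borel_measurable \<mu>S" for k by (rule indicator_muS[OF Cm])
    show "incseq (\<lambda>k. indicator (C k) :: _ \<Rightarrow> ennreal)"
      unfolding incseq_def le_fun_def
    proof (intro allI impI)
      fix m n :: nat and L assume "m \<le> n"
      then have "C m \<subseteq> C n" by (rule incseqD[OF inc])
      then show "indicator (C m) L \<le> (indicator (C n) L :: ennreal)" by (auto simp: indicator_def)
    qed
  qed simp
  also have "\<dots> = (SUP k. emeasure \<mu>S (C k))" by (simp only: eqk)
  also have "\<dots> = emeasure \<mu>S (\<Union>k. C k)"
    by (rule SUP_emeasure_incseq[OF _ inc]) (use CmS in blast)
  also have "\<dots> = emeasure \<mu>S B"
  proof -
    have "S \<inter> exceptional \<in> null_sets \<mu>S"
      using muS_exceptional S_sets exceptional_sets by (auto simp: null_sets_def sets_muS_iff)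
    then have "emeasure \<mu>S (B - S \<inter> exceptional) = emeasure \<mu>S B"
      by (rule emeasure_Diff_null_set) (use Bm B in \<open>simp add: sets_muS_iff\<close>)
    moreover have "B - S \<inter> exceptional = B - exceptional" using B by blast
    ultimately show ?thesis by (simp add: un)
  qed
  finally show ?thesis .
qed

text \<open>A Campbell formula, extended from indicators by linearity and monotone limits. It moves
  integrals over \<open>S\<close> to the full space, where the invariant finite measure
  lives.\<close>

lemma hit_integral_eq:
  assumes "F \<in> borel_measurable \<mu>S"
  shows "hit_integral {0..<1} F = (\<integral>\<^sup>+L. F L \<partial>\<mu>S)"
  using assms
proof (induction rule: borel_measurable_induct)
  case (cong f g)
  have "hit_integral {0..<1} f = hit_integral {0..<1} g"
    by (rule hit_integral_cong_generic) (use cong(3) in simp)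
  moreover have "(\<integral>\<^sup>+L. f L \<partial>\<mu>S) = (\<integral>\<^sup>+L. g L \<partial>\<mu>S)" by (rule nn_integral_cong[OF cong(3)])
  ultimately show ?case using cong(4) by simp
next
  case (set A)
  then show ?case using hit_integral_indicator[of A] by (simp add: sets_muS_iff)
next
  case (mult u c)
  have "hit_sum {0..<1} (\<lambda>x. c * u x) L = c * hit_sum {0..<1} u L" for L
    unfolding hit_sum_def by (rule nn_integral_cmult) simp
  then have "hit_sum {0..<1} (\<lambda>x. c * u x) = (\<lambda>L. c * hit_sum {0..<1} u L)" by (rule ext)
  then have "hit_integral {0..<1} (\<lambda>x. c * u x) = c * hit_integral {0..<1} u"
    unfolding hit_integral_def using hit_sum_mu[OF _ mult(2), of "{0..<1}"] by (simp add: nn_integral_cmult)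
  then show ?case using mult(2,4) by (simp add: nn_integral_cmult)
next
  case (add u v)
  have "hit_sum {0..<1} (\<lambda>x. v x + u x) L = hit_sum {0..<1} v L + hit_sum {0..<1} u L" for L
    unfolding hit_sum_def by (rule nn_integral_add) simp_all
  then have "hit_sum {0..<1} (\<lambda>x. v x + u x) = (\<lambda>L. hit_sum {0..<1} v L + hit_sum {0..<1} u L)" by (rule ext)
  then have "hit_integral {0..<1} (\<lambda>x. v x + u x) = hit_integral {0..<1} v + hit_integral {0..<1} u"
    unfolding hit_integral_def using hit_sum_mu[OF _ add(1), of "{0..<1}"] hit_sum_mu[OF _ add(3), of "{0..<1}"]
    by (simp add: nn_integral_add)
  then show ?case using add by (simp add: nn_integral_add)
next
  case (seq U)
  have "hit_integral {0..<1} (\<lambda>L. SUP k. U k L) = (SUP k. hit_integral {0..<1} (U k))"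
    by (rule hit_integral_SUP) (use seq in auto)
  also have "\<dots> = (SUP k. \<integral>\<^sup>+L. U k L \<partial>\<mu>S)" by (simp only: seq.IH)
  also have "\<dots> = (\<integral>\<^sup>+L. (SUP k. U k L) \<partial>\<mu>S)"
    by (rule nn_integral_monotone_convergence_SUP[symmetric]) (use seq in auto)
  finally show ?case by (simp add: SUP_apply[abs_def])
qed

end

section \<open>Hit sums over a unit of time as coboundaries\<close>

context generic_lattice
begin

lemma hit_sum_eq_sum:
  assumes "\<And>t. flow t L \<in> S \<Longrightarrow> f (flow t L) \<ge> 0"
  shows "hit_sum {0..<1} (\<lambda>M. ennreal (f M)) L = ennreal (\<Sum>t\<in>{t \<in> {0..<1}. flow t L \<in> S}. f (flow t L))"
proof -
  have "hit_sum {0..<1} (\<lambda>M. ennreal (f M)) L = (\<Sum>t\<in>{t \<in> {0..<1}. flow t L \<in> S}. ennreal (f (flow t L)))"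
    unfolding hit_sum_def by (rule nn_integral_count_space_finite) (rule finite_hits, simp)
  also have "\<dots> = ennreal (\<Sum>t\<in>{t \<in> {0..<1}. flow t L \<in> S}. f (flow t L))"
    by (rule sum_ennreal) (use assms in blast)
  finally show ?thesis .
qed

text \<open>The second claim records that a sum of nonnegative terms is nonnegative; it is the
  one-sided bound on the coboundary of \<open>log_q0\<close> that replaces integrability of
  \<open>log_q0\<close>.\<close>

lemma hit_sum_rho:
  "hit_sum {0..<1} (\<lambda>M. ennreal (rho M)) L = ennreal (real CARD('d) + (log_q0 (flow 1 L) - log_q0 L))"
  "real CARD('d) + (log_q0 (flow 1 L) - log_q0 L) \<ge> 0"
proof -
  have nn: "rho (flow t L) \<ge> 0" if "flow t L \<in> S" for t
    using generic_lattice.rho_nonneg[OF generic_flow that] .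
  have s: "(\<Sum>t\<in>{t \<in> {0..<1}. flow t L \<in> S}. rho (flow t L)) = real CARD('d) + (log_q0 (flow 1 L) - log_q0 L)"
    using sum_rho_hits[of 1] generic by (simp add: log_q0_def flow_exceptional_iff)
  show "hit_sum {0..<1} (\<lambda>M. ennreal (rho M)) L = ennreal (real CARD('d) + (log_q0 (flow 1 L) - log_q0 L))"
    unfolding s[symmetric] by (rule hit_sum_eq_sum[where f = rho, OF nn])
  show "real CARD('d) + (log_q0 (flow 1 L) - log_q0 L) \<ge> 0"
    unfolding s[symmetric] by (rule sum_nonneg) (use nn in blast)
qed

lemma hit_sum_tau:
  "hit_sum {0..<1} (\<lambda>M. ennreal (tau M)) L = ennreal (1 + (first_hit (flow 1 L) - first_hit L))"
  "1 + (first_hit (flow 1 L) - first_hit L) \<ge> 0"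
proof -
  have nn: "tau (flow t L) \<ge> 0" if "flow t L \<in> S" for t
    using generic_lattice.tau_pos[OF generic_flow that] by simp
  have s: "(\<Sum>t\<in>{t \<in> {0..<1}. flow t L \<in> S}. tau (flow t L)) = 1 + (first_hit (flow 1 L) - first_hit L)"
    using sum_tau_hits[of 1] generic by (simp add: first_hit_def flow_exceptional_iff)
  show "hit_sum {0..<1} (\<lambda>M. ennreal (tau M)) L = ennreal (1 + (first_hit (flow 1 L) - first_hit L))"
    unfolding s[symmetric] by (rule hit_sum_eq_sum[where f = tau, OF nn])
  show "1 + (first_hit (flow 1 L) - first_hit L) \<ge> 0"
    unfolding s[symmetric] by (rule sum_nonneg) (use nn in blast)
qed

lemma hit_sum_1:
  "hit_sum {0..<1} (\<lambda>_. 1) L = ennreal (real (card {t \<in> {0..<1}. flow t L \<in> S}))"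
  using hit_sum_eq_sum[of "\<lambda>_. 1"] by simp

lemma flow_1_funpow: "(flow 1 ^^ k) L = flow (real k) L"
  by (induction k) (simp_all add: flow_0 flow_flow)

lemma sum_card_hits:
  "(\<Sum>k<m. real (card {t \<in> {0..<1}. flow t (flow (real k) L) \<in> S})) = real (card {t \<in> {0..<real m}. flow t L \<in> S})"
proof (induction m)
  case (Suc m)
  have "card {t \<in> {0..<real m + 1}. flow t L \<in> S}
    = card {t \<in> {0..<real m}. flow t L \<in> S} + card {t \<in> {0..<1}. flow t (flow (real m) L) \<in> S}"
    by (rule card_hits_add) simp_all
  moreover have "real (Suc m) = real m + 1" by simp
  ultimately show ?case using Suc by (simp only: sum.lessThan_Suc of_nat_add)
qed simp

text \<open>The averages \<open>R\<close> telescope to \<open>ln (q L (N m)) - ln (q L 0)\<close>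
  over \<open>m\<close>, with \<open>N m\<close> the number of hits before time \<open>m\<close>. So
  growth per unit of time is \<open>d\<close>, growth of the index is \<open>\<kappa>\<close>, and
  monotonicity of \<open>q\<close> fills the gaps between the indices \<open>N m\<close>.\<close>

lemma log_q_limit:
  assumes N: "(\<lambda>m. real (card {t \<in> {0..<real m}. flow t L \<in> S}) / real m) \<longlonglongrightarrow> \<kappa>" and k: "\<kappa> > 0"
    and R: "(\<lambda>m. (\<Sum>k<m. real CARD('d) + (log_q0 (flow 1 (flow (real k) L)) - log_q0 (flow (real k) L))) / real m)
      \<longlonglongrightarrow> real CARD('d)"
  shows "(\<lambda>n. ln (q L (int n)) / real n) \<longlonglongrightarrow> real CARD('d) / \<kappa>"
proof (rule tendsto_along_subsequence_mono[OF _ _ _ N k])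
  let ?N = "\<lambda>m. card {t \<in> {0..<real m}. flow t L \<in> S}"
  show "mono (\<lambda>n. ln (q L (int n)))"
  proof (rule monoI)
    fix m n :: nat assume "m \<le> n"
    then have "q L (int m) \<le> q L (int n)" using strict_mono_less_eq[OF q_strict_mono, of "int m" "int n"] by simp
    then show "ln (q L (int m)) \<le> ln (q L (int n))" using q_pos by simp
  qed
  show "mono ?N"
  proof (rule monoI)
    fix m n :: nat assume "m \<le> n"
    then show "?N m \<le> ?N n" by (intro card_mono finite_hits) auto
  qed
  show "?N 0 = 0" by simp
  have tele: "(\<Sum>k<m. real CARD('d) + (log_q0 (flow 1 (flow (real k) L)) - log_q0 (flow (real k) L)))
      = ln (q L (int (?N m))) - ln (q L 0)" for m
  proof -
    have "flow 1 (flow (real k) L) = flow (real (Suc k)) L" for k by (simp add: flow_flow)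
    then have "(\<Sum>k<m. real CARD('d) + (log_q0 (flow 1 (flow (real k) L)) - log_q0 (flow (real k) L)))
      = (\<Sum>k<m. real CARD('d)) + (\<Sum>k<m. log_q0 (flow (real (Suc k)) L) - log_q0 (flow (real k) L))"
      by (simp only: sum.distrib)
    also have "\<dots> = real CARD('d) * real m + (log_q0 (flow (real m) L) - log_q0 L)"
      using sum_lessThan_telescope[of "\<lambda>k. log_q0 (flow (real k) L)" m] by (simp add: flow_0)
    also have "\<dots> = ln (q L (int (?N m))) - ln (q L 0)"
      using q_card_hits[of "real m"] generic by (simp add: log_q0_def flow_exceptional_iff)
    finally show ?thesis .
  qed
  have "(\<lambda>m. ln (q L 0) / real m) \<longlonglongrightarrow> 0"
    by (intro tendsto_divide_0[OF tendsto_const] filterlim_at_top_imp_at_infinity filterlim_real_sequentially)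
  from tendsto_add[OF R this] show "(\<lambda>m. ln (q L (int (?N m))) / real m) \<longlonglongrightarrow> real CARD('d)"
    unfolding tele by (simp add: add_divide_distrib[symmetric])
  show "real CARD('d) > 0" by simp
qed

end

section \<open>The integrals over the transversal and the almost sure limit\<close>

context section_flow
begin

lemma coboundary_flow:
  fixes f :: "(real^('d + 'c)) set \<Rightarrow> real"
  assumes f: "f \<in> borel_measurable lattice_borel" and C: "C \<ge> 0"
    and lb: "\<And>L. generic_lattice L \<Longrightarrow> C + (f (flow 1 L) - f L) \<ge> 0"
  shows "integrable \<mu> (\<lambda>L. C + (f (flow 1 L) - f L))"
    "(\<integral>L. C + (f (flow 1 L) - f L) \<partial>\<mu>) = C * measure \<mu> lattice_space"
    "(\<integral>\<^sup>+L. ennreal (C + (f (flow 1 L) - f L)) \<partial>\<mu>) = ennreal (C * measure \<mu> lattice_space)"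
proof -
  have fm: "f \<in> borel_measurable \<mu>" using f by (simp cong: measurable_cong_sets)
  have AElb: "AE L in \<mu>. f (flow 1 L) - f L \<ge> - C"
    using AE_generic by eventually_elim (use lb in fastforce)
  note cb = coboundary_integral[OF measurable_flow distr_flow fm C AElb]
  show i: "integrable \<mu> (\<lambda>L. C + (f (flow 1 L) - f L))" using cb(1) by simp
  show e: "(\<integral>L. C + (f (flow 1 L) - f L) \<partial>\<mu>) = C * measure \<mu> lattice_space"
    using cb by (simp add: mult.commute)
  have "AE L in \<mu>. C + (f (flow 1 L) - f L) \<ge> 0" using AE_generic by eventually_elim (rule lb)
  from nn_integral_eq_integral[OF i this]
  show "(\<integral>\<^sup>+L. ennreal (C + (f (flow 1 L) - f L)) \<partial>\<mu>) = ennreal (C * measure \<mu> lattice_space)"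
    unfolding e .
qed

text \<open>The Campbell formula moves the integral to the full space, where the coboundary
  contributes nothing and the constant \<open>C\<close> remains.\<close>

lemma integral_from_hits:
  fixes g f :: "(real^('d + 'c)) set \<Rightarrow> real"
  assumes g: "g \<in> borel_measurable \<mu>S" "\<And>L. generic_lattice L \<Longrightarrow> L \<in> S \<Longrightarrow> g L \<ge> 0"
    and f: "f \<in> borel_measurable lattice_borel" and C: "C \<ge> 0"
    and lb: "\<And>L. generic_lattice L \<Longrightarrow> C + (f (flow 1 L) - f L) \<ge> 0"
    and h: "\<And>L. generic_lattice L \<Longrightarrow> hit_sum {0..<1} (\<lambda>M. ennreal (g M)) L = ennreal (C + (f (flow 1 L) - f L))"
  shows "integrable \<mu>S g" "(\<integral>L. g L \<partial>\<mu>S) = C * measure \<mu> lattice_space"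
proof -
  have "(\<integral>\<^sup>+L. ennreal (g L) \<partial>\<mu>S) = hit_integral {0..<1} (\<lambda>L. ennreal (g L))"
    by (rule hit_integral_eq[symmetric]) (use g(1) in measurable)
  also have "\<dots> = (\<integral>\<^sup>+L. ennreal (C + (f (flow 1 L) - f L)) \<partial>\<mu>)"
    unfolding hit_integral_def
    by (rule nn_integral_cong_AE) (use AE_generic in eventually_elim, rule h)
  also have "\<dots> = ennreal (C * measure \<mu> lattice_space)" by (rule coboundary_flow(3)[OF f C lb])
  finally have nn: "(\<integral>\<^sup>+L. ennreal (g L) \<partial>\<mu>S) = ennreal (C * measure \<mu> lattice_space)" .
  have AEg: "AE L in \<mu>S. g L \<ge> 0"
    using AE_muS_generic AE_space by eventually_elim (use g(2) in simp)
  show "integrable \<mu>S g" by (rule integrableI_nonneg[OF g(1) AEg]) (simp add: nn)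
  show "(\<integral>L. g L \<partial>\<mu>S) = C * measure \<mu> lattice_space"
    using C by (subst integral_eq_nn_integral[OF g(1) AEg]) (simp add: nn)
qed

lemma rho_muS: "integrable \<mu>S rho" "(\<integral>L. rho L \<partial>\<mu>S) = real CARD('d) * measure \<mu> lattice_space"
  by (rule integral_from_hits[OF _ generic_lattice.rho_nonneg log_q0_measurable _ generic_lattice.hit_sum_rho(2) generic_lattice.hit_sum_rho(1)];
      simp add: measurable_muS rho_measurable)+

text \<open>Kac's formula for the flow: the hit sum of \<open>tau\<close> over a unit of time is
  \<open>1\<close> plus the coboundary of \<open>first_hit\<close>.\<close>

lemma tau_muS: "integrable \<mu>S tau" "(\<integral>L. tau L \<partial>\<mu>S) = measure \<mu> lattice_space"
proof -
  have t: "tau \<in> borel_measurable \<mu>S"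
    unfolding measurable_muS by (rule measurable_restrict_space1[OF tau_measurable])
  have p: "tau L \<ge> 0" if "generic_lattice L" "L \<in> S" for L
    using generic_lattice.tau_pos[OF that] by simp
  note i = integral_from_hits[OF t p first_hit_measurable _ generic_lattice.hit_sum_tau(2) generic_lattice.hit_sum_tau(1)]
  show "integrable \<mu>S tau" by (rule i(1)) simp_all
  show "(\<integral>L. tau L \<partial>\<mu>S) = measure \<mu> lattice_space" using i(2) by simp
qed

lemma total_mass_pos: "measure \<mu> lattice_space > 0"
  using invariant_mu unfolding invariant_lattice_measure_def
  by (simp add: emeasure_eq_measure zero_less_measure_iff)

definition hit_count :: "(real^('d + 'c)) set \<Rightarrow> real" where
  "hit_count L = enn2real (hit_sum {0..<1} (\<lambda>_. 1) L)"

lemma hit_count_eq: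
  "generic_lattice L \<Longrightarrow> hit_count L = real (card {t \<in> {0..<1}. flow t L \<in> S})"
  unfolding hit_count_def by (simp add: generic_lattice.hit_sum_1)

text \<open>The Campbell formula for the constant \<open>1\<close> equates the mass of the
  transversal with the mean number of hits per unit of time, and the packing bound makes that number
  bounded.\<close>

lemma hit_count_integral:
  "integrable \<mu> hit_count" "emeasure \<mu>S S < \<infinity>" "(\<integral>L. hit_count L \<partial>\<mu>) = measure \<mu>S S"
proof -
  let ?K = "real (packing_bound TYPE('d) TYPE('c))"
  have m: "hit_count \<in> borel_measurable \<mu>"
    unfolding hit_count_def[abs_def] using hit_sum_mu[of "{0..<1}" "\<lambda>_. 1"] by simp
  have b: "AE L in \<mu>. norm (hit_count L) \<le> ?K"
    using AE_generic
  proof eventually_elim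
    case (elim L)
    then show ?case using generic_lattice.card_hits_le[OF elim] by (simp add: hit_count_eq)
  qed
  show i: "integrable \<mu> hit_count" by (rule integrable_const_bound[OF b m])
  have "emeasure \<mu>S S = (\<integral>\<^sup>+L. 1 \<partial>\<mu>S)" by simp
  also have "\<dots> = hit_integral {0..<1} (\<lambda>_. 1)" by (rule hit_integral_eq[symmetric]) simp
  also have "\<dots> = (\<integral>\<^sup>+L. ennreal (hit_count L) \<partial>\<mu>)"
    unfolding hit_integral_def
  proof (rule nn_integral_cong_AE)
    show "AE L in \<mu>. hit_sum {0..<1} (\<lambda>_. 1) L = ennreal (hit_count L)"
      using AE_generic by eventually_elim (simp add: hit_count_eq generic_lattice.hit_sum_1)
  qed
  also have "\<dots> = ennreal (\<integral>L. hit_count L \<partial>\<mu>)"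
    by (rule nn_integral_eq_integral[OF i]) (simp add: hit_count_def)
  finally have e: "emeasure \<mu>S S = ennreal (\<integral>L. hit_count L \<partial>\<mu>)" .
  then show "emeasure \<mu>S S < \<infinity>" by simp
  have "(\<integral>L. hit_count L \<partial>\<mu>) \<ge> 0" by (rule integral_nonneg_AE) (simp add: hit_count_def)
  then show "(\<integral>L. hit_count L \<partial>\<mu>) = measure \<mu>S S" unfolding measure_def e by simp
qed

text \<open>A null transversal would give \<open>rho\<close> integral zero, whereas its integral is
  \<open>d\<close> times the positive mass of \<open>\<mu>\<close>.\<close>

lemma muS_pos: "emeasure \<mu>S S > 0"
proof (rule ccontr)
  assume "\<not> emeasure \<mu>S S > 0"
  then have "emeasure \<mu>S (space \<mu>S) = 0" by simp
  then have "AE L in \<mu>S. rho L = 0" by (auto intro!: AE_I[of _ _ "space \<mu>S"])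
  then have "(\<integral>L. rho L \<partial>\<mu>S) = 0" by (rule integral_eq_zero_AE)
  then show False using rho_muS(2) total_mass_pos by simp
qed

lemma muS_measure_pos: "measure \<mu>S S > 0"
  using muS_pos hit_count_integral(2) by (simp add: measure_def enn2real_positive_iff)

text \<open>Birkhoff's theorem for the number of hits gives the density
  \<open>\<kappa> = \<mu>S(S) / \<mu>(lattice_space)\<close>; for \<open>d\<close> plus the
  coboundary of \<open>log_q0\<close>, whose integrability comes from the one-sided bound, it gives
  the mean \<open>d\<close>. Their quotient is the limit.\<close>

lemma AE_log_q_limit:
  "AE L in \<mu>. (\<lambda>n. ln (q L (int n)) / real n)
     \<longlonglongrightarrow> real CARD('d) / (measure \<mu>S S / measure \<mu> lattice_space)"
proof -
  let ?f = "\<lambda>L. real CARD('d) + (log_q0 (flow 1 L) - log_q0 L)"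
  note cb = coboundary_flow[OF log_q0_measurable _ generic_lattice.hit_sum_rho(2)]
  have B1: "AE L in \<mu>. (\<lambda>n. (\<Sum>k<n. hit_count ((flow 1 ^^ k) L)) / real n)
      \<longlonglongrightarrow> (\<integral>L. hit_count L \<partial>\<mu>) / measure \<mu> (space \<mu>)"
    by (rule birkhoff_ergodic[OF measurable_flow distr_flow flow_ergodic hit_count_integral(1)])
       (use total_mass_pos in auto)
  have B2: "AE L in \<mu>. (\<lambda>n. (\<Sum>k<n. ?f ((flow 1 ^^ k) L)) / real n)
      \<longlonglongrightarrow> (\<integral>L. ?f L \<partial>\<mu>) / measure \<mu> (space \<mu>)"
  proof (rule birkhoff_ergodic[OF measurable_flow distr_flow flow_ergodic])
    show "integrable \<mu> ?f" by (rule cb(1)) simp_all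
  qed (use total_mass_pos in auto)
  have I2: "(\<integral>L. ?f L \<partial>\<mu>) = real CARD('d) * measure \<mu> lattice_space"
    by (rule cb(2)) simp_all
  from B1 B2 AE_generic show ?thesis
  proof eventually_elim
    case (elim L)
    interpret generic_lattice L by fact
    have c: "hit_count ((flow 1 ^^ k) L) = real (card {t \<in> {0..<1}. flow t (flow (real k) L) \<in> S})" for k
      unfolding flow_1_funpow by (rule hit_count_eq[OF generic_flow])
    show ?case
    proof (rule log_q_limit)
      show "(\<lambda>m. real (card {t \<in> {0..<real m}. flow t L \<in> S}) / real m) \<longlonglongrightarrow> measure \<mu>S S / measure \<mu> lattice_space"
        using elim(1) unfolding c sum_card_hits hit_count_integral(3) space_mu .
      show "measure \<mu>S S / measure \<mu> lattice_space > 0"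
        using muS_measure_pos total_mass_pos by simp
      show "(\<lambda>m. (\<Sum>k<m. ?f (flow (real k) L)) / real m) \<longlonglongrightarrow> real CARD('d)"
        using elim(2) total_mass_pos unfolding I2 flow_1_funpow space_mu by simp
    qed
  qed
qed

end

theorem corollary6p4:
  fixes \<mu> \<mu>S :: "(real^('d::finite + 'c::finite)) set measure"
  assumes "invariant_lattice_measure \<mu>"
    and "transversal_measure \<mu> \<mu>S"
  shows "0 < emeasure \<mu>S S \<and> emeasure \<mu>S S < \<infinity> \<and>
      integrable \<mu>S rho \<and> integrable \<mu>S tau \<and>
      (AE \<Lambda> in \<mu>. (\<exists>X. minimal_sequence \<Lambda> X) \<and>
         (\<lambda>n. 1 / real n * ln (q \<Lambda> (int n))) \<longlonglongrightarrow> levy_const \<mu>S) \<and>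
      levy_const \<mu>S = real CARD('d) / measure \<mu>S S * (\<integral>\<Lambda>. tau \<Lambda> \<partial>\<mu>S) \<and>
      real CARD('d) / measure \<mu>S S * (\<integral>\<Lambda>. tau \<Lambda> \<partial>\<mu>S)
        = real CARD('d) * measure \<mu> lattice_space / measure \<mu>S S"
proof -
  interpret section_flow \<mu> \<mu>S by unfold_locales (use assms in auto)
  have levy: "levy_const \<mu>S = real CARD('d) * measure \<mu> lattice_space / measure \<mu>S S"
    unfolding levy_const_def rho_muS(2) by simp
  have "AE \<Lambda> in \<mu>. (\<exists>X. minimal_sequence \<Lambda> X) \<and> (\<lambda>n. 1 / real n * ln (q \<Lambda> (int n))) \<longlonglongrightarrow> levy_const \<mu>S"
    using AE_generic AE_log_q_limit
  proof eventually_elim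
    case (elim L)
    have "(\<lambda>n. 1 / real n * ln (q L (int n))) = (\<lambda>n. ln (q L (int n)) / real n)" by simp
    then show ?case
      using generic_lattice.ex_minimal_sequence[OF elim(1)] elim(2) by (simp add: levy)
  qed
  then show ?thesis
    using muS_pos hit_count_integral(2) rho_muS(1) tau_muS levy by simp
qed

end
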